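(* Let $k$ be a commutative unital ring and let $X$ be a templicial $k$-module with a naF-structure. Then $X$ is a quasi-category in modules.
   Context: Quivers. For a set $S$, $k\mathrm{Quiv}_S$ is the category of families $Q=(Q(a,b))_{a,b\in S}$ of $k$-modules with componentwise morphisms; it is monoidal with $(Q\otimes_S P)(a,b)=\bigoplus_{c\in S}Q(a,c)\otimes P(c,b)$ and unit $k_S$, where $k_S(a,b)=k$ if $a=b$ and $0$ otherwise. Finite intervals. $\mathbf{\Delta}_f$ has objects $[n]=\{0,\dots,n\}$, $n\ge 0$, and morphisms the order-preserving maps $f:[m]\to[n]$ with $f(0)=0$, $f(m)=n$; it is monoidal with $[m]+[n]=[m+n]$, unit $[0]$, $(f+g)(i)=f(i)$ for $i\le m$ and $m'+g(i-m)$ for $i\ge m$ (where $f:[m]\to[m']$). Templicial modules. A templicial $k$-module is a pair $(X,S)$ with $S$ a set and $X:\mathbf{\Delta}_f^{op}\to k\mathrm{Quiv}_S$ a colax monoidal functor, with comultiplications $\mu_{p,q}:X_{p+q}\to X_p\otimes_S X_q$ and counit $\epsilon:X_0\to k_S$ an isomorphism. For a simplicial set $K$, $\tilde F(K)$ is the templicial $k$-module with vertex set $K_0$, $\tilde F(K)_n(a,b)$ the free $k$-module on the set of $n$-simplices of $K$ with first vertex $a$ and last vertex $b$, inner faces and degeneracies those of $K$, and $\mu_{p,q}$ induced by sending $x\in K_{p+q}$ to (restriction to $\{0,\dots,p\}$)$\otimes$(restriction to $\{p,\dots,p+q\}$). naF-structures. A naF- (nonassociative Frobenius) structure on $(X,S)$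 is a family of quiver morphisms $Z^{p,q}:X_p\otimes_S X_q\to X_{p+q}$ ($p,q\ge 0$), natural in $[p],[q]\in\mathbf{\Delta}_f$, such that $Z^{p,0}(\mathrm{id}\otimes\epsilon^{-1})$ and $Z^{0,q}(\epsilon^{-1}\otimes\mathrm{id})$ are the unit isomorphisms and for all $k,l,p,q\ge0$ with $k+l=p+q$: $\mu_{k,l}Z^{p,q}=(Z^{p,k-p}\otimes\mathrm{id}_{X_l})(\mathrm{id}_{X_p}\otimes\mu_{k-p,l})$ if $p\le k$, and $\mu_{k,l}Z^{p,q}=(\mathrm{id}_{X_k}\otimes Z^{p-k,q})(\mu_{k,p-k}\otimes\mathrm{id}_{X_q})$ if $p\ge k$. (No associativity is required.) Necklaces. $\mathcal Nec$ has objects $(T,p)$ with $p\ge0$ and $T\subseteq[p]$ containing $0$ and $p$; a morphism $(T,p)\to(U,q)$ is $f:[p]\to[q]$ in $\mathbf{\Delta}_f$ with $U\subseteq f(T)$. For $T=\{0=t_0<\dots<t_k=p\}$ put $X_T=X_{t_1}\otimes_S X_{t_2-t_1}\otimes_S\cdots\otimes_S X_{p-t_{k-1}}$ ($k_S$ if $p=0$), and let $\mu_T:X_p\to X_T$ be the iterated comultiplication ($\epsilon$ if $p=0$, identity if $k=1$). This extends to a functor $X_\bullet:\mathcal Nec^{op}\to k\mathrm{Quiv}_S$: each $f:(T,p)\to(U,q)$ factors uniquely as the active map $f:(T,p)\to(f(T),q)$ followed by the inert map $\mathrm{id}_{[q]}:(f(T),q)\to(U,q)$. For an inert map $(T,p)\to(U,p)$,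 $U=\{0=u_0<\dots<u_l=p\}\subseteq T$, $X_U\to X_T$ is $\mu_{T_1}\otimes\cdots\otimes\mu_{T_l}$ with $T_i=\{t-u_{i-1}: t\in T, u_{i-1}\le t\le u_i\}$. For an active map $f$, write uniquely $f=f_1+\dots+f_k$ with $f_i:[t_i-t_{i-1}]\to[f(t_i)-f(t_{i-1})]$ in $\mathbf{\Delta}_f$; then $X_{f(T)}\to X_T$ is $X_{f(T)}\simeq X_{f(t_1)}\otimes_S\cdots\otimes_S X_{q-f(t_{k-1})}\xrightarrow{X(f_1)\otimes\cdots\otimes X(f_k)}X_T$, the isomorphism using $X_0\simeq k_S$. Evaluating at $a,b\in S$ gives $X_\bullet(a,b):\mathcal Nec^{op}\to\mathrm{Mod}(k)$. Quasi-categories in modules. A functor $Y:\mathcal Nec^{op}\to\mathrm{Mod}(k)$ lifts inner horns if for all $0<j<n$ every natural transformation $\tilde F(\Lambda^n_j)_\bullet(0,n)\to Y$ extends along the map $\tilde F(\Lambda^n_j)_\bullet(0,n)\to\tilde F(\Delta^n)_\bullet(0,n)$ induced by the $j$th horn inclusion. A templicial $k$-module $(X,S)$ is a quasi-category in modules if $X_\bullet(a,b)$ lifts inner horns for all $a,b\in S$. *)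

theory Defs
  imports "HOL-Algebra.Module" "HOL-Algebra.AbelCoset" "HOL-Library.FuncSet"
begin

section \<open>Free modules, quotients, linear maps\<close>

text \<open>
  Modules are \<^locale>\<open>module\<close> records over a ring record \<open>R\<close>. The fields \<^const>\<open>mult\<close> and
  \<^const>\<open>one\<close> that such a record inherits from rings play no role for modules.
\<close>

definition linear_maps ::
  "('k, 'z) ring_scheme \<Rightarrow> ('k, 'm) module \<Rightarrow> ('k, 'n) module \<Rightarrow> ('m \<Rightarrow> 'n) set" where
  "linear_maps R M N = {f. f \<in> carrier M \<rightarrow> carrier N \<and>
     (\<forall>x\<in>carrier M. \<forall>y\<in>carrier M. f (x \<oplus>\<^bsub>M\<^esub> y) = f x \<oplus>\<^bsub>N\<^esub> f y) \<and>
     (\<forall>r\<in>carrier R. \<forall>x\<in>carrier M. f (r \<odot>\<^bsub>M\<^esub> x) = r \<odot>\<^bsub>N\<^esub> f x)}"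

definition free_module :: "('k, 'z) ring_scheme \<Rightarrow> 'x set \<Rightarrow> ('k, 'x \<Rightarrow> 'k) module" where
  "free_module R B =
    \<lparr>carrier = {u. (\<forall>x. u x \<in> carrier R) \<and> (\<forall>x. x \<notin> B \<longrightarrow> u x = \<zero>\<^bsub>R\<^esub>) \<and> finite {x. u x \<noteq> \<zero>\<^bsub>R\<^esub>}},
     mult = undefined, one = undefined,
     zero = (\<lambda>x. \<zero>\<^bsub>R\<^esub>), add = (\<lambda>u v x. u x \<oplus>\<^bsub>R\<^esub> v x), smult = (\<lambda>r u x. r \<otimes>\<^bsub>R\<^esub> u x)\<rparr>"

definition free_gen :: "('k, 'z) ring_scheme \<Rightarrow> 'x \<Rightarrow> 'x \<Rightarrow> 'k" where
  "free_gen R x = (\<lambda>y. if y = x then \<one>\<^bsub>R\<^esub> else \<zero>\<^bsub>R\<^esub>)"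

text \<open>The linear extension to the free module of a map \<open>\<phi>\<close> on basis elements.\<close>
definition free_lift ::
  "('k, 'z) ring_scheme \<Rightarrow> ('k, 'n) module \<Rightarrow> ('x \<Rightarrow> 'n) \<Rightarrow> ('x \<Rightarrow> 'k) \<Rightarrow> 'n" where
  "free_lift R N \<phi> u = finsum N (\<lambda>x. u x \<odot>\<^bsub>N\<^esub> \<phi> x) {x. u x \<noteq> \<zero>\<^bsub>R\<^esub>}"

definition submodule_generated ::
  "('k, 'z) ring_scheme \<Rightarrow> ('k, 'm) module \<Rightarrow> 'm set \<Rightarrow> 'm set" where
  "submodule_generated R M G = \<Inter>{N. submodule N R M \<and> G \<subseteq> N}"

definition quotient_module :: "('k, 'm) module \<Rightarrow> 'm set \<Rightarrow> ('k, 'm set) module" where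
  "quotient_module M N =
    \<lparr>carrier = a_rcosets\<^bsub>M\<^esub> N, mult = undefined, one = undefined,
     zero = N, add = set_add M, smult = (\<lambda>r U. \<Union>u\<in>U. N +>\<^bsub>M\<^esub> (r \<odot>\<^bsub>M\<^esub> u))\<rparr>"


section \<open>Quivers and their tensor products\<close>

text \<open>
  A quiver on a vertex set \<open>S\<close> is a family of modules; only its values at vertices in \<open>S\<close>
  matter.

  The tensor product over \<open>S\<close> is formed for finite lists of quivers at once:
  \<open>(Q\<^sub>1 \<otimes> \<dots> \<otimes> Q\<^sub>n)(a,b)\<close> is the module generated by the lists
  \<open>[(a, x\<^sub>1, c\<^sub>1), (c\<^sub>1, x\<^sub>2, c\<^sub>2), \<dots>, (c\<^bsub>n-1\<^esub>, x\<^sub>n, b)]\<close> with \<open>c\<^sub>i \<in> S\<close> and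
  \<open>x\<^sub>i \<in> Q\<^sub>i(c\<^bsub>i-1\<^esub>,c\<^sub>i)\<close>, subject to linearity in each \<open>x\<^sub>i\<close>. This is the direct sum over
  \<open>c\<^sub>1, \<dots>, c\<^bsub>n-1\<^esub>\<close> of the tensor products \<open>Q\<^sub>1(a,c\<^sub>1) \<otimes> \<dots> \<otimes> Q\<^sub>n(c\<^bsub>n-1\<^esub>,b)\<close>. The product of the
  empty list is the unit quiver \<open>k\<^sub>S\<close>: there is no relation, and the only generator is the empty
  list, present if and only if \<open>a = b\<close>. Forming all products in this way makes \<open>\<otimes>\<close> strictly
  associative and unital, so that no coherence isomorphisms occur except for the identification of
  \<open>Q\<close> with the product of the one-element list \<open>[Q]\<close>, see \<open>qwrap\<close> below.
\<close>

type_synonym ('k, 's, 'm) quiver = "'s \<Rightarrow> 's \<Rightarrow> ('k, 'm) module"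
type_synonym ('k, 's, 'm) tens = "(('s \<times> 'm \<times> 's) list \<Rightarrow> 'k) set"

primrec qpaths ::
  "'s set \<Rightarrow> ('k, 's, 'm) quiver list \<Rightarrow> 's \<Rightarrow> 's \<Rightarrow> ('s \<times> 'm \<times> 's) list set" where
  "qpaths S [] a b = {xs. xs = [] \<and> a = b}"
| "qpaths S (Q # Qs) a b =
     {(a, x, c) # xs | x c xs. a \<in> S \<and> c \<in> S \<and> x \<in> carrier (Q a c) \<and> xs \<in> qpaths S Qs c b}"

definition multilinear_relations ::
  "('k, 'z) ring_scheme \<Rightarrow> 's set \<Rightarrow> ('k, 's, 'm) quiver list \<Rightarrow> 's \<Rightarrow> 's
    \<Rightarrow> (('s \<times> 'm \<times> 's) list \<Rightarrow> 'k) set" where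
  "multilinear_relations R S Qs a b =
    (let P = qpaths S Qs a b; F = free_module R P in
     {free_gen R (xs @ (c, x \<oplus>\<^bsub>(Qs ! length xs) c d\<^esub> y, d) # ys)
        \<ominus>\<^bsub>F\<^esub> (free_gen R (xs @ (c, x, d) # ys) \<oplus>\<^bsub>F\<^esub> free_gen R (xs @ (c, y, d) # ys)) | xs c x y d ys.
        xs @ (c, x, d) # ys \<in> P \<and> xs @ (c, y, d) # ys \<in> P} \<union>
     {free_gen R (xs @ (c, r \<odot>\<^bsub>(Qs ! length xs) c d\<^esub> x, d) # ys)
        \<ominus>\<^bsub>F\<^esub> r \<odot>\<^bsub>F\<^esub> free_gen R (xs @ (c, x, d) # ys) | xs c r x d ys.
        r \<in> carrier R \<and> xs @ (c, x, d) # ys \<in> P})"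

definition qtens_rel ::
  "('k, 'z) ring_scheme \<Rightarrow> 's set \<Rightarrow> ('k, 's, 'm) quiver list \<Rightarrow> 's \<Rightarrow> 's
    \<Rightarrow> (('s \<times> 'm \<times> 's) list \<Rightarrow> 'k) set" where
  "qtens_rel R S Qs a b =
     submodule_generated R (free_module R (qpaths S Qs a b)) (multilinear_relations R S Qs a b)"

definition qtens ::
  "('k, 'z) ring_scheme \<Rightarrow> 's set \<Rightarrow> ('k, 's, 'm) quiver list
    \<Rightarrow> 's \<Rightarrow> 's \<Rightarrow> ('k, ('k, 's, 'm) tens) module" where
  "qtens R S Qs a b =
     quotient_module (free_module R (qpaths S Qs a b)) (qtens_rel R S Qs a b)"

definition ptens ::
  "('k, 'z) ring_scheme \<Rightarrow> 's set \<Rightarrow> ('k, 's, 'm) quiver list \<Rightarrow> 's \<Rightarrow> 's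
    \<Rightarrow> ('s \<times> 'm \<times> 's) list \<Rightarrow> ('k, 's, 'm) tens" where
  "ptens R S Qs a b xs =
     qtens_rel R S Qs a b +>\<^bsub>free_module R (qpaths S Qs a b)\<^esub> free_gen R xs"

text \<open>
  The linear map on a tensor product with prescribed values \<open>\<phi>\<close> on pure tensors. It is computed on an
  arbitrary representative, and hence is meaningful if \<open>\<phi>\<close> is linear in each tensor factor, as it
  is whenever this constant is used.
\<close>
definition qtens_lift ::
  "('k, 'z) ring_scheme \<Rightarrow> ('k, 'n) module \<Rightarrow> (('s \<times> 'm \<times> 's) list \<Rightarrow> 'n)
    \<Rightarrow> ('k, 's, 'm) tens \<Rightarrow> 'n" where
  "qtens_lift R N \<phi> U = free_lift R N \<phi> (SOME u. u \<in> U)"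

text \<open>The concatenation product of tensors with domains \<open>Qs\<close> from \<open>a\<close> to \<open>c\<close> and \<open>Ps\<close> from \<open>c\<close> to \<open>b\<close>.\<close>
definition qcat ::
  "('k, 'z) ring_scheme \<Rightarrow> 's set \<Rightarrow> ('k, 's, 'm) quiver list \<Rightarrow> ('k, 's, 'm) quiver list
    \<Rightarrow> 's \<Rightarrow> 's \<Rightarrow> ('k, 's, 'm) tens \<Rightarrow> ('k, 's, 'm) tens \<Rightarrow> ('k, 's, 'm) tens" where
  "qcat R S Qs Ps a b U V =
     (let N = qtens R S (Qs @ Ps) a b in
      qtens_lift R N (\<lambda>xs. qtens_lift R N (\<lambda>ys. ptens R S (Qs @ Ps) a b (xs @ ys)) V) U)"


section \<open>Morphisms between tensor products\<close>

record ('k, 's, 'm) qarr =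
  qdom :: "('k, 's, 'm) quiver list"
  qcod :: "('k, 's, 'm) quiver list"
  qfun :: "'s \<Rightarrow> 's \<Rightarrow> ('k, 's, 'm) tens \<Rightarrow> ('k, 's, 'm) tens"

definition qarr_eq ::
  "('k, 'z) ring_scheme \<Rightarrow> 's set \<Rightarrow> ('k, 's, 'm) qarr \<Rightarrow> ('k, 's, 'm) qarr \<Rightarrow> bool" where
  "qarr_eq R S f g \<longleftrightarrow> qdom f = qdom g \<and> qcod f = qcod g \<and>
     (\<forall>a\<in>S. \<forall>b\<in>S. \<forall>u\<in>carrier (qtens R S (qdom f) a b). qfun f a b u = qfun g a b u)"

definition qid :: "('k, 's, 'm) quiver list \<Rightarrow> ('k, 's, 'm) qarr" where
  "qid Qs = \<lparr>qdom = Qs, qcod = Qs, qfun = (\<lambda>a b u. u)\<rparr>"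

definition qcomp :: "('k, 's, 'm) qarr \<Rightarrow> ('k, 's, 'm) qarr \<Rightarrow> ('k, 's, 'm) qarr" where
  "qcomp g f = \<lparr>qdom = qdom f, qcod = qcod g, qfun = (\<lambda>a b u. qfun g a b (qfun f a b u))\<rparr>"

text \<open>
  The tensor product of two morphisms, characterised by
  \<open>(f \<otimes> g)(u \<otimes> v) = f u \<otimes> g v\<close>. The vertex \<open>c\<close> is the one at which the path \<open>xs\<close> passes from
  the factors of the first to those of the second domain.
\<close>
definition qtensor ::
  "('k, 'z) ring_scheme \<Rightarrow> 's set \<Rightarrow> ('k, 's, 'm) qarr \<Rightarrow> ('k, 's, 'm) qarr
    \<Rightarrow> ('k, 's, 'm) qarr" where
  "qtensor R S f g =
    \<lparr>qdom = qdom f @ qdom g, qcod = qcod f @ qcod g,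
     qfun = (\<lambda>a b. qtens_lift R (qtens R S (qcod f @ qcod g) a b)
       (\<lambda>xs. let ys = take (length (qdom f)) xs; zs = drop (length (qdom f)) xs;
                 c = (if ys = [] then a else snd (snd (last ys)))
             in qcat R S (qcod f) (qcod g) a b
                  (qfun f a c (ptens R S (qdom f) a c ys))
                  (qfun g c b (ptens R S (qdom g) c b zs))))\<rparr>"

definition qtensor_list ::
  "('k, 'z) ring_scheme \<Rightarrow> 's set \<Rightarrow> ('k, 's, 'm) qarr list \<Rightarrow> ('k, 's, 'm) qarr" where
  "qtensor_list R S fs = foldr (qtensor R S) fs (qid [])"

text \<open>The isomorphism from \<open>Q\<close> to the tensor product of \<open>[Q]\<close>, and its inverse.\<close>
definition qwrap ::
  "('k, 'z) ring_scheme \<Rightarrow> 's set \<Rightarrow> ('k, 's, 'm) quiver \<Rightarrow> 's \<Rightarrow> 's \<Rightarrow> 'm \<Rightarrow> ('k, 's, 'm) tens" where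
  "qwrap R S Q a b x = ptens R S [Q] a b [(a, x, b)]"

definition qunwrap ::
  "('k, 'z) ring_scheme \<Rightarrow> 's set \<Rightarrow> ('k, 's, 'm) quiver \<Rightarrow> 's \<Rightarrow> 's \<Rightarrow> ('k, 's, 'm) tens \<Rightarrow> 'm" where
  "qunwrap R S Q a b = inv_into (carrier (Q a b)) (qwrap R S Q a b)"


section \<open>Finite intervals\<close>

text \<open>Maps out of \<open>[m] = {0..m}\<close> are represented by functions that are \<^const>\<open>undefined\<close> outside \<open>{0..m}\<close>.\<close>

definition mono_maps :: "nat \<Rightarrow> nat \<Rightarrow> (nat \<Rightarrow> nat) set" where
  "mono_maps m n = {f \<in> {0..m} \<rightarrow>\<^sub>E {0..n}. mono_on {0..m} f}"

definition fint_maps :: "nat \<Rightarrow> nat \<Rightarrow> (nat \<Rightarrow> nat) set" where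
  "fint_maps m n = {f \<in> mono_maps m n. f 0 = 0 \<and> f m = n}"

text \<open>\<open>f + g\<close> for \<open>f : [m] \<rightarrow> [m']\<close> and \<open>g\<close> with source \<open>[n]\<close>.\<close>
definition fint_sum :: "nat \<Rightarrow> nat \<Rightarrow> nat \<Rightarrow> (nat \<Rightarrow> nat) \<Rightarrow> (nat \<Rightarrow> nat) \<Rightarrow> nat \<Rightarrow> nat" where
  "fint_sum m m' n f g = (\<lambda>i\<in>{0..m + n}. if i \<le> m then f i else m' + g (i - m))"


section \<open>Templicial modules\<close>

text \<open>
  For \<open>f : [m] \<rightarrow> [n]\<close>, \<open>tact X m n f a b\<close> is the map \<open>X\<^sub>n(a,b) \<rightarrow> X\<^sub>m(a,b)\<close>. The
  comultiplication \<open>tcomult X p q\<close> takes values in the tensor product of \<open>[X\<^sub>p, X\<^sub>q]\<close>, the counit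
  in that of \<open>[]\<close>, which is \<open>k\<^sub>S\<close>.
\<close>
record ('k, 's, 'm) templicial =
  tverts :: "'s set"
  tsimp :: "nat \<Rightarrow> ('k, 's, 'm) quiver"
  tact :: "nat \<Rightarrow> nat \<Rightarrow> (nat \<Rightarrow> nat) \<Rightarrow> 's \<Rightarrow> 's \<Rightarrow> 'm \<Rightarrow> 'm"
  tcomult :: "nat \<Rightarrow> nat \<Rightarrow> 's \<Rightarrow> 's \<Rightarrow> 'm \<Rightarrow> ('k, 's, 'm) tens"
  tcounit :: "'s \<Rightarrow> 's \<Rightarrow> 'm \<Rightarrow> ('k, 's, 'm) tens"

definition id_arr :: "('k, 's, 'm) templicial \<Rightarrow> nat \<Rightarrow> ('k, 's, 'm) qarr" where
  "id_arr X n = qid [tsimp X n]"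

definition act_arr ::
  "('k, 'z) ring_scheme \<Rightarrow> ('k, 's, 'm) templicial \<Rightarrow> nat \<Rightarrow> nat \<Rightarrow> (nat \<Rightarrow> nat)
    \<Rightarrow> ('k, 's, 'm) qarr" where
  "act_arr R X m n f = \<lparr>qdom = [tsimp X n], qcod = [tsimp X m],
     qfun = (\<lambda>a b u. qwrap R (tverts X) (tsimp X m) a b
       (tact X m n f a b (qunwrap R (tverts X) (tsimp X n) a b u)))\<rparr>"

definition comult_arr ::
  "('k, 'z) ring_scheme \<Rightarrow> ('k, 's, 'm) templicial \<Rightarrow> nat \<Rightarrow> nat \<Rightarrow> ('k, 's, 'm) qarr" where
  "comult_arr R X p q = \<lparr>qdom = [tsimp X (p + q)], qcod = [tsimp X p, tsimp X q],
     qfun = (\<lambda>a b u. tcomult X p q a b (qunwrap R (tverts X) (tsimp X (p + q)) a b u))\<rparr>"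

definition counit_arr ::
  "('k, 'z) ring_scheme \<Rightarrow> ('k, 's, 'm) templicial \<Rightarrow> ('k, 's, 'm) qarr" where
  "counit_arr R X = \<lparr>qdom = [tsimp X 0], qcod = [],
     qfun = (\<lambda>a b u. tcounit X a b (qunwrap R (tverts X) (tsimp X 0) a b u))\<rparr>"

definition counit_inv_arr ::
  "('k, 'z) ring_scheme \<Rightarrow> ('k, 's, 'm) templicial \<Rightarrow> ('k, 's, 'm) qarr" where
  "counit_inv_arr R X = \<lparr>qdom = [], qcod = [tsimp X 0],
     qfun = (\<lambda>a b u. qwrap R (tverts X) (tsimp X 0) a b
       (inv_into (carrier (tsimp X 0 a b)) (tcounit X a b) u))\<rparr>"

definition templicial_module ::
  "('k, 'z) ring_scheme \<Rightarrow> ('k, 's, 'm) templicial \<Rightarrow> bool" where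
  "templicial_module R X \<longleftrightarrow>
    (let S = tverts X in
     (\<forall>n. \<forall>a\<in>S. \<forall>b\<in>S. module R (tsimp X n a b)) \<and>
     (\<forall>m n. \<forall>f\<in>fint_maps m n. \<forall>a\<in>S. \<forall>b\<in>S.
        tact X m n f a b \<in> linear_maps R (tsimp X n a b) (tsimp X m a b)) \<and>
     (\<forall>n. \<forall>a\<in>S. \<forall>b\<in>S. \<forall>x\<in>carrier (tsimp X n a b). tact X n n (\<lambda>i\<in>{0..n}. i) a b x = x) \<and>
     (\<forall>l m n. \<forall>f\<in>fint_maps l m. \<forall>g\<in>fint_maps m n. \<forall>a\<in>S. \<forall>b\<in>S. \<forall>x\<in>carrier (tsimp X n a b).
        tact X l n (compose {0..l} g f) a b x = tact X l m f a b (tact X m n g a b x)) \<and>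
     (\<forall>p q. \<forall>a\<in>S. \<forall>b\<in>S. tcomult X p q a b \<in>
        linear_maps R (tsimp X (p + q) a b) (qtens R S [tsimp X p, tsimp X q] a b)) \<and>
     (\<forall>p p' q q'. \<forall>f\<in>fint_maps p p'. \<forall>g\<in>fint_maps q q'. qarr_eq R S
        (qcomp (qtensor R S (act_arr R X p p' f) (act_arr R X q q' g)) (comult_arr R X p' q'))
        (qcomp (comult_arr R X p q) (act_arr R X (p + q) (p' + q') (fint_sum p p' q f g)))) \<and>
     (\<forall>a\<in>S. \<forall>b\<in>S. tcounit X a b \<in> linear_maps R (tsimp X 0 a b) (qtens R S [] a b) \<and>
        bij_betw (tcounit X a b) (carrier (tsimp X 0 a b)) (carrier (qtens R S [] a b))) \<and>
     (\<forall>p q r. qarr_eq R S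
        (qcomp (qtensor R S (comult_arr R X p q) (id_arr X r)) (comult_arr R X (p + q) r))
        (qcomp (qtensor R S (id_arr X p) (comult_arr R X q r)) (comult_arr R X p (q + r)))) \<and>
     (\<forall>n. qarr_eq R S
        (qcomp (qtensor R S (counit_arr R X) (id_arr X n)) (comult_arr R X 0 n)) (id_arr X n)) \<and>
     (\<forall>n. qarr_eq R S
        (qcomp (qtensor R S (id_arr X n) (counit_arr R X)) (comult_arr R X n 0)) (id_arr X n)))"


section \<open>Nonassociative Frobenius structures\<close>

type_synonym ('k, 's, 'm) naF_data =
  "nat \<Rightarrow> nat \<Rightarrow> 's \<Rightarrow> 's \<Rightarrow> ('k, 's, 'm) tens \<Rightarrow> 'm"

definition naF_arr ::
  "('k, 'z) ring_scheme \<Rightarrow> ('k, 's, 'm) templicial \<Rightarrow> ('k, 's, 'm) naF_data \<Rightarrow> nat \<Rightarrow> nat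
    \<Rightarrow> ('k, 's, 'm) qarr" where
  "naF_arr R X Z p q = \<lparr>qdom = [tsimp X p, tsimp X q], qcod = [tsimp X (p + q)],
     qfun = (\<lambda>a b u. qwrap R (tverts X) (tsimp X (p + q)) a b (Z p q a b u))\<rparr>"

definition naF_structure ::
  "('k, 'z) ring_scheme \<Rightarrow> ('k, 's, 'm) templicial \<Rightarrow> ('k, 's, 'm) naF_data \<Rightarrow> bool" where
  "naF_structure R X Z \<longleftrightarrow>
    (let S = tverts X in
     (\<forall>p q. \<forall>a\<in>S. \<forall>b\<in>S. Z p q a b \<in>
        linear_maps R (qtens R S [tsimp X p, tsimp X q] a b) (tsimp X (p + q) a b)) \<and>
     (\<forall>p p' q q'. \<forall>f\<in>fint_maps p p'. \<forall>g\<in>fint_maps q q'. qarr_eq R S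
        (qcomp (naF_arr R X Z p q) (qtensor R S (act_arr R X p p' f) (act_arr R X q q' g)))
        (qcomp (act_arr R X (p + q) (p' + q') (fint_sum p p' q f g)) (naF_arr R X Z p' q'))) \<and>
     (\<forall>p. qarr_eq R S
        (qcomp (naF_arr R X Z p 0) (qtensor R S (id_arr X p) (counit_inv_arr R X))) (id_arr X p)) \<and>
     (\<forall>q. qarr_eq R S
        (qcomp (naF_arr R X Z 0 q) (qtensor R S (counit_inv_arr R X) (id_arr X q))) (id_arr X q)) \<and>
     (\<forall>k l p q. k + l = p + q \<and> p \<le> k \<longrightarrow> qarr_eq R S
        (qcomp (comult_arr R X k l) (naF_arr R X Z p q))
        (qcomp (qtensor R S (naF_arr R X Z p (k - p)) (id_arr X l))
               (qtensor R S (id_arr X p) (comult_arr R X (k - p) l)))) \<and>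
     (\<forall>k l p q. k + l = p + q \<and> k \<le> p \<longrightarrow> qarr_eq R S
        (qcomp (comult_arr R X k l) (naF_arr R X Z p q))
        (qcomp (qtensor R S (id_arr X k) (naF_arr R X Z (p - k) q))
               (qtensor R S (comult_arr R X k (p - k)) (id_arr X q)))))"


section \<open>Necklaces and the functor of a templicial module\<close>

type_synonym necklace = "nat set \<times> nat"

definition necklaces :: "necklace set" where
  "necklaces = {(T, p). T \<subseteq> {0..p} \<and> 0 \<in> T \<and> p \<in> T}"

definition necklace_maps :: "necklace \<Rightarrow> necklace \<Rightarrow> (nat \<Rightarrow> nat) set" where
  "necklace_maps A B = {f \<in> fint_maps (snd A) (snd B). fst B \<subseteq> f ` fst A}"

text \<open>The pairs \<open>(t\<^bsub>i-1\<^esub>, t\<^sub>i)\<close> for \<open>T = {t\<^sub>0 < \<dots> < t\<^sub>k}\<close>, and the differences \<open>t\<^sub>i - t\<^bsub>i-1\<^esub>\<close>.\<close>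
definition steps :: "nat set \<Rightarrow> (nat \<times> nat) list" where
  "steps T = (let ts = sorted_list_of_set T in zip (butlast ts) (tl ts))"

definition gaps :: "nat set \<Rightarrow> nat list" where
  "gaps T = map (\<lambda>(s, t). t - s) (steps T)"

text \<open>For the differences of \<open>T\<close> this is \<open>\<mu>\<^sub>T\<close>; by coassociativity the choice of bracketing is immaterial.\<close>
fun iterated_comult ::
  "('k, 'z) ring_scheme \<Rightarrow> ('k, 's, 'm) templicial \<Rightarrow> nat list \<Rightarrow> ('k, 's, 'm) qarr" where
  "iterated_comult R X [] = counit_arr R X"
| "iterated_comult R X [n] = id_arr X n"
| "iterated_comult R X (n # m # ns) =
     qcomp (qtensor R (tverts X) (id_arr X n) (iterated_comult R X (m # ns)))
           (comult_arr R X n (sum_list (m # ns)))"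

text \<open>The map \<open>X\<^sub>U \<rightarrow> X\<^sub>T\<close> for \<open>U \<subseteq> T\<close>.\<close>
definition inert_arr ::
  "('k, 'z) ring_scheme \<Rightarrow> ('k, 's, 'm) templicial \<Rightarrow> nat set \<Rightarrow> nat set
    \<Rightarrow> ('k, 's, 'm) qarr" where
  "inert_arr R X T U = qtensor_list R (tverts X)
     (map (\<lambda>(s, t). iterated_comult R X (gaps ((\<lambda>i. i - s) ` {i \<in> T. s \<le> i \<and> i \<le> t}))) (steps U))"

text \<open>
  The map \<open>X\<^bsub>f(T)\<^esub> \<rightarrow> X\<^sub>T\<close>. The steps of \<open>T\<close> that \<open>f\<close> collapses have no counterpart in \<open>f(T)\<close>;
  for these a factor \<open>X\<^sub>0\<close> is first inserted by means of the inverse of the counit.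
\<close>
definition active_arr ::
  "('k, 'z) ring_scheme \<Rightarrow> ('k, 's, 'm) templicial \<Rightarrow> nat set \<Rightarrow> (nat \<Rightarrow> nat)
    \<Rightarrow> ('k, 's, 'm) qarr" where
  "active_arr R X T f = qcomp
     (qtensor_list R (tverts X)
       (map (\<lambda>(s, t). act_arr R X (t - s) (f t - f s) (\<lambda>i\<in>{0..t - s}. f (s + i) - f s)) (steps T)))
     (qtensor_list R (tverts X)
       (map (\<lambda>(s, t). if f t = f s then counit_inv_arr R X else id_arr X (f t - f s)) (steps T)))"

text \<open>Contravariant functors on necklaces: for \<open>f : A \<rightarrow> B\<close>, \<open>nmap Y A B f\<close> is the map from
  \<open>nobj Y B\<close> to \<open>nobj Y A\<close>.\<close>
record ('k, 'm) necklace_module =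
  nobj :: "necklace \<Rightarrow> ('k, 'm) module"
  nmap :: "necklace \<Rightarrow> necklace \<Rightarrow> (nat \<Rightarrow> nat) \<Rightarrow> 'm \<Rightarrow> 'm"

definition necklace_functor ::
  "('k, 'z) ring_scheme \<Rightarrow> ('k, 's, 'm) templicial \<Rightarrow> 's \<Rightarrow> 's
    \<Rightarrow> ('k, ('k, 's, 'm) tens) necklace_module" where
  "necklace_functor R X a b =
    \<lparr>nobj = (\<lambda>(T, p). qtens R (tverts X) (map (tsimp X) (gaps T)) a b),
     nmap = (\<lambda>(T, p) (U, q) f.
       qfun (qcomp (active_arr R X T f) (inert_arr R X (f ` T) U)) a b)\<rparr>"

definition necklace_nat_trans ::
  "('k, 'z) ring_scheme \<Rightarrow> ('k, 'm) necklace_module \<Rightarrow> ('k, 'n) necklace_module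
    \<Rightarrow> (necklace \<Rightarrow> 'm \<Rightarrow> 'n) \<Rightarrow> bool" where
  "necklace_nat_trans R Y Y' \<alpha> \<longleftrightarrow>
     (\<forall>A\<in>necklaces. \<alpha> A \<in> linear_maps R (nobj Y A) (nobj Y' A)) \<and>
     (\<forall>A\<in>necklaces. \<forall>B\<in>necklaces. \<forall>f\<in>necklace_maps A B. \<forall>u\<in>carrier (nobj Y B).
        \<alpha> A (nmap Y A B f u) = nmap Y' A B f (\<alpha> B u))"


section \<open>Simplicial sets and their free templicial modules\<close>

text \<open>For \<open>f : [m] \<rightarrow> [n]\<close>, \<open>sact K m n f\<close> is the map \<open>K\<^sub>n \<rightarrow> K\<^sub>m\<close>.\<close>
record 'x simplicial_set =
  ssimp :: "nat \<Rightarrow> 'x set"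
  sact :: "nat \<Rightarrow> nat \<Rightarrow> (nat \<Rightarrow> nat) \<Rightarrow> 'x \<Rightarrow> 'x"

definition svertex :: "'x simplicial_set \<Rightarrow> nat \<Rightarrow> nat \<Rightarrow> 'x \<Rightarrow> 'x" where
  "svertex K n i = sact K 0 n (\<lambda>_\<in>{0..0}. i)"

definition free_templicial ::
  "('k, 'z) ring_scheme \<Rightarrow> 'x simplicial_set \<Rightarrow> ('k, 'x, 'x \<Rightarrow> 'k) templicial" where
  "free_templicial R K =
    (let Q = (\<lambda>n a b. free_module R {x \<in> ssimp K n. svertex K n 0 x = a \<and> svertex K n n x = b}) in
     \<lparr>tverts = ssimp K 0,
      tsimp = Q,
      tact = (\<lambda>m n f a b. free_lift R (Q m a b) (\<lambda>x. free_gen R (sact K m n f x))),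
      tcomult = (\<lambda>p q a b. free_lift R (qtens R (ssimp K 0) [Q p, Q q] a b)
        (\<lambda>x. let c = svertex K (p + q) p x in ptens R (ssimp K 0) [Q p, Q q] a b
           [(a, free_gen R (sact K p (p + q) (\<lambda>i\<in>{0..p}. i) x), c),
            (c, free_gen R (sact K q (p + q) (\<lambda>i\<in>{0..q}. p + i) x), b)])),
      tcounit = (\<lambda>a b. free_lift R (qtens R (ssimp K 0) [] a b)
        (\<lambda>x. ptens R (ssimp K 0) [] a b []))\<rparr>)"

text \<open>The map from \<open>F(K)\<^sub>T(a,b)\<close> to \<open>F(L)\<^sub>T(\<phi> a, \<phi> b)\<close> induced by a simplicial map \<open>\<phi> : K \<rightarrow> L\<close>, where \<open>F\<close> is
  \<^const>\<open>free_templicial\<close>.\<close>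
definition free_necklace_map ::
  "('k, 'z) ring_scheme \<Rightarrow> 'y simplicial_set \<Rightarrow> (nat \<Rightarrow> 'x \<Rightarrow> 'y) \<Rightarrow> necklace \<Rightarrow> 'x \<Rightarrow> 'x
    \<Rightarrow> ('k, 'x, 'x \<Rightarrow> 'k) tens \<Rightarrow> ('k, 'y, 'y \<Rightarrow> 'k) tens" where
  "free_necklace_map R L \<phi> A a b =
    (let X = free_templicial R L; ns = gaps (fst A); Qs = map (tsimp X) ns in
     qtens_lift R (qtens R (tverts X) Qs (\<phi> 0 a) (\<phi> 0 b))
       (\<lambda>xs. ptens R (tverts X) Qs (\<phi> 0 a) (\<phi> 0 b)
          (map2 (\<lambda>n (c, u, d). (\<phi> 0 c,
             free_lift R (tsimp X n (\<phi> 0 c) (\<phi> 0 d)) (\<lambda>x. free_gen R (\<phi> n x)) u, \<phi> 0 d)) ns xs)))"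

definition std_simplex :: "nat \<Rightarrow> (nat \<Rightarrow> nat) simplicial_set" where
  "std_simplex n =
    \<lparr>ssimp = (\<lambda>m. mono_maps m n), sact = (\<lambda>l m f x. compose {0..l} x f)\<rparr>"

definition horn :: "nat \<Rightarrow> nat \<Rightarrow> (nat \<Rightarrow> nat) simplicial_set" where
  "horn n j = (std_simplex n)
     \<lparr>ssimp := (\<lambda>m. {x \<in> mono_maps m n. \<not> {0..n} - {j} \<subseteq> x ` {0..m}})\<rparr>"

definition std_vertex :: "nat \<Rightarrow> nat \<Rightarrow> nat" where
  "std_vertex i = (\<lambda>_\<in>{0..0}. i)"


section \<open>Quasi-categories in modules\<close>

text \<open>The simplicial map \<open>\<lambda>m x. x\<close> is the inclusion of the horn into the simplex.\<close>
definition lifts_inner_horns ::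
  "('k, 'z) ring_scheme \<Rightarrow> ('k, 'm) necklace_module \<Rightarrow> bool" where
  "lifts_inner_horns R Y \<longleftrightarrow>
    (\<forall>j n. 0 < j \<and> j < n \<longrightarrow>
      (\<forall>\<alpha>. necklace_nat_trans R
             (necklace_functor R (free_templicial R (horn n j)) (std_vertex 0) (std_vertex n)) Y \<alpha> \<longrightarrow>
        (\<exists>\<beta>. necklace_nat_trans R
             (necklace_functor R (free_templicial R (std_simplex n)) (std_vertex 0) (std_vertex n)) Y \<beta> \<and>
           (\<forall>A\<in>necklaces. \<forall>u\<in>carrier (nobj (necklace_functor R
                (free_templicial R (horn n j)) (std_vertex 0) (std_vertex n)) A).
              \<beta> A (free_necklace_map R (std_simplex n) (\<lambda>m x. x) A (std_vertex 0) (std_vertex n) u)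
                = \<alpha> A u))))"

definition quasi_category_in_modules ::
  "('k, 'z) ring_scheme \<Rightarrow> ('k, 's, 'm) templicial \<Rightarrow> bool" where
  "quasi_category_in_modules R X \<longleftrightarrow>
     (\<forall>a\<in>tverts X. \<forall>b\<in>tverts X. lifts_inner_horns R (necklace_functor R X a b))"

end

(* A natural transformation out of F(Delta^n)_.(0,n) is an element x of X_n(a,b), because
   F(Delta^n)_T(0,n) is free on the morphisms (T,p) -> ({0,n},n); it sends such an f to mu_T(X(f) x).
   A basis element of F(Lambda^n_j)_T(0,n) factors either through an inert map ({0,k,n},n) -> ({0,n},n)
   with 0 < k < n or through an inner coface d_i with i different from j. So extending a transformation
   amounts to finding x with prescribed mu_{k,n-k}(x) = w_k and prescribed faces X(d_i) x = y_i.
   First the w_k are attained one after the other: replacing x by x + Z^{m,n-m}(w_m - mu_{m,n-m} x)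
   corrects the m-th value, since Z^{m,n-m} is a section of mu_{m,n-m}, and keeps those with k < m by the
   second Frobenius identity. Then the faces are corrected by adding degeneracies s_t(y_i - X(d_i) x)
   with t = i for i < j (i ascending) and t = i - 1 for i > j (i descending). The comultiplications are
   not disturbed: y_i - X(d_i) x is killed by all mu_{k,n-1-k} with 0 < k < n - 1, and s_t is an inner
   degeneracy. *)
theory Submission
  imports Defs
begin

section \<open>Linear maps and free modules\<close>

text \<open>The condition \<open>0 < j < n\<close> enters twice. Of the faces already corrected,
  adding a degeneracy s_t of the error can spoil only those with index t and t + 1. One of these two
  is the face being treated, and the other is either still to be treated or the absent face
  \<open>j\<close>; working from both ends towards \<open>j\<close> guarantees this. Moreover t is
  then an inner index, so s_t turns errors without inner comultiplications into elements without
  inner comultiplications. The other corrected faces survive because a simplicial identity moves the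
  face past s_t onto the error, where it gives zero by the compatibility of the prescribed faces.

  The formal obstacle is that tensors are cosets and arrows are functions with known values on
  carriers only. Arrows are therefore compared by \<open>qarr_eq\<close>, and a rewriting inside a
  composite has to know that the inner arrow is linear, hence stays in the carrier. Equalities of
  linear maps are tested on pure tensors, and on free templicial modules on one vector
  \<open>bvec\<close> for each map into [n].\<close>

lemma linear_mapsI:
  assumes "\<And>x. x \<in> carrier M \<Longrightarrow> f x \<in> carrier N"
    and "\<And>x y. \<lbrakk>x \<in> carrier M; y \<in> carrier M\<rbrakk> \<Longrightarrow> f (x \<oplus>\<^bsub>M\<^esub> y) = f x \<oplus>\<^bsub>N\<^esub> f y"
    and "\<And>r x. \<lbrakk>r \<in> carrier R; x \<in> carrier M\<rbrakk> \<Longrightarrow> f (r \<odot>\<^bsub>M\<^esub> x) = r \<odot>\<^bsub>N\<^esub> f x"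
  shows "f \<in> linear_maps R M N"
  using assms by (auto simp: linear_maps_def)

lemma linear_maps_closed: "\<lbrakk>f \<in> linear_maps R M N; x \<in> carrier M\<rbrakk> \<Longrightarrow> f x \<in> carrier N"
  and linear_maps_add: "\<lbrakk>f \<in> linear_maps R M N; x \<in> carrier M; y \<in> carrier M\<rbrakk>
    \<Longrightarrow> f (x \<oplus>\<^bsub>M\<^esub> y) = f x \<oplus>\<^bsub>N\<^esub> f y"
  and linear_maps_smult: "\<lbrakk>f \<in> linear_maps R M N; r \<in> carrier R; x \<in> carrier M\<rbrakk>
    \<Longrightarrow> f (r \<odot>\<^bsub>M\<^esub> x) = r \<odot>\<^bsub>N\<^esub> f x"
  by (auto simp: linear_maps_def)

lemma linear_maps_zero:
  assumes "module R M" "module R N" "f \<in> linear_maps R M N"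
  shows "f \<zero>\<^bsub>M\<^esub> = \<zero>\<^bsub>N\<^esub>"
proof -
  interpret M: module R M by fact
  interpret N: module R N by fact
  have "f \<zero>\<^bsub>M\<^esub> = f (\<zero>\<^bsub>R\<^esub> \<odot>\<^bsub>M\<^esub> \<zero>\<^bsub>M\<^esub>)" by simp
  also have "\<dots> = \<zero>\<^bsub>R\<^esub> \<odot>\<^bsub>N\<^esub> f \<zero>\<^bsub>M\<^esub>" using linear_maps_smult[OF assms(3), of "\<zero>\<^bsub>R\<^esub>" "\<zero>\<^bsub>M\<^esub>"] by simp
  also have "\<dots> = \<zero>\<^bsub>N\<^esub>" using linear_maps_closed[OF assms(3)] by simp
  finally show ?thesis .
qed

lemma linear_maps_minus:
  assumes "module R M" "module R N" "f \<in> linear_maps R M N" "x \<in> carrier M" "y \<in> carrier M"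
  shows "f (x \<ominus>\<^bsub>M\<^esub> y) = f x \<ominus>\<^bsub>N\<^esub> f y"
proof -
  interpret M: module R M by fact
  interpret N: module R N by fact
  have "f (\<ominus>\<^bsub>M\<^esub> y) = f ((\<ominus>\<^bsub>R\<^esub> \<one>\<^bsub>R\<^esub>) \<odot>\<^bsub>M\<^esub> y)" using assms by (simp add: M.smult_l_minus)
  also have "\<dots> = (\<ominus>\<^bsub>R\<^esub> \<one>\<^bsub>R\<^esub>) \<odot>\<^bsub>N\<^esub> f y" using linear_maps_smult[OF assms(3)] assms by simp
  also have "\<dots> = \<ominus>\<^bsub>N\<^esub> f y" using linear_maps_closed[OF assms(3)] assms by (simp add: N.smult_l_minus)
  finally show ?thesis using assms by (simp add: a_minus_def linear_maps_add)
qed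

lemma linear_maps_comp:
  "\<lbrakk>f \<in> linear_maps R M N; g \<in> linear_maps R N K\<rbrakk> \<Longrightarrow> (\<lambda>x. g (f x)) \<in> linear_maps R M K"
  by (auto simp: linear_maps_def Pi_iff)

lemma linear_maps_id: "(\<lambda>x. x) \<in> linear_maps R M M"
  by (auto simp: linear_maps_def)

lemma linear_maps_plus:
  assumes "module R N" "f \<in> linear_maps R M N" "g \<in> linear_maps R M N"
  shows "(\<lambda>x. f x \<oplus>\<^bsub>N\<^esub> g x) \<in> linear_maps R M N"
proof -
  interpret N: module R N by fact
  show ?thesis
    using linear_maps_closed[OF assms(2)] linear_maps_closed[OF assms(3)]
    by (intro linear_mapsI)
      (auto simp: linear_maps_add[OF assms(2)] linear_maps_add[OF assms(3)]
         linear_maps_smult[OF assms(2)] linear_maps_smult[OF assms(3)] N.M.add.m_ac N.smult_r_distr)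
qed

lemma linear_maps_scale:
  assumes "module R N" "f \<in> linear_maps R M N" "r \<in> carrier R"
  shows "(\<lambda>x. r \<odot>\<^bsub>N\<^esub> f x) \<in> linear_maps R M N"
proof -
  interpret N: module R N by fact
  show ?thesis
    using linear_maps_closed[OF assms(2)] assms(3)
    by (intro linear_mapsI)
      (auto simp: linear_maps_add[OF assms(2)] linear_maps_smult[OF assms(2)] N.smult_r_distr
        N.smult_assoc1[symmetric] N.R.m_comm)
qed

text \<open>Serves the two maps that are given as \<open>inv_into\<close>: the inverse of the counit
  and \<open>qunwrap\<close>.\<close>

lemma linear_maps_inv_into:
  assumes "module R M" "f \<in> linear_maps R M N" "bij_betw f (carrier M) (carrier N)"
  shows "inv_into (carrier M) f \<in> linear_maps R N M"
proof (intro linear_mapsI)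
  interpret M: module R M by fact
  let ?g = "inv_into (carrier M) f"
  have g: "?g x \<in> carrier M" "f (?g x) = x" if "x \<in> carrier N" for x
    using assms(3) that bij_betw_inv_into_right[OF assms(3)]
    by (auto simp: bij_betw_def inv_into_into)
  have gf: "?g (f x) = x" if "x \<in> carrier M" for x
    using bij_betw_inv_into_left[OF assms(3) that] .
  fix x y assume x: "x \<in> carrier N"
  show "?g x \<in> carrier M" using g x by simp
  show "?g (x \<oplus>\<^bsub>N\<^esub> y) = ?g x \<oplus>\<^bsub>M\<^esub> ?g y" if y: "y \<in> carrier N"
  proof -
    have "?g (x \<oplus>\<^bsub>N\<^esub> y) = ?g (f (?g x \<oplus>\<^bsub>M\<^esub> ?g y))"
      using g x y by (simp add: linear_maps_add[OF assms(2)])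
    then show ?thesis using gf g x y by simp
  qed
next
  interpret M: module R M by fact
  let ?g = "inv_into (carrier M) f"
  fix r x assume rx: "r \<in> carrier R" "x \<in> carrier N"
  have g: "?g x \<in> carrier M" "f (?g x) = x"
    using assms(3) rx bij_betw_inv_into_right[OF assms(3)]
    by (auto simp: bij_betw_def inv_into_into)
  have "?g (r \<odot>\<^bsub>N\<^esub> x) = ?g (f (r \<odot>\<^bsub>M\<^esub> ?g x))"
    using g rx by (simp add: linear_maps_smult[OF assms(2)])
  then show "?g (r \<odot>\<^bsub>N\<^esub> x) = r \<odot>\<^bsub>M\<^esub> ?g x"
    using bij_betw_inv_into_left[OF assms(3)] g rx by simp
qed

lemma (in cring) free_module_module: "module R (free_module R B)"
proof (rule moduleI)
  show "cring R" by (rule is_cring)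
  have fin: "finite {x. u x \<oplus> v x \<noteq> \<zero>}" if "finite {x. u x \<noteq> \<zero>}" "finite {x. v x \<noteq> \<zero>}" for u v
    by (rule finite_subset[OF _ finite_UnI[OF that]]) auto
  show "abelian_group (free_module R B)"
  proof (rule abelian_groupI, goal_cases)
    case (1 u v) then show ?case using fin by (auto simp: free_module_def)
  next
    case 2 then show ?case by (auto simp: free_module_def)
  next
    case (3 u v w) then show ?case by (auto simp: free_module_def a_assoc)
  next
    case (4 u v) then show ?case by (auto simp: free_module_def a_comm)
  next
    case (5 u) then show ?case by (auto simp: free_module_def)
  next
    case (6 u)
    then have "finite {x. \<ominus> u x \<noteq> \<zero>}"
      by (rule_tac finite_subset[of _ "{x. u x \<noteq> \<zero>}"]) (auto simp: free_module_def)
    with 6 show ?case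
      by (intro bexI[of _ "\<lambda>x. \<ominus> u x"]) (auto simp: free_module_def l_neg)
  qed
next
  fix r u assume "r \<in> carrier R" "u \<in> carrier (free_module R B)"
  moreover from this have "finite {x. r \<otimes> u x \<noteq> \<zero>}"
    by (rule_tac finite_subset[of _ "{x. u x \<noteq> \<zero>}"]) (auto simp: free_module_def)
  ultimately show "r \<odot>\<^bsub>free_module R B\<^esub> u \<in> carrier (free_module R B)"
    by (auto simp: free_module_def)
qed (auto simp: free_module_def l_distr r_distr m_assoc)

lemma (in cring) free_gen_closed: "x \<in> B \<Longrightarrow> free_gen R x \<in> carrier (free_module R B)"
  by (auto simp: free_module_def free_gen_def intro: finite_subset[of _ "{x}"])

lemma (in cring) free_module_induct [consumes 1, case_names zero add]:
  assumes "u \<in> carrier (free_module R B)"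
    and "P \<zero>\<^bsub>free_module R B\<^esub>"
    and step: "\<And>r x u. \<lbrakk>r \<in> carrier R; x \<in> B; u \<in> carrier (free_module R B); P u\<rbrakk>
      \<Longrightarrow> P (r \<odot>\<^bsub>free_module R B\<^esub> free_gen R x \<oplus>\<^bsub>free_module R B\<^esub> u)"
  shows "P u"
proof -
  \<comment> \<open>The induction runs over a finite set \<open>A\<close> that contains the support,
    not over the support itself: once the entry at \<open>x\<close> is set to zero, the rest is
    supported in the smaller set, whether or not \<open>u x\<close> was zero.\<close>
  have "finite A \<Longrightarrow> A \<subseteq> B \<Longrightarrow> (\<forall>x. u x \<in> carrier R) \<Longrightarrow> {x. u x \<noteq> \<zero>} \<subseteq> A \<Longrightarrow> P u" for A u
  proof (induction A arbitrary: u rule: finite_induct)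
    case empty
    then have "u = \<zero>\<^bsub>free_module R B\<^esub>" by (auto simp: free_module_def)
    then show ?case using assms(2) by simp
  next
    case (insert x A)
    define v where "v = u (x := \<zero>)"
    have v: "P v" using insert.prems by (intro insert.IH) (auto simp: v_def)
    have "v \<in> carrier (free_module R B)"
      using insert by (auto simp: free_module_def v_def intro: finite_subset[of _ A])
    moreover have "u = u x \<odot>\<^bsub>free_module R B\<^esub> free_gen R x \<oplus>\<^bsub>free_module R B\<^esub> v"
      using insert.prems by (auto simp: free_module_def v_def free_gen_def)
    ultimately show ?case using step[of "u x" x v] v insert.prems by auto
  qed
  from this[of "{x. u x \<noteq> \<zero>}" u] show ?thesis using assms(1) by (auto simp: free_module_def)
qed

lemma (in cring) free_module_ext:
  assumes "module R N" "f \<in> linear_maps R (free_module R B) N" "g \<in> linear_maps R (free_module R B) N"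
    and "\<And>x. x \<in> B \<Longrightarrow> f (free_gen R x) = g (free_gen R x)"
    and "u \<in> carrier (free_module R B)"
  shows "f u = g u"
  using assms(5)
proof (induction u rule: free_module_induct)
  case zero
  show ?case using linear_maps_zero[OF free_module_module assms(1)] assms(2,3) by metis
next
  case (add r x u)
  interpret F: module R "free_module R B" by (rule free_module_module)
  from add show ?case
    by (simp add: linear_maps_add[OF assms(2)] linear_maps_add[OF assms(3)]
       linear_maps_smult[OF assms(2)] linear_maps_smult[OF assms(3)] free_gen_closed assms(4))
qed

text \<open>\<open>free_lift\<close> sums over the support, and the supports of two vectors, of
  their sum and of a multiple all differ. Over a common finite index set the sums can be compared
  term by term.\<close>

lemma (in cring) free_lift_superset:
  assumes "module R N" "finite A" "{x. u x \<noteq> \<zero>} \<subseteq> A" "\<And>x. x \<in> A \<Longrightarrow> \<phi> x \<in> carrier N"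
    "\<And>x. u x \<in> carrier R"
  shows "free_lift R N \<phi> u = (\<Oplus>\<^bsub>N\<^esub>x\<in>A. u x \<odot>\<^bsub>N\<^esub> \<phi> x)"
proof -
  interpret N: module R N by fact
  show ?thesis unfolding free_lift_def
    using assms by (intro N.add.finprod_mono_neutral_cong_left) auto
qed

lemma (in cring) free_lift_linear:
  assumes "module R N" "\<And>x. x \<in> B \<Longrightarrow> \<phi> x \<in> carrier N"
  shows "free_lift R N \<phi> \<in> linear_maps R (free_module R B) N"
proof -
  interpret N: module R N by fact
  show ?thesis
  proof (rule linear_mapsI)
    fix u assume "u \<in> carrier (free_module R B)"
    then show "free_lift R N \<phi> u \<in> carrier N"
      unfolding free_lift_def using assms(2)
      by (intro N.M.finsum_closed) (auto simp: free_module_def Pi_iff)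
  next
    fix u v assume u: "u \<in> carrier (free_module R B)" and v: "v \<in> carrier (free_module R B)"
    define A where "A = {x. u x \<noteq> \<zero>} \<union> {x. v x \<noteq> \<zero>}"
    have A: "finite A" "A \<subseteq> B" using u v by (auto simp: A_def free_module_def)
    have c: "u x \<in> carrier R" "v x \<in> carrier R" for x using u v by (auto simp: free_module_def)
    have \<phi>: "x \<in> A \<Longrightarrow> \<phi> x \<in> carrier N" for x using A assms(2) by auto
    have "free_lift R N \<phi> (u \<oplus>\<^bsub>free_module R B\<^esub> v) = (\<Oplus>\<^bsub>N\<^esub>x\<in>A. (u x \<oplus> v x) \<odot>\<^bsub>N\<^esub> \<phi> x)"
      using c by (subst free_lift_superset[OF assms(1) A(1) _ \<phi>]) (auto simp: free_module_def A_def)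
    also have "\<dots> = (\<Oplus>\<^bsub>N\<^esub>x\<in>A. u x \<odot>\<^bsub>N\<^esub> \<phi> x \<oplus>\<^bsub>N\<^esub> v x \<odot>\<^bsub>N\<^esub> \<phi> x)"
      using c \<phi> by (intro N.M.finsum_cong') (auto simp: N.smult_l_distr)
    also have "\<dots> = (\<Oplus>\<^bsub>N\<^esub>x\<in>A. u x \<odot>\<^bsub>N\<^esub> \<phi> x) \<oplus>\<^bsub>N\<^esub> (\<Oplus>\<^bsub>N\<^esub>x\<in>A. v x \<odot>\<^bsub>N\<^esub> \<phi> x)"
      using c \<phi> by (intro N.M.finsum_addf) auto
    also have "(\<Oplus>\<^bsub>N\<^esub>x\<in>A. u x \<odot>\<^bsub>N\<^esub> \<phi> x) = free_lift R N \<phi> u"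
      by (rule free_lift_superset[OF assms(1) A(1) _ \<phi> c(1), symmetric]) (simp_all add: A_def)
    also have "(\<Oplus>\<^bsub>N\<^esub>x\<in>A. v x \<odot>\<^bsub>N\<^esub> \<phi> x) = free_lift R N \<phi> v"
      by (rule free_lift_superset[OF assms(1) A(1) _ \<phi> c(2), symmetric]) (simp_all add: A_def)
    finally show "free_lift R N \<phi> (u \<oplus>\<^bsub>free_module R B\<^esub> v) = free_lift R N \<phi> u \<oplus>\<^bsub>N\<^esub> free_lift R N \<phi> v" .
  next
    fix r u assume r: "r \<in> carrier R" and u: "u \<in> carrier (free_module R B)"
    define A where "A = {x. u x \<noteq> \<zero>}"
    have A: "finite A" "A \<subseteq> B" using u by (auto simp: A_def free_module_def)
    have c: "u x \<in> carrier R" for x using u by (auto simp: free_module_def)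
    have \<phi>: "x \<in> A \<Longrightarrow> \<phi> x \<in> carrier N" for x using A assms(2) by auto
    have "free_lift R N \<phi> (r \<odot>\<^bsub>free_module R B\<^esub> u) = (\<Oplus>\<^bsub>N\<^esub>x\<in>A. (r \<otimes> u x) \<odot>\<^bsub>N\<^esub> \<phi> x)"
      using c r by (subst free_lift_superset[OF assms(1) A(1) _ \<phi>]) (auto simp: free_module_def A_def)
    also have "\<dots> = (\<Oplus>\<^bsub>N\<^esub>x\<in>A. r \<odot>\<^bsub>N\<^esub> (u x \<odot>\<^bsub>N\<^esub> \<phi> x))"
      using c \<phi> r by (intro N.M.finsum_cong') (auto simp: N.smult_assoc1)
    also have "\<dots> = r \<odot>\<^bsub>N\<^esub> (\<Oplus>\<^bsub>N\<^esub>x\<in>A. u x \<odot>\<^bsub>N\<^esub> \<phi> x)"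
      using c \<phi> r A by (intro N.finsum_smult_ldistr[symmetric]) auto
    also have "(\<Oplus>\<^bsub>N\<^esub>x\<in>A. u x \<odot>\<^bsub>N\<^esub> \<phi> x) = free_lift R N \<phi> u"
      by (rule free_lift_superset[OF assms(1) A(1) _ \<phi> c, symmetric]) (simp_all add: A_def)
    finally show "free_lift R N \<phi> (r \<odot>\<^bsub>free_module R B\<^esub> u) = r \<odot>\<^bsub>N\<^esub> free_lift R N \<phi> u" .
  qed
qed

lemma (in cring) free_lift_gen:
  assumes "module R N" "\<phi> x \<in> carrier N"
  shows "free_lift R N \<phi> (free_gen R x) = \<phi> x"
proof -
  interpret N: module R N by fact
  have "free_lift R N \<phi> (free_gen R x) = (\<Oplus>\<^bsub>N\<^esub>y\<in>{x}. free_gen R x y \<odot>\<^bsub>N\<^esub> \<phi> y)"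
    using assms by (intro free_lift_superset) (auto simp: free_gen_def)
  also have "\<dots> = \<phi> x" using assms by (simp add: free_gen_def)
  finally show ?thesis .
qed

section \<open>Quotient modules\<close>

text \<open>Only \<open>M\<close> is declared as a structure here, so that a coset written without
  subscript is one in \<open>M\<close>.\<close>

locale plain_module = module R M
  for R :: "('k, 'z) ring_scheme" and M :: "('k, 'm) module" (structure)

lemma (in module) submodule_zero: "submodule N R M \<Longrightarrow> \<zero>\<^bsub>M\<^esub> \<in> N"
  using subgroup.one_closed[OF submodule.axioms(1)] by force

lemma (in plain_module) submodule_generated_submodule:
  assumes "G \<subseteq> carrier M"
  shows "submodule (submodule_generated R M G) R M"
    and "G \<subseteq> submodule_generated R M G"
proof -
  let ?\<N> = "{N. submodule N R M \<and> G \<subseteq> N}"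
  \<comment> \<open>The family is inhabited, which keeps its intersection inside the
    carrier.\<close>
  have *: "carrier M \<in> ?\<N>" using assms carrier_is_submodule by auto
  show "submodule (submodule_generated R M G) R M"
    unfolding submodule_generated_def
  proof (rule submoduleI)
    show "\<Inter>?\<N> \<subseteq> carrier M" using * by blast
    show "\<zero>\<^bsub>M\<^esub> \<in> \<Inter>?\<N>" using submodule_zero by blast
    show "\<ominus>\<^bsub>M\<^esub> a \<in> \<Inter>?\<N>" if "a \<in> \<Inter>?\<N>" for a using that submoduleE(3) by blast
    show "a \<oplus>\<^bsub>M\<^esub> b \<in> \<Inter>?\<N>" if "a \<in> \<Inter>?\<N>" "b \<in> \<Inter>?\<N>" for a b
      using that submoduleE(5) by blast
    show "r \<odot>\<^bsub>M\<^esub> a \<in> \<Inter>?\<N>" if "r \<in> carrier R" "a \<in> \<Inter>?\<N>" for r a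
      using that submoduleE(4) by blast
  qed
  show "G \<subseteq> submodule_generated R M G" by (auto simp: submodule_generated_def)
qed

lemma submodule_generated_least:
  "\<lbrakk>submodule N R M; G \<subseteq> N\<rbrakk> \<Longrightarrow> submodule_generated R M G \<subseteq> N"
  by (auto simp: submodule_generated_def)

context plain_module
begin

context
  fixes N assumes N: "submodule N R M"
begin

lemma submodule_abelian_subgroup: "abelian_subgroup N M"
  using N submodule.axioms(1)
  by (intro abelian_subgroupI3 additive_subgroup.intro) (auto intro: abelian_group_axioms)

lemma quotient_carrier: "carrier (quotient_module M N) = (\<lambda>x. N +> x) ` carrier M"
  by (auto simp: quotient_module_def A_RCOSETS_def')

lemma quotient_add:
  "\<lbrakk>x \<in> carrier M; y \<in> carrier M\<rbrakk>
    \<Longrightarrow> (N +> x) \<oplus>\<^bsub>quotient_module M N\<^esub> (N +> y) = N +> (x \<oplus>\<^bsub>M\<^esub> y)"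
  using abelian_subgroup.a_rcos_sum[OF submodule_abelian_subgroup] by (simp add: quotient_module_def)

lemma coset_eq_iff:
  assumes "x \<in> carrier M" "y \<in> carrier M"
  shows "N +> x = N +> y \<longleftrightarrow> x \<ominus>\<^bsub>M\<^esub> y \<in> N"
proof -
  interpret A: abelian_subgroup N M by (rule submodule_abelian_subgroup)
  have "N +> x = N +> y \<longleftrightarrow> x \<in> N +> y"
    using assms A.a_rcos_self A.a_repr_independence' by metis
  then show ?thesis using A.a_rcos_module[OF assms(2,1)] by (simp add: a_minus_def)
qed

text \<open>Speaks about an arbitrary element of the coset because \<open>qtens_lift\<close> takes
  whichever representative \<open>SOME\<close> yields.\<close>

lemma mem_coset: "\<lbrakk>x \<in> carrier M; y \<in> N +> x\<rbrakk> \<Longrightarrow> y \<in> carrier M \<and> y \<ominus>\<^bsub>M\<^esub> x \<in> N \<and> N +> y = N +> x"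
proof -
  interpret A: abelian_subgroup N M by (rule submodule_abelian_subgroup)
  assume *: "x \<in> carrier M" "y \<in> N +> x"
  have y: "y \<in> carrier M" using * A.a_elemrcos_carrier by blast
  have "N +> y = N +> x" using A.a_repr_independence'[of y x] * by simp
  with y * show ?thesis using coset_eq_iff by blast
qed

text \<open>The scalar multiple of a coset is defined as a union over all its representatives. Two
  representatives differ by an element of \<open>N\<close>, and so do their multiples, so the union
  is a single coset.\<close>

lemma quotient_smult:
  assumes "r \<in> carrier R" "x \<in> carrier M"
  shows "r \<odot>\<^bsub>quotient_module M N\<^esub> (N +> x) = N +> (r \<odot>\<^bsub>M\<^esub> x)"
proof -
  interpret A: abelian_subgroup N M by (rule submodule_abelian_subgroup)
  have "N +> (r \<odot>\<^bsub>M\<^esub> u) = N +> (r \<odot>\<^bsub>M\<^esub> x)" if u: "u \<in> N +> x" for u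
  proof -
    have "u \<in> carrier M" "u \<ominus>\<^bsub>M\<^esub> x \<in> N" using mem_coset assms u by blast+
    moreover have "r \<odot>\<^bsub>M\<^esub> (u \<ominus>\<^bsub>M\<^esub> x) = r \<odot>\<^bsub>M\<^esub> u \<ominus>\<^bsub>M\<^esub> r \<odot>\<^bsub>M\<^esub> x"
      using assms calculation by (simp add: a_minus_def smult_r_distr smult_r_minus)
    ultimately show ?thesis
      using assms submodule.smult_closed[OF N, of r "u \<ominus>\<^bsub>M\<^esub> x"] by (subst coset_eq_iff) auto
  qed
  moreover have "x \<in> N +> x" using A.a_rcos_self assms by blast
  ultimately have "(\<Union>u\<in>N +> x. N +> (r \<odot>\<^bsub>M\<^esub> u)) = N +> (r \<odot>\<^bsub>M\<^esub> x)" by blast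
  then show ?thesis by (simp add: quotient_module_def)
qed

lemma quotient_module_module: "module R (quotient_module M N)"
proof (rule moduleI)
  let ?Q = "quotient_module M N"
  interpret A: abelian_subgroup N M by (rule submodule_abelian_subgroup)
  show "cring R" by (rule R.is_cring)
  have z: "\<zero>\<^bsub>?Q\<^esub> = N +> \<zero>\<^bsub>M\<^esub>"
    using A.a_subset by (simp add: quotient_module_def)
  show "abelian_group ?Q"
  proof (rule abelian_groupI)
    fix U assume "U \<in> carrier ?Q"
    then obtain x where "x \<in> carrier M" "U = N +> x" by (auto simp: quotient_carrier)
    then show "\<exists>V\<in>carrier ?Q. V \<oplus>\<^bsub>?Q\<^esub> U = \<zero>\<^bsub>?Q\<^esub>"
      by (intro bexI[of _ "N +> \<ominus>\<^bsub>M\<^esub> x"]) (auto simp: quotient_carrier quotient_add z M.l_neg)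
  qed (auto simp: quotient_carrier quotient_add z M.a_ac)
qed (auto simp: quotient_carrier quotient_add quotient_smult smult_l_distr smult_r_distr smult_assoc1)

end

end

section \<open>Tensor products of quivers\<close>

definition module_quivers :: "('k, 'z) ring_scheme \<Rightarrow> 's set \<Rightarrow> ('k, 's, 'm) quiver list \<Rightarrow> bool" where
  "module_quivers R S Qs \<longleftrightarrow> (\<forall>Q\<in>set Qs. \<forall>c\<in>S. \<forall>d\<in>S. module R (Q c d))"

text \<open>The two equations mirror the two families in \<open>multilinear_relations\<close>: a
  slot is addressed by the length of the prefix before it, and all vertices of the path stay
  fixed.\<close>

definition multilinear ::
  "('k, 'z) ring_scheme \<Rightarrow> 's set \<Rightarrow> ('k, 's, 'm) quiver list \<Rightarrow> 's \<Rightarrow> 's \<Rightarrow> ('k, 'n) module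
    \<Rightarrow> (('s \<times> 'm \<times> 's) list \<Rightarrow> 'n) \<Rightarrow> bool" where
  "multilinear R S Qs a b N \<phi> \<longleftrightarrow>
    (\<forall>xs\<in>qpaths S Qs a b. \<phi> xs \<in> carrier N) \<and>
    (\<forall>xs c x y d ys. xs @ (c, x, d) # ys \<in> qpaths S Qs a b \<longrightarrow> xs @ (c, y, d) # ys \<in> qpaths S Qs a b \<longrightarrow>
       \<phi> (xs @ (c, x \<oplus>\<^bsub>(Qs ! length xs) c d\<^esub> y, d) # ys)
         = \<phi> (xs @ (c, x, d) # ys) \<oplus>\<^bsub>N\<^esub> \<phi> (xs @ (c, y, d) # ys)) \<and>
    (\<forall>xs c r x d ys. r \<in> carrier R \<longrightarrow> xs @ (c, x, d) # ys \<in> qpaths S Qs a b \<longrightarrow>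
       \<phi> (xs @ (c, r \<odot>\<^bsub>(Qs ! length xs) c d\<^esub> x, d) # ys) = r \<odot>\<^bsub>N\<^esub> \<phi> (xs @ (c, x, d) # ys))"

lemma qpaths_length: "xs \<in> qpaths S Qs a b \<Longrightarrow> length xs = length Qs"
  by (induction Qs arbitrary: a xs) auto

text \<open>\<open>qtensor\<close> recovers the vertex between its two factors from the first half
  of a path by exactly this expression.\<close>

lemma qpaths_end:
  "xs \<in> qpaths S Qs a b \<Longrightarrow> b = (if xs = [] then a else snd (snd (last xs)))"
proof (induction Qs arbitrary: a xs)
  case (Cons Q Qs)
  then obtain x c ys where "xs = (a, x, c) # ys" "ys \<in> qpaths S Qs c b" by auto
  with Cons.IH[of ys c] show ?case by auto
qed auto

lemma qpaths_end_mem: "\<lbrakk>xs \<in> qpaths S Qs a b; a \<in> S\<rbrakk> \<Longrightarrow> b \<in> S"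
  by (induction Qs arbitrary: a xs) auto

lemma qpaths_append_iff:
  "xs \<in> qpaths S (Qs @ Ps) a b \<longleftrightarrow>
     (\<exists>ys zs c. xs = ys @ zs \<and> ys \<in> qpaths S Qs a c \<and> zs \<in> qpaths S Ps c b)"
proof (induction Qs arbitrary: a xs)
  case (Cons Q Qs)
  show ?case
  proof
    assume "xs \<in> qpaths S ((Q # Qs) @ Ps) a b"
    then obtain x c ts where *: "xs = (a, x, c) # ts" "a \<in> S" "c \<in> S" "x \<in> carrier (Q a c)"
      "ts \<in> qpaths S (Qs @ Ps) c b" by auto
    then obtain ys zs e where "ts = ys @ zs" "ys \<in> qpaths S Qs c e" "zs \<in> qpaths S Ps e b"
      using Cons.IH by blast
    with * show "\<exists>ys zs c. xs = ys @ zs \<and> ys \<in> qpaths S (Q # Qs) a c \<and> zs \<in> qpaths S Ps c b"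
      by (intro exI[of _ "(a, x, c) # ys"] exI[of _ zs] exI[of _ e]) auto
  next
    assume "\<exists>ys zs c. xs = ys @ zs \<and> ys \<in> qpaths S (Q # Qs) a c \<and> zs \<in> qpaths S Ps c b"
    then show "xs \<in> qpaths S ((Q # Qs) @ Ps) a b" using Cons.IH by fastforce
  qed
qed auto

lemma qpaths_append:
  "\<lbrakk>xs \<in> qpaths S Qs a c; ys \<in> qpaths S Ps c b\<rbrakk> \<Longrightarrow> xs @ ys \<in> qpaths S (Qs @ Ps) a b"
  unfolding qpaths_append_iff by blast

lemma qpaths_replace:
  assumes "xs @ (c, x, d) # ys \<in> qpaths S Qs a b"
  shows "length xs < length Qs" "c \<in> S" "d \<in> S" "x \<in> carrier ((Qs ! length xs) c d)"
    and "\<And>y. y \<in> carrier ((Qs ! length xs) c d) \<Longrightarrow> xs @ (c, y, d) # ys \<in> qpaths S Qs a b"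
proof -
  have "length xs < length Qs \<and> c \<in> S \<and> d \<in> S \<and> x \<in> carrier ((Qs ! length xs) c d) \<and>
    (\<forall>y. y \<in> carrier ((Qs ! length xs) c d) \<longrightarrow> xs @ (c, y, d) # ys \<in> qpaths S Qs a b)"
    using assms
  proof (induction xs arbitrary: Qs a)
    case Nil then show ?case by (cases Qs) auto
  next
    case (Cons z xs) then show ?case by (cases Qs) auto
  qed
  then show "length xs < length Qs" "c \<in> S" "d \<in> S" "x \<in> carrier ((Qs ! length xs) c d)"
    and "\<And>y. y \<in> carrier ((Qs ! length xs) c d) \<Longrightarrow> xs @ (c, y, d) # ys \<in> qpaths S Qs a b"
    by auto
qed

lemma qpaths_add:
  assumes "module_quivers R S Qs"
    and "xs @ (c, x, d) # ys \<in> qpaths S Qs a b" "xs @ (c, y, d) # ys \<in> qpaths S Qs a b"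
  shows "xs @ (c, x \<oplus>\<^bsub>(Qs ! length xs) c d\<^esub> y, d) # ys \<in> qpaths S Qs a b"
proof -
  note r = qpaths_replace[OF assms(2)]
  interpret module R "(Qs ! length xs) c d"
    using assms(1) r nth_mem unfolding module_quivers_def by blast
  show ?thesis using r qpaths_replace(4)[OF assms(3)] by simp
qed

lemma qpaths_smult:
  assumes "module_quivers R S Qs" "r \<in> carrier R" "xs @ (c, x, d) # ys \<in> qpaths S Qs a b"
  shows "xs @ (c, r \<odot>\<^bsub>(Qs ! length xs) c d\<^esub> x, d) # ys \<in> qpaths S Qs a b"
proof -
  note r = qpaths_replace[OF assms(3)]
  interpret module R "(Qs ! length xs) c d"
    using assms(1) r nth_mem unfolding module_quivers_def by blast
  show ?thesis using r assms(2) by simp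
qed

lemma multilinear_closed:
  "\<lbrakk>multilinear R S Qs a b N \<phi>; xs \<in> qpaths S Qs a b\<rbrakk> \<Longrightarrow> \<phi> xs \<in> carrier N"
  by (simp add: multilinear_def)

lemma multilinear_add:
  "\<lbrakk>multilinear R S Qs a b N \<phi>; xs @ (c, x, d) # ys \<in> qpaths S Qs a b;
    xs @ (c, y, d) # ys \<in> qpaths S Qs a b\<rbrakk>
   \<Longrightarrow> \<phi> (xs @ (c, x \<oplus>\<^bsub>(Qs ! length xs) c d\<^esub> y, d) # ys)
         = \<phi> (xs @ (c, x, d) # ys) \<oplus>\<^bsub>N\<^esub> \<phi> (xs @ (c, y, d) # ys)"
  unfolding multilinear_def by blast

lemma multilinear_smult:
  "\<lbrakk>multilinear R S Qs a b N \<phi>; r \<in> carrier R; xs @ (c, x, d) # ys \<in> qpaths S Qs a b\<rbrakk>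
   \<Longrightarrow> \<phi> (xs @ (c, r \<odot>\<^bsub>(Qs ! length xs) c d\<^esub> x, d) # ys) = r \<odot>\<^bsub>N\<^esub> \<phi> (xs @ (c, x, d) # ys)"
  unfolding multilinear_def by blast

lemma multilinear_Nil: "multilinear R S [] a b N \<phi> \<longleftrightarrow> (a = b \<longrightarrow> \<phi> [] \<in> carrier N)"
  by (auto simp: multilinear_def)

text \<open>A slot is either the first entry or lies in the rest, so the condition splits into
  linearity in the head and multilinearity in the tail. This is the form for inductions over the
  list of factors.\<close>

lemma multilinear_ConsI:
  assumes head: "\<And>c xs. \<lbrakk>c \<in> S; xs \<in> qpaths S Qs c b\<rbrakk>
      \<Longrightarrow> (\<lambda>x. \<phi> ((a, x, c) # xs)) \<in> linear_maps R (Q a c) N"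
    and tail: "\<And>c x. \<lbrakk>c \<in> S; x \<in> carrier (Q a c)\<rbrakk>
      \<Longrightarrow> multilinear R S Qs c b N (\<lambda>xs. \<phi> ((a, x, c) # xs))"
  shows "multilinear R S (Q # Qs) a b N \<phi>"
  unfolding multilinear_def
proof (intro conjI ballI allI impI)
  fix xs assume "xs \<in> qpaths S (Q # Qs) a b"
  then show "\<phi> xs \<in> carrier N" using linear_maps_closed[OF head] by auto
next
  fix xs c x y d ys
  assume "xs @ (c, x, d) # ys \<in> qpaths S (Q # Qs) a b" "xs @ (c, y, d) # ys \<in> qpaths S (Q # Qs) a b"
  then show "\<phi> (xs @ (c, x \<oplus>\<^bsub>((Q # Qs) ! length xs) c d\<^esub> y, d) # ys)
         = \<phi> (xs @ (c, x, d) # ys) \<oplus>\<^bsub>N\<^esub> \<phi> (xs @ (c, y, d) # ys)"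
    using linear_maps_add[OF head] tail by (cases xs) (auto simp: multilinear_def)
next
  fix xs c r x d ys
  assume "r \<in> carrier R" "xs @ (c, x, d) # ys \<in> qpaths S (Q # Qs) a b"
  then show "\<phi> (xs @ (c, r \<odot>\<^bsub>((Q # Qs) ! length xs) c d\<^esub> x, d) # ys) = r \<odot>\<^bsub>N\<^esub> \<phi> (xs @ (c, x, d) # ys)"
    using linear_maps_smult[OF head] tail by (cases xs) (auto simp: multilinear_def)
qed

lemma multilinear_head:
  assumes "multilinear R S (Q # Qs) a b N \<phi>" "a \<in> S" "c \<in> S" "xs \<in> qpaths S Qs c b"
  shows "(\<lambda>x. \<phi> ((a, x, c) # xs)) \<in> linear_maps R (Q a c) N"
proof (rule linear_mapsI)
  fix x assume x: "x \<in> carrier (Q a c)"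
  then show "\<phi> ((a, x, c) # xs) \<in> carrier N"
    using assms by (intro multilinear_closed[OF assms(1)]) auto
  show "\<phi> ((a, x \<oplus>\<^bsub>Q a c\<^esub> y, c) # xs) = \<phi> ((a, x, c) # xs) \<oplus>\<^bsub>N\<^esub> \<phi> ((a, y, c) # xs)"
    if "y \<in> carrier (Q a c)" for y
    using assms x that multilinear_add[OF assms(1), of "[]" a x c xs y] by simp
next
  fix r x assume "r \<in> carrier R" "x \<in> carrier (Q a c)"
  then show "\<phi> ((a, r \<odot>\<^bsub>Q a c\<^esub> x, c) # xs) = r \<odot>\<^bsub>N\<^esub> \<phi> ((a, x, c) # xs)"
    using assms multilinear_smult[OF assms(1), of r "[]" a x c xs] by simp
qed

lemma multilinear_tail:
  assumes "multilinear R S (Q # Qs) a b N \<phi>" "a \<in> S" "c \<in> S" "x \<in> carrier (Q a c)"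
  shows "multilinear R S Qs c b N (\<lambda>xs. \<phi> ((a, x, c) # xs))"
  using assms multilinear_closed[OF assms(1), of "(a, x, c) # _"]
    multilinear_add[OF assms(1), of "(a, x, c) # _"] multilinear_smult[OF assms(1), of _ "(a, x, c) # _"]
  unfolding multilinear_def by simp

text \<open>Meant for functions that cut a path in two, like the one inside \<open>qtensor\<close>:
  every slot lies in one of the pieces while the other piece stays fixed.\<close>

lemma multilinear_appendI:
  assumes "\<And>c ys. \<lbrakk>c \<in> S; ys \<in> qpaths S Ps c b\<rbrakk> \<Longrightarrow> multilinear R S Qs a c N (\<lambda>xs. \<phi> (xs @ ys))"
    and "\<And>c xs. \<lbrakk>c \<in> S; xs \<in> qpaths S Qs a c\<rbrakk> \<Longrightarrow> multilinear R S Ps c b N (\<lambda>ys. \<phi> (xs @ ys))"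
    and "a \<in> S"
  shows "multilinear R S (Qs @ Ps) a b N \<phi>"
  using assms
proof (induction Qs arbitrary: a \<phi>)
  case Nil
  then show ?case using Nil(2)[of a "[]"] by simp
next
  case (Cons Q Qs)
  show ?case unfolding append_Cons
  proof (rule multilinear_ConsI)
    fix c xs assume c: "c \<in> S" and "xs \<in> qpaths S (Qs @ Ps) c b"
    then obtain ys zs d where *: "xs = ys @ zs" "ys \<in> qpaths S Qs c d" "zs \<in> qpaths S Ps d b"
      unfolding qpaths_append_iff by blast
    have "multilinear R S (Q # Qs) a d N (\<lambda>xs. \<phi> (xs @ zs))"
      by (rule Cons.prems(1)[OF qpaths_end_mem[OF *(2) c] *(3)])
    from multilinear_head[OF this Cons.prems(3) c *(2)] *
    show "(\<lambda>x. \<phi> ((a, x, c) # xs)) \<in> linear_maps R (Q a c) N" by simp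
  next
    fix c x assume c: "c \<in> S" and x: "x \<in> carrier (Q a c)"
    show "multilinear R S (Qs @ Ps) c b N (\<lambda>xs. \<phi> ((a, x, c) # xs))"
    proof (rule Cons.IH)
      fix d ys assume d: "d \<in> S" "ys \<in> qpaths S Ps d b"
      from multilinear_tail[OF Cons.prems(1)[OF this] Cons.prems(3) c x]
      show "multilinear R S Qs c d N (\<lambda>xs. \<phi> ((a, x, c) # xs @ ys))" by simp
    next
      fix d xs assume d: "d \<in> S" "xs \<in> qpaths S Qs c d"
      then have "(a, x, c) # xs \<in> qpaths S (Q # Qs) a d" using c x Cons.prems(3) by simp
      from Cons.prems(2)[OF d(1) this]
      show "multilinear R S Ps d b N (\<lambda>ys. \<phi> ((a, x, c) # xs @ ys))" by simp
    qed (fact c)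
  qed
qed

lemma multilinear_comp:
  assumes "multilinear R S Qs a b N \<phi>" "f \<in> linear_maps R N K"
  shows "multilinear R S Qs a b K (\<lambda>xs. f (\<phi> xs))"
  using assms(1) linear_maps_closed[OF assms(2)] linear_maps_add[OF assms(2)] linear_maps_smult[OF assms(2)]
  unfolding multilinear_def by simp

text \<open>Multilinearity also evaluates at sums and multiples in a slot. Since the functions are
  known to agree on paths only, the quivers must be module-valued for these to be paths
  again.\<close>

lemma multilinear_cong:
  assumes "module_quivers R S Qs" "\<And>xs. xs \<in> qpaths S Qs a b \<Longrightarrow> \<phi> xs = \<psi> xs"
    and \<psi>: "multilinear R S Qs a b N \<psi>"
  shows "multilinear R S Qs a b N \<phi>"
proof -
  show ?thesis
    using \<psi> qpaths_add[OF assms(1)] qpaths_smult[OF assms(1)] unfolding multilinear_def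
    by (simp add: assms(2))
qed

lemma multilinear_relations_addI:
  fixes R (structure) and S Qs a b defines "F \<equiv> free_module R (qpaths S Qs a b)"
  assumes "xs @ (c, x, d) # ys \<in> qpaths S Qs a b" "xs @ (c, y, d) # ys \<in> qpaths S Qs a b"
  shows "free_gen R (xs @ (c, x \<oplus>\<^bsub>(Qs ! length xs) c d\<^esub> y, d) # ys)
    \<ominus>\<^bsub>F\<^esub> (free_gen R (xs @ (c, x, d) # ys) \<oplus>\<^bsub>F\<^esub> free_gen R (xs @ (c, y, d) # ys))
    \<in> multilinear_relations R S Qs a b"
  unfolding multilinear_relations_def Let_def F_def
  by (rule UnI1, rule CollectI, intro exI conjI, rule refl) (fact assms)+

lemma multilinear_relations_smultI:
  fixes R (structure) and S Qs a b defines "F \<equiv> free_module R (qpaths S Qs a b)"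
  assumes "r \<in> carrier R" "xs @ (c, x, d) # ys \<in> qpaths S Qs a b"
  shows "free_gen R (xs @ (c, r \<odot>\<^bsub>(Qs ! length xs) c d\<^esub> x, d) # ys)
    \<ominus>\<^bsub>F\<^esub> r \<odot>\<^bsub>F\<^esub> free_gen R (xs @ (c, x, d) # ys) \<in> multilinear_relations R S Qs a b"
  unfolding multilinear_relations_def Let_def F_def
  by (rule UnI2, rule CollectI, intro exI conjI, rule refl) (fact assms)+

section \<open>The universal property of the tensor product of quivers\<close>

locale quiver_tensors = cring R
  for R :: "('k, 'z) ring_scheme" (structure) +
  fixes S :: "'s set"
begin

context
  fixes Qs :: "('k, 's, 'm) quiver list" and a b :: 's
  assumes Qs: "module_quivers R S Qs"
begin

interpretation F: plain_module R "free_module R (qpaths S Qs a b)"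
  unfolding plain_module_def by (rule free_module_module)

lemma multilinear_relations_closed:
  "multilinear_relations R S Qs a b \<subseteq> carrier (free_module R (qpaths S Qs a b))"
proof -
  show ?thesis
    unfolding multilinear_relations_def Let_def
    using qpaths_add[OF Qs] qpaths_smult[OF Qs] by (auto simp: free_gen_closed)
qed

lemma qtens_rel_submodule: "submodule (qtens_rel R S Qs a b) R (free_module R (qpaths S Qs a b))"
  unfolding qtens_rel_def
  by (rule F.submodule_generated_submodule(1)[OF multilinear_relations_closed])

lemma qtens_module: "module R (qtens R S Qs a b)"
  unfolding qtens_def by (rule F.quotient_module_module[OF qtens_rel_submodule])

private abbreviation qproj where
  "qproj u \<equiv> qtens_rel R S Qs a b +>\<^bsub>free_module R (qpaths S Qs a b)\<^esub> u"

private lemma qproj_linear: "(\<lambda>u. qproj u) \<in> linear_maps R (free_module R (qpaths S Qs a b)) (qtens R S Qs a b)"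
  unfolding qtens_def
  by (intro linear_mapsI)
    (simp_all add: F.quotient_carrier[OF qtens_rel_submodule] F.quotient_add[OF qtens_rel_submodule]
      F.quotient_smult[OF qtens_rel_submodule])

lemma ptens_multilinear: "multilinear R S Qs a b (qtens R S Qs a b) (ptens R S Qs a b)"
proof -
  let ?F = "free_module R (qpaths S Qs a b)"
  have rel: "qproj u = qproj v"
    if "u \<ominus>\<^bsub>?F\<^esub> v \<in> multilinear_relations R S Qs a b" "u \<in> carrier ?F" "v \<in> carrier ?F" for u v
    using that F.submodule_generated_submodule(2)[OF multilinear_relations_closed]
    by (subst F.coset_eq_iff[OF qtens_rel_submodule]) (auto simp: qtens_rel_def)
  show ?thesis
    unfolding multilinear_def ptens_def
  proof (intro conjI ballI allI impI)
    fix xs assume "xs \<in> qpaths S Qs a b"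
    then show "qproj (free_gen R xs) \<in> carrier (qtens R S Qs a b)"
      by (intro linear_maps_closed[OF qproj_linear] free_gen_closed)
  next
    fix xs c x y d ys
    assume *: "xs @ (c, x, d) # ys \<in> qpaths S Qs a b" "xs @ (c, y, d) # ys \<in> qpaths S Qs a b"
    note gens = *[THEN free_gen_closed] qpaths_add[OF Qs *, THEN free_gen_closed]
    have "qproj (free_gen R (xs @ (c, x \<oplus>\<^bsub>(Qs ! length xs) c d\<^esub> y, d) # ys))
      = qproj (free_gen R (xs @ (c, x, d) # ys) \<oplus>\<^bsub>?F\<^esub> free_gen R (xs @ (c, y, d) # ys))"
      using * gens by (intro rel multilinear_relations_addI) simp_all
    also note linear_maps_add[OF qproj_linear gens(1,2)]
    finally show "qproj (free_gen R (xs @ (c, x \<oplus>\<^bsub>(Qs ! length xs) c d\<^esub> y, d) # ys))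
      = qproj (free_gen R (xs @ (c, x, d) # ys)) \<oplus>\<^bsub>qtens R S Qs a b\<^esub> qproj (free_gen R (xs @ (c, y, d) # ys))" .
  next
    fix xs c r x d ys
    assume *: "r \<in> carrier R" "xs @ (c, x, d) # ys \<in> qpaths S Qs a b"
    note gens = *(2)[THEN free_gen_closed] qpaths_smult[OF Qs *, THEN free_gen_closed]
    have "qproj (free_gen R (xs @ (c, r \<odot>\<^bsub>(Qs ! length xs) c d\<^esub> x, d) # ys))
      = qproj (r \<odot>\<^bsub>?F\<^esub> free_gen R (xs @ (c, x, d) # ys))"
      using * gens by (intro rel multilinear_relations_smultI) simp_all
    also note linear_maps_smult[OF qproj_linear *(1) gens(1)]
    finally show "qproj (free_gen R (xs @ (c, r \<odot>\<^bsub>(Qs ! length xs) c d\<^esub> x, d) # ys))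
      = r \<odot>\<^bsub>qtens R S Qs a b\<^esub> qproj (free_gen R (xs @ (c, x, d) # ys))" .
  qed
qed

lemma ptens_closed: "xs \<in> qpaths S Qs a b \<Longrightarrow> ptens R S Qs a b xs \<in> carrier (qtens R S Qs a b)"
  using multilinear_closed[OF ptens_multilinear] .

text \<open>Pure tensors generate: pulled back along the projection, both maps are linear on a free
  module and agree on its generators.\<close>

lemma qtens_ext:
  assumes "module R N" "f \<in> linear_maps R (qtens R S Qs a b) N" "g \<in> linear_maps R (qtens R S Qs a b) N"
    and "\<And>xs. xs \<in> qpaths S Qs a b \<Longrightarrow> f (ptens R S Qs a b xs) = g (ptens R S Qs a b xs)"
    and "U \<in> carrier (qtens R S Qs a b)"
  shows "f U = g U"
proof -
  obtain u where u: "u \<in> carrier (free_module R (qpaths S Qs a b))" "U = qproj u"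
    using assms(5) by (auto simp: qtens_def F.quotient_carrier[OF qtens_rel_submodule])
  have "(\<lambda>u. f (qproj u)) u = (\<lambda>u. g (qproj u)) u"
    by (rule free_module_ext[OF assms(1) linear_maps_comp[OF qproj_linear assms(2)]
          linear_maps_comp[OF qproj_linear assms(3)] _ u(1)])
      (use assms(4) in \<open>simp add: ptens_def\<close>)
  then show ?thesis using u by simp
qed

context
  fixes N :: "('k, 'n) module" and \<phi>
  assumes N: "module R N" and \<phi>: "multilinear R S Qs a b N \<phi>"
begin

private lemma lift_linear: "free_lift R N \<phi> \<in> linear_maps R (free_module R (qpaths S Qs a b)) N"
  using \<phi> by (intro free_lift_linear N) (simp add: multilinear_def)

text \<open>The kernel of the lift is a submodule that contains every multilinear relation, hence
  also the submodule generated by them.\<close>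

private lemma lift_rel: "u \<in> qtens_rel R S Qs a b \<Longrightarrow> free_lift R N \<phi> u = \<zero>\<^bsub>N\<^esub>"
proof -
  interpret N: module R N by (rule N)
  let ?F = "free_module R (qpaths S Qs a b)"
  let ?K = "{u \<in> carrier ?F. free_lift R N \<phi> u = \<zero>\<^bsub>N\<^esub>}"
  \<comment> \<open>As a scalar multiple, the negative is covered by linearity, which gives closure
    of the kernel under negation.\<close>
  have neg: "\<ominus>\<^bsub>?F\<^esub> u = (\<ominus> \<one>) \<odot>\<^bsub>?F\<^esub> u" if "u \<in> carrier ?F" for u
    using that by (simp add: F.smult_l_minus)
  have K: "submodule ?K R ?F"
    using linear_maps_zero[OF free_module_module N lift_linear]
    by (intro F.submoduleI)
      (auto simp: linear_maps_add[OF lift_linear] linear_maps_smult[OF lift_linear] neg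
        simp del: F.smult_l_minus)
  have gen: "free_lift R N \<phi> (free_gen R xs) = \<phi> xs" if "xs \<in> qpaths S Qs a b" for xs
    using that \<phi> by (intro free_lift_gen N) (simp add: multilinear_def)
  have \<phi>c: "\<phi> xs \<in> carrier N" if "xs \<in> qpaths S Qs a b" for xs
    using that \<phi> by (simp add: multilinear_def)
  have "multilinear_relations R S Qs a b \<subseteq> ?K"
  proof
    fix u assume u: "u \<in> multilinear_relations R S Qs a b"
    then have uF: "u \<in> carrier ?F" using multilinear_relations_closed by blast
    have "free_lift R N \<phi> u = \<zero>\<^bsub>N\<^esub>"
      using u unfolding multilinear_relations_def Let_def
    proof (elim UnE CollectE exE conjE)
      fix xs c x y d ys
      assume *: "xs @ (c, x, d) # ys \<in> qpaths S Qs a b" "xs @ (c, y, d) # ys \<in> qpaths S Qs a b"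
        and u: "u = free_gen R (xs @ (c, x \<oplus>\<^bsub>(Qs ! length xs) c d\<^esub> y, d) # ys)
        \<ominus>\<^bsub>?F\<^esub> (free_gen R (xs @ (c, x, d) # ys) \<oplus>\<^bsub>?F\<^esub> free_gen R (xs @ (c, y, d) # ys))"
      note m = qpaths_add[OF Qs *]
      have "\<phi> (xs @ (c, x \<oplus>\<^bsub>(Qs ! length xs) c d\<^esub> y, d) # ys)
         = \<phi> (xs @ (c, x, d) # ys) \<oplus>\<^bsub>N\<^esub> \<phi> (xs @ (c, y, d) # ys)"
        using \<phi> * unfolding multilinear_def by blast
      then show ?thesis unfolding u using * m \<phi>c
        by (subst linear_maps_minus[OF free_module_module N lift_linear])
          (simp_all add: linear_maps_add[OF lift_linear] gen free_gen_closed a_minus_def N.M.r_neg)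
    next
      fix xs c r x d ys
      assume *: "r \<in> carrier R" "xs @ (c, x, d) # ys \<in> qpaths S Qs a b"
        and u: "u = free_gen R (xs @ (c, r \<odot>\<^bsub>(Qs ! length xs) c d\<^esub> x, d) # ys)
          \<ominus>\<^bsub>?F\<^esub> r \<odot>\<^bsub>?F\<^esub> free_gen R (xs @ (c, x, d) # ys)"
      note m = qpaths_smult[OF Qs *]
      have "\<phi> (xs @ (c, r \<odot>\<^bsub>(Qs ! length xs) c d\<^esub> x, d) # ys) = r \<odot>\<^bsub>N\<^esub> \<phi> (xs @ (c, x, d) # ys)"
        using \<phi> * unfolding multilinear_def by blast
      then show ?thesis unfolding u using * m \<phi>c
        by (subst linear_maps_minus[OF free_module_module N lift_linear])
          (simp_all add: linear_maps_smult[OF lift_linear] gen free_gen_closed a_minus_def N.M.r_neg)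
    qed
    with uF show "u \<in> ?K" by simp
  qed
  from submodule_generated_least[OF K this]
  show "u \<in> qtens_rel R S Qs a b \<Longrightarrow> free_lift R N \<phi> u = \<zero>\<^bsub>N\<^esub>"
    unfolding qtens_rel_def by blast
qed

text \<open>Independence of the representative chosen by \<open>SOME\<close>: two representatives
  differ by an element of \<open>qtens_rel\<close>, where the lift vanishes.\<close>

private lemma qtens_lift_qproj:
  assumes u: "u \<in> carrier (free_module R (qpaths S Qs a b))"
  shows "qtens_lift R N \<phi> (qproj u) = free_lift R N \<phi> u"
proof -
  interpret N: module R N by (rule N)
  interpret A: abelian_subgroup "qtens_rel R S Qs a b" "free_module R (qpaths S Qs a b)"
    by (rule F.submodule_abelian_subgroup[OF qtens_rel_submodule])
  have "u \<in> qproj u" using A.a_rcos_self u by blast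
  then have "(SOME v. v \<in> qproj u) \<in> qproj u" by (rule someI[of "\<lambda>v. v \<in> qproj u"])
  from F.mem_coset[OF qtens_rel_submodule u this]
  have v: "(SOME v. v \<in> qproj u) \<in> carrier (free_module R (qpaths S Qs a b))"
    "(SOME v. v \<in> qproj u) \<ominus>\<^bsub>free_module R (qpaths S Qs a b)\<^esub> u \<in> qtens_rel R S Qs a b" by auto
  have "free_lift R N \<phi> (SOME v. v \<in> qproj u) \<ominus>\<^bsub>N\<^esub> free_lift R N \<phi> u = \<zero>\<^bsub>N\<^esub>"
    using lift_rel[OF v(2)] linear_maps_minus[OF free_module_module N lift_linear v(1) u] by simp
  then show ?thesis
    unfolding qtens_lift_def
    using linear_maps_closed[OF lift_linear u] linear_maps_closed[OF lift_linear v(1)]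
    by (metis N.M.add.inv_equality N.M.minus_eq N.M.minus_minus N.M.add.inv_closed)
qed

lemma qtens_lift_linear: "qtens_lift R N \<phi> \<in> linear_maps R (qtens R S Qs a b) N"
proof (rule linear_mapsI)
  note qc = F.quotient_carrier[OF qtens_rel_submodule, folded qtens_def]
  fix U assume U: "U \<in> carrier (qtens R S Qs a b)"
  then obtain u where u: "u \<in> carrier (free_module R (qpaths S Qs a b))" "U = qproj u"
    by (auto simp: qc)
  show "qtens_lift R N \<phi> U \<in> carrier N"
    using u by (simp add: qtens_lift_qproj linear_maps_closed[OF lift_linear])
  show "qtens_lift R N \<phi> (r \<odot>\<^bsub>qtens R S Qs a b\<^esub> U) = r \<odot>\<^bsub>N\<^esub> qtens_lift R N \<phi> U"
    if "r \<in> carrier R" for r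
    using u that linear_maps_smult[OF qproj_linear, of r u, symmetric]
    by (simp add: qtens_lift_qproj linear_maps_smult[OF lift_linear])
  fix V assume "V \<in> carrier (qtens R S Qs a b)"
  then obtain v where v: "v \<in> carrier (free_module R (qpaths S Qs a b))" "V = qproj v"
    by (auto simp: qc)
  show "qtens_lift R N \<phi> (U \<oplus>\<^bsub>qtens R S Qs a b\<^esub> V) = qtens_lift R N \<phi> U \<oplus>\<^bsub>N\<^esub> qtens_lift R N \<phi> V"
    using u v linear_maps_add[OF qproj_linear, of u v, symmetric]
    by (simp add: qtens_lift_qproj linear_maps_add[OF lift_linear])
qed

lemma qtens_lift_ptens: "xs \<in> qpaths S Qs a b \<Longrightarrow> qtens_lift R N \<phi> (ptens R S Qs a b xs) = \<phi> xs"
  unfolding ptens_def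
  by (subst qtens_lift_qproj)
    (auto simp: free_gen_closed intro!: free_lift_gen N multilinear_closed[OF \<phi>])

end

end

end

lemma multilinear_append_left:
  assumes "multilinear R S (Qs @ Ps) a b N \<phi>" "ys \<in> qpaths S Ps c b"
  shows "multilinear R S Qs a c N (\<lambda>xs. \<phi> (xs @ ys))"
proof -
  have mem: "xs \<in> qpaths S Qs a c \<Longrightarrow> xs @ ys \<in> qpaths S (Qs @ Ps) a b" for xs
    by (rule qpaths_append[OF _ assms(2)])
  have nth: "(Qs @ Ps) ! length xs = Qs ! length xs" if "xs @ z # zs \<in> qpaths S Qs a c" for xs zs z
    using qpaths_length[OF that] by (simp add: nth_append)
  show ?thesis unfolding multilinear_def
  proof (intro conjI ballI allI impI)
    fix xs assume "xs \<in> qpaths S Qs a c"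
    then show "\<phi> (xs @ ys) \<in> carrier N" using multilinear_closed[OF assms(1)] mem by blast
  next
    fix xs e x y d zs
    assume *: "xs @ (e, x, d) # zs \<in> qpaths S Qs a c" "xs @ (e, y, d) # zs \<in> qpaths S Qs a c"
    then show "\<phi> ((xs @ (e, x \<oplus>\<^bsub>(Qs ! length xs) e d\<^esub> y, d) # zs) @ ys)
      = \<phi> ((xs @ (e, x, d) # zs) @ ys) \<oplus>\<^bsub>N\<^esub> \<phi> ((xs @ (e, y, d) # zs) @ ys)"
      using multilinear_add[OF assms(1), of xs e x d "zs @ ys" y] mem[OF *(1)] mem[OF *(2)]
      by (simp add: nth[OF *(1)])
  next
    fix xs e r x d zs
    assume *: "r \<in> carrier R" "xs @ (e, x, d) # zs \<in> qpaths S Qs a c"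
    then show "\<phi> ((xs @ (e, r \<odot>\<^bsub>(Qs ! length xs) e d\<^esub> x, d) # zs) @ ys)
      = r \<odot>\<^bsub>N\<^esub> \<phi> ((xs @ (e, x, d) # zs) @ ys)"
      using multilinear_smult[OF assms(1) *(1), of xs e x d "zs @ ys"] mem[OF *(2)]
      by (simp add: nth[OF *(2)])
  qed
qed

lemma multilinear_append_right:
  assumes "multilinear R S (Qs @ Ps) a b N \<phi>" "xs \<in> qpaths S Qs a c"
  shows "multilinear R S Ps c b N (\<lambda>ys. \<phi> (xs @ ys))"
proof -
  have mem: "ys \<in> qpaths S Ps c b \<Longrightarrow> xs @ ys \<in> qpaths S (Qs @ Ps) a b" for ys
    by (rule qpaths_append[OF assms(2)])
  have nth: "(Qs @ Ps) ! (length xs + n) = Ps ! n" for n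
    using qpaths_length[OF assms(2)] by (simp add: nth_append)
  show ?thesis unfolding multilinear_def
  proof (intro conjI ballI allI impI)
    fix ys assume "ys \<in> qpaths S Ps c b"
    then show "\<phi> (xs @ ys) \<in> carrier N" using multilinear_closed[OF assms(1)] mem by blast
  next
    fix ys e x y d zs
    assume *: "ys @ (e, x, d) # zs \<in> qpaths S Ps c b" "ys @ (e, y, d) # zs \<in> qpaths S Ps c b"
    then show "\<phi> (xs @ ys @ (e, x \<oplus>\<^bsub>(Ps ! length ys) e d\<^esub> y, d) # zs)
      = \<phi> (xs @ ys @ (e, x, d) # zs) \<oplus>\<^bsub>N\<^esub> \<phi> (xs @ ys @ (e, y, d) # zs)"
      using multilinear_add[OF assms(1), of "xs @ ys" e x d zs y] mem[OF *(1)] mem[OF *(2)]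
      by (simp add: nth)
  next
    fix ys e r x d zs
    assume *: "r \<in> carrier R" "ys @ (e, x, d) # zs \<in> qpaths S Ps c b"
    then show "\<phi> (xs @ ys @ (e, r \<odot>\<^bsub>(Ps ! length ys) e d\<^esub> x, d) # zs)
      = r \<odot>\<^bsub>N\<^esub> \<phi> (xs @ ys @ (e, x, d) # zs)"
      using multilinear_smult[OF assms(1) *(1), of "xs @ ys" e x d zs] mem[OF *(2)]
      by (simp add: nth)
  qed
qed

lemma module_quivers_append [simp]:
  "module_quivers R S (Qs @ Ps) \<longleftrightarrow> module_quivers R S Qs \<and> module_quivers R S Ps"
  by (auto simp: module_quivers_def)

lemma module_quivers_Nil [simp]: "module_quivers R S []"
  by (simp add: module_quivers_def)

lemma module_quivers_Cons:
  "module_quivers R S (Q # Qs) \<longleftrightarrow> (\<forall>c\<in>S. \<forall>d\<in>S. module R (Q c d)) \<and> module_quivers R S Qs"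
  by (simp add: module_quivers_def)

section \<open>The concatenation product of tensors\<close>

context quiver_tensors
begin

context
  fixes Qs Ps :: "('k, 's, 'm) quiver list"
  assumes Qs: "module_quivers R S Qs" and Ps: "module_quivers R S Ps"
begin

private lemma QPs: "module_quivers R S (Qs @ Ps)"
  using Qs Ps by simp

private lemma inner_multilinear:
  "xs \<in> qpaths S Qs a c \<Longrightarrow>
    multilinear R S Ps c b (qtens R S (Qs @ Ps) a b) (\<lambda>ys. ptens R S (Qs @ Ps) a b (xs @ ys))"
  by (rule multilinear_append_right[OF ptens_multilinear[OF QPs]])

private abbreviation inner where
  "inner a b xs V \<equiv> qtens_lift R (qtens R S (Qs @ Ps) a b) (\<lambda>ys. ptens R S (Qs @ Ps) a b (xs @ ys)) V"

private lemmas inner_linear = qtens_lift_linear[OF Ps qtens_module[OF QPs] inner_multilinear]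

private lemmas inner_ptens = qtens_lift_ptens[OF Ps qtens_module[OF QPs] inner_multilinear]

text \<open>The inner lift is already linear in \<open>V\<close>, so the equations for a slot of
  \<open>xs\<close> may be tested on pure \<open>V\<close>. There they are the relations satisfied
  by \<open>ptens\<close> on the concatenated path.\<close>

private lemma outer_multilinear:
  assumes V: "V \<in> carrier (qtens R S Ps c b)"
  shows "multilinear R S Qs a c (qtens R S (Qs @ Ps) a b) (\<lambda>xs. inner a b xs V)"
  unfolding multilinear_def
proof (intro conjI ballI allI impI)
  fix xs assume "xs \<in> qpaths S Qs a c"
  then show "inner a b xs V \<in> carrier (qtens R S (Qs @ Ps) a b)"
    by (rule linear_maps_closed[OF inner_linear V])
next
  let ?N = "qtens R S (Qs @ Ps) a b"
  fix xs e x y d zs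
  assume *: "xs @ (e, x, d) # zs \<in> qpaths S Qs a c" "xs @ (e, y, d) # zs \<in> qpaths S Qs a c"
  note sum = qpaths_add[OF Qs *]
  show "inner a b (xs @ (e, x \<oplus>\<^bsub>(Qs ! length xs) e d\<^esub> y, d) # zs) V
      = inner a b (xs @ (e, x, d) # zs) V \<oplus>\<^bsub>?N\<^esub> inner a b (xs @ (e, y, d) # zs) V"
    (is "?f V = ?g V \<oplus>\<^bsub>?N\<^esub> ?h V")
  proof (rule qtens_ext[OF Ps qtens_module[OF QPs] inner_linear[OF sum]
        linear_maps_plus[OF qtens_module[OF QPs] inner_linear[OF *(1)] inner_linear[OF *(2)]] _ V])
    fix ys assume ys: "ys \<in> qpaths S Ps c b"
    show "?f (ptens R S Ps c b ys) = ?g (ptens R S Ps c b ys) \<oplus>\<^bsub>?N\<^esub> ?h (ptens R S Ps c b ys)"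
      unfolding inner_ptens[OF sum ys] inner_ptens[OF *(1) ys] inner_ptens[OF *(2) ys]
      using multilinear_add[OF multilinear_append_left[OF ptens_multilinear[OF QPs] ys] *]
      by simp
  qed
next
  let ?N = "qtens R S (Qs @ Ps) a b"
  fix xs e r x d zs
  assume *: "r \<in> carrier R" "xs @ (e, x, d) # zs \<in> qpaths S Qs a c"
  note sm = qpaths_smult[OF Qs *]
  show "inner a b (xs @ (e, r \<odot>\<^bsub>(Qs ! length xs) e d\<^esub> x, d) # zs) V
      = r \<odot>\<^bsub>?N\<^esub> inner a b (xs @ (e, x, d) # zs) V"
    (is "?f V = r \<odot>\<^bsub>?N\<^esub> ?g V")
  proof (rule qtens_ext[OF Ps qtens_module[OF QPs] inner_linear[OF sm]
        linear_maps_scale[OF qtens_module[OF QPs] inner_linear[OF *(2)] *(1)] _ V])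
    fix ys assume ys: "ys \<in> qpaths S Ps c b"
    show "?f (ptens R S Ps c b ys) = r \<odot>\<^bsub>?N\<^esub> ?g (ptens R S Ps c b ys)"
      unfolding inner_ptens[OF sm ys] inner_ptens[OF *(2) ys]
      using multilinear_smult[OF multilinear_append_left[OF ptens_multilinear[OF QPs] ys] *]
      by simp
  qed
qed

lemma qcat_linear_left:
  "V \<in> carrier (qtens R S Ps c b) \<Longrightarrow>
    (\<lambda>U. qcat R S Qs Ps a b U V) \<in> linear_maps R (qtens R S Qs a c) (qtens R S (Qs @ Ps) a b)"
  unfolding qcat_def Let_def
  by (rule qtens_lift_linear[OF Qs qtens_module[OF QPs] outer_multilinear])

private lemma qcat_ptens_left:
  "\<lbrakk>xs \<in> qpaths S Qs a c; V \<in> carrier (qtens R S Ps c b)\<rbrakk> \<Longrightarrow>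
    qcat R S Qs Ps a b (ptens R S Qs a c xs) V = inner a b xs V"
  unfolding qcat_def Let_def
  by (rule qtens_lift_ptens[OF Qs qtens_module[OF QPs] outer_multilinear])

lemma qcat_ptens:
  "\<lbrakk>xs \<in> qpaths S Qs a c; ys \<in> qpaths S Ps c b\<rbrakk> \<Longrightarrow>
    qcat R S Qs Ps a b (ptens R S Qs a c xs) (ptens R S Ps c b ys) = ptens R S (Qs @ Ps) a b (xs @ ys)"
  by (simp add: qcat_ptens_left ptens_closed[OF Ps] inner_ptens)

lemma qcat_closed:
  "\<lbrakk>U \<in> carrier (qtens R S Qs a c); V \<in> carrier (qtens R S Ps c b)\<rbrakk> \<Longrightarrow>
    qcat R S Qs Ps a b U V \<in> carrier (qtens R S (Qs @ Ps) a b)"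
  by (rule linear_maps_closed[OF qcat_linear_left])

text \<open>\<open>qcat\<close> is an outer lift in \<open>U\<close>, so linearity in
  \<open>V\<close> cannot be read off from its definition. Both sides are linear in
  \<open>U\<close>, and for pure \<open>U\<close> only the inner lift remains.\<close>

lemma qcat_linear_right:
  assumes U: "U \<in> carrier (qtens R S Qs a c)"
  shows "(\<lambda>V. qcat R S Qs Ps a b U V) \<in> linear_maps R (qtens R S Ps c b) (qtens R S (Qs @ Ps) a b)"
proof (rule linear_mapsI)
  let ?N = "qtens R S (Qs @ Ps) a b"
  interpret P: module R "qtens R S Ps c b" by (rule qtens_module[OF Ps])
  fix V assume V: "V \<in> carrier (qtens R S Ps c b)"
  show "qcat R S Qs Ps a b U V \<in> carrier ?N" using U V by (rule qcat_closed)
  show "qcat R S Qs Ps a b U (r \<odot>\<^bsub>qtens R S Ps c b\<^esub> V) = r \<odot>\<^bsub>?N\<^esub> qcat R S Qs Ps a b U V"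
    if r: "r \<in> carrier R" for r
    using V r
    by (intro qtens_ext[OF Qs qtens_module[OF QPs] qcat_linear_left
         linear_maps_scale[OF qtens_module[OF QPs] qcat_linear_left] _ U])
      (auto simp: qcat_ptens_left linear_maps_smult[OF inner_linear])
  show "qcat R S Qs Ps a b U (V \<oplus>\<^bsub>qtens R S Ps c b\<^esub> W) = qcat R S Qs Ps a b U V \<oplus>\<^bsub>?N\<^esub> qcat R S Qs Ps a b U W"
    if W: "W \<in> carrier (qtens R S Ps c b)" for W
    using V W
    by (intro qtens_ext[OF Qs qtens_module[OF QPs] qcat_linear_left
         linear_maps_plus[OF qtens_module[OF QPs] qcat_linear_left qcat_linear_left] _ U])
      (auto simp: qcat_ptens_left linear_maps_add[OF inner_linear])
qed

end

text \<open>On pure tensors this is associativity of list concatenation. Then \<open>W\<close>,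
  \<open>V\<close> and \<open>U\<close> are made arbitrary one after the other, each time by
  linearity in that argument.\<close>

lemma qcat_assoc:
  assumes Qs: "module_quivers R S Qs" and Ps: "module_quivers R S Ps" and Ts: "module_quivers R S Ts"
    and U: "U \<in> carrier (qtens R S Qs a c)" and V: "V \<in> carrier (qtens R S Ps c d)"
    and W: "W \<in> carrier (qtens R S Ts d b)"
  shows "qcat R S (Qs @ Ps) Ts a b (qcat R S Qs Ps a d U V) W
    = qcat R S Qs (Ps @ Ts) a b U (qcat R S Ps Ts c b V W)"
proof -
  have QP: "module_quivers R S (Qs @ Ps)" and PT: "module_quivers R S (Ps @ Ts)"
    and QPT: "module_quivers R S ((Qs @ Ps) @ Ts)" "module_quivers R S (Qs @ Ps @ Ts)"
    using Qs Ps Ts by simp_all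
  note N = qtens_module[OF QPT(2)]
  have 1: "qcat R S (Qs @ Ps) Ts a b (qcat R S Qs Ps a d (ptens R S Qs a c xs) (ptens R S Ps c d ys)) (ptens R S Ts d b zs)
    = qcat R S Qs (Ps @ Ts) a b (ptens R S Qs a c xs) (qcat R S Ps Ts c b (ptens R S Ps c d ys) (ptens R S Ts d b zs))"
    if "xs \<in> qpaths S Qs a c" "ys \<in> qpaths S Ps c d" "zs \<in> qpaths S Ts d b" for xs ys zs
    using that qpaths_append[OF that(1,2)] qpaths_append[OF that(2,3)]
    by (simp add: qcat_ptens[OF Qs Ps, where c=c] qcat_ptens[OF Ps Ts, where c=d]
      qcat_ptens[OF Qs PT, where c=c] qcat_ptens[OF QP Ts, where c=d])
  have 2: "qcat R S (Qs @ Ps) Ts a b (qcat R S Qs Ps a d (ptens R S Qs a c xs) (ptens R S Ps c d ys)) W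
    = qcat R S Qs (Ps @ Ts) a b (ptens R S Qs a c xs) (qcat R S Ps Ts c b (ptens R S Ps c d ys) W)"
    if "xs \<in> qpaths S Qs a c" "ys \<in> qpaths S Ps c d" for xs ys
  proof -
    have h1: "qcat R S (Qs @ Ps) Ts a b (qcat R S Qs Ps a d (ptens R S Qs a c xs) (ptens R S Ps c d ys))
      \<in> linear_maps R (qtens R S Ts d b) (qtens R S (Qs @ Ps @ Ts) a b)"
      using qcat_linear_right[OF QP Ts qcat_closed[OF Qs Ps ptens_closed[OF Qs that(1)] ptens_closed[OF Ps that(2)]]]
      by simp
    have h2: "qcat R S Qs (Ps @ Ts) a b (ptens R S Qs a c xs)
      \<in> linear_maps R (qtens R S (Ps @ Ts) c b) (qtens R S (Qs @ Ps @ Ts) a b)"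
      using qcat_linear_right[OF Qs PT ptens_closed[OF Qs that(1)]] by simp
    have h3: "qcat R S Ps Ts c b (ptens R S Ps c d ys) \<in> linear_maps R (qtens R S Ts d b) (qtens R S (Ps @ Ts) c b)"
      using qcat_linear_right[OF Ps Ts ptens_closed[OF Ps that(2)]] by simp
    show ?thesis
      by (rule qtens_ext[OF Ts N h1 linear_maps_comp[OF h3 h2] _ W]) (use 1 that in blast)
  qed
  have 3: "qcat R S (Qs @ Ps) Ts a b (qcat R S Qs Ps a d (ptens R S Qs a c xs) V) W
    = qcat R S Qs (Ps @ Ts) a b (ptens R S Qs a c xs) (qcat R S Ps Ts c b V W)"
    if "xs \<in> qpaths S Qs a c" for xs
  proof -
    have h1: "qcat R S Qs Ps a d (ptens R S Qs a c xs) \<in> linear_maps R (qtens R S Ps c d) (qtens R S (Qs @ Ps) a d)"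
      using qcat_linear_right[OF Qs Ps ptens_closed[OF Qs that]] by simp
    have h2: "(\<lambda>V. qcat R S (Qs @ Ps) Ts a b V W) \<in> linear_maps R (qtens R S (Qs @ Ps) a d) (qtens R S (Qs @ Ps @ Ts) a b)"
      using qcat_linear_left[OF QP Ts W] by simp
    have h3: "(\<lambda>V. qcat R S Ps Ts c b V W) \<in> linear_maps R (qtens R S Ps c d) (qtens R S (Ps @ Ts) c b)"
      by (rule qcat_linear_left[OF Ps Ts W])
    have h4: "qcat R S Qs (Ps @ Ts) a b (ptens R S Qs a c xs) \<in> linear_maps R (qtens R S (Ps @ Ts) c b) (qtens R S (Qs @ Ps @ Ts) a b)"
      using qcat_linear_right[OF Qs PT ptens_closed[OF Qs that]] by simp
    show ?thesis
      by (rule qtens_ext[OF Ps N linear_maps_comp[OF h1 h2] linear_maps_comp[OF h3 h4] _ V]) (use 2 that in blast)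
  qed
  have h1: "(\<lambda>U. qcat R S Qs Ps a d U V) \<in> linear_maps R (qtens R S Qs a c) (qtens R S (Qs @ Ps) a d)"
      by (rule qcat_linear_left[OF Qs Ps V])
  have h2: "(\<lambda>V. qcat R S (Qs @ Ps) Ts a b V W) \<in> linear_maps R (qtens R S (Qs @ Ps) a d) (qtens R S (Qs @ Ps @ Ts) a b)"
      using qcat_linear_left[OF QP Ts W] by simp
  have h3: "(\<lambda>U. qcat R S Qs (Ps @ Ts) a b U (qcat R S Ps Ts c b V W)) \<in> linear_maps R (qtens R S Qs a c) (qtens R S (Qs @ Ps @ Ts) a b)"
      by (rule qcat_linear_left[OF Qs PT qcat_closed[OF Ps Ts V W]])
  show ?thesis
    by (rule qtens_ext[OF Qs N linear_maps_comp[OF h1 h2] h3 _ U]) (use 3 in blast)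
qed

lemma ptens_Nil_closed: "ptens R S ([] :: ('k, 's, 'm) quiver list) a a [] \<in> carrier (qtens R S [] a a)"
  by (rule ptens_closed) auto

lemma qcat_unit_right:
  assumes Qs: "module_quivers R S Qs" and U: "U \<in> carrier (qtens R S Qs a b)"
  shows "qcat R S Qs [] a b U (ptens R S [] b b []) = U"
proof (rule qtens_ext[OF Qs qtens_module[OF Qs] _ linear_maps_id _ U])
  show "(\<lambda>U. qcat R S Qs [] a b U (ptens R S [] b b [])) \<in> linear_maps R (qtens R S Qs a b) (qtens R S Qs a b)"
    using qcat_linear_left[OF Qs module_quivers_Nil ptens_Nil_closed] by simp
  show "qcat R S Qs [] a b (ptens R S Qs a b xs) (ptens R S [] b b []) = ptens R S Qs a b xs"
    if "xs \<in> qpaths S Qs a b" for xs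
    using qcat_ptens[OF Qs module_quivers_Nil that, of "[]" b] by simp
qed

lemma qcat_unit_left:
  assumes Qs: "module_quivers R S Qs" and U: "U \<in> carrier (qtens R S Qs a b)"
  shows "qcat R S [] Qs a b (ptens R S [] a a []) U = U"
proof (rule qtens_ext[OF Qs qtens_module[OF Qs] _ linear_maps_id _ U])
  show "qcat R S [] Qs a b (ptens R S [] a a []) \<in> linear_maps R (qtens R S Qs a b) (qtens R S Qs a b)"
    using qcat_linear_right[OF module_quivers_Nil Qs ptens_Nil_closed] by simp
  show "qcat R S [] Qs a b (ptens R S [] a a []) (ptens R S Qs a b xs) = ptens R S Qs a b xs"
    if "xs \<in> qpaths S Qs a b" for xs
    using qcat_ptens[OF module_quivers_Nil Qs _ that, of "[]" a] by simp
qed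

end

section \<open>Linear morphisms between tensor products\<close>

definition linear_arr :: "('k, 'z) ring_scheme \<Rightarrow> 's set \<Rightarrow> ('k, 's, 'm) qarr \<Rightarrow> bool" where
  "linear_arr R S f \<longleftrightarrow> module_quivers R S (qdom f) \<and> module_quivers R S (qcod f) \<and>
     (\<forall>a\<in>S. \<forall>b\<in>S. qfun f a b \<in> linear_maps R (qtens R S (qdom f) a b) (qtens R S (qcod f) a b))"

lemma linear_arr_dom: "linear_arr R S f \<Longrightarrow> module_quivers R S (qdom f)"
  and linear_arr_cod: "linear_arr R S f \<Longrightarrow> module_quivers R S (qcod f)"
  and linear_arr_fun: "\<lbrakk>linear_arr R S f; a \<in> S; b \<in> S\<rbrakk>
    \<Longrightarrow> qfun f a b \<in> linear_maps R (qtens R S (qdom f) a b) (qtens R S (qcod f) a b)"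
  by (auto simp: linear_arr_def)

lemma qcomp_simps [simp]:
  "qdom (qcomp g f) = qdom f" "qcod (qcomp g f) = qcod g"
  "qfun (qcomp g f) a b u = qfun g a b (qfun f a b u)"
  by (simp_all add: qcomp_def)

lemma qid_simps [simp]: "qdom (qid Qs) = Qs" "qcod (qid Qs) = Qs" "qfun (qid Qs) a b u = u"
  by (simp_all add: qid_def)

lemma qtensor_simps [simp]:
  "qdom (qtensor R S f g) = qdom f @ qdom g" "qcod (qtensor R S f g) = qcod f @ qcod g"
  by (simp_all add: qtensor_def)

lemma qcomp_assoc: "qcomp h (qcomp g f) = qcomp (qcomp h g) f"
  by (simp add: qcomp_def)

lemma linear_arr_qcomp:
  assumes f: "linear_arr R S f" and g: "linear_arr R S g" and fg: "qdom g = qcod f"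
  shows "linear_arr R S (qcomp g f)"
  unfolding linear_arr_def
proof (intro conjI ballI)
  fix a b assume ab: "a \<in> S" "b \<in> S"
  from linear_maps_comp[OF linear_arr_fun[OF f ab] linear_arr_fun[OF g ab, unfolded fg]]
  show "qfun (qcomp g f) a b \<in> linear_maps R (qtens R S (qdom (qcomp g f)) a b) (qtens R S (qcod (qcomp g f)) a b)"
    by (simp add: qcomp_def)
qed (use linear_arr_dom[OF f] linear_arr_cod[OF g] in simp_all)

lemma linear_arr_qid: "module_quivers R S Qs \<Longrightarrow> linear_arr R S (qid Qs)"
  by (auto simp: linear_arr_def qid_def linear_maps_id)

lemma qarr_eq_refl: "qarr_eq R S f f"
  by (simp add: qarr_eq_def)

lemma qarr_eq_sym: "qarr_eq R S f g \<Longrightarrow> qarr_eq R S g f"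
  by (simp add: qarr_eq_def)

lemma qarr_eq_trans [trans]: "\<lbrakk>qarr_eq R S f g; qarr_eq R S g h\<rbrakk> \<Longrightarrow> qarr_eq R S f h"
  by (simp add: qarr_eq_def)

lemma qarr_eqD:
  "\<lbrakk>qarr_eq R S f g; a \<in> S; b \<in> S; u \<in> carrier (qtens R S (qdom f) a b)\<rbrakk> \<Longrightarrow> qfun f a b u = qfun g a b u"
  by (simp add: qarr_eq_def)

lemma qarr_eq_dom: "qarr_eq R S f g \<Longrightarrow> qdom f = qdom g"
  and qarr_eq_cod: "qarr_eq R S f g \<Longrightarrow> qcod f = qcod g"
  by (simp_all add: qarr_eq_def)

lemma qcomp_qid_left: "qcod f = Qs \<Longrightarrow> qcomp (qid Qs) f = f"
  by (simp add: qcomp_def qid_def)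

lemma qcomp_qid_right: "qdom f = Qs \<Longrightarrow> qcomp f (qid Qs) = f"
  by (simp add: qcomp_def qid_def)

text \<open>The outer arrows agree on a carrier only; linearity of \<open>f\<close> ensures that its
  values lie there.\<close>

lemma qcomp_cong:
  assumes "qarr_eq R S f f'" "qarr_eq R S g g'" "linear_arr R S f" "qdom g = qcod f"
  shows "qarr_eq R S (qcomp g f) (qcomp g' f')"
  using assms linear_maps_closed[OF linear_arr_fun[OF assms(3)]]
  by (auto simp: qarr_eq_def)

lemma qcomp_cong_left:
  "\<lbrakk>qarr_eq R S g g'; linear_arr R S f; qdom g = qcod f\<rbrakk> \<Longrightarrow> qarr_eq R S (qcomp g f) (qcomp g' f)"
  by (intro qcomp_cong qarr_eq_refl)

lemma qcomp_cong_right: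
  "qarr_eq R S f f' \<Longrightarrow> qarr_eq R S (qcomp g f) (qcomp g f')"
  by (auto simp: qarr_eq_def)

section \<open>The tensor product of arrows as an associative and unital bifunctor\<close>

context quiver_tensors
begin

lemma linear_arr_cong:
  assumes fg: "qarr_eq R S f g" and f: "linear_arr R S f"
  shows "linear_arr R S g"
proof -
  have "qfun g a b \<in> linear_maps R (qtens R S (qdom f) a b) (qtens R S (qcod f) a b)"
    if ab: "a \<in> S" "b \<in> S" for a b
  proof -
    note fab = linear_arr_fun[OF f ab]
    have eq: "qfun g a b u = qfun f a b u" if "u \<in> carrier (qtens R S (qdom f) a b)" for u
      using qarr_eqD[OF fg ab that] by simp
    interpret module R "qtens R S (qdom f) a b" by (rule qtens_module[OF linear_arr_dom[OF f]])
    show ?thesis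
      by (rule linear_mapsI)
        (simp_all add: eq linear_maps_closed[OF fab] linear_maps_add[OF fab] linear_maps_smult[OF fab])
  qed
  then show ?thesis
    using linear_arr_dom[OF f] linear_arr_cod[OF f] qarr_eq_dom[OF fg] qarr_eq_cod[OF fg]
    by (simp add: linear_arr_def)
qed

lemma qarr_eqI:
  assumes f: "linear_arr R S f" and g: "linear_arr R S g" and "qdom f = qdom g" "qcod f = qcod g"
    and "\<And>a b xs. \<lbrakk>a \<in> S; b \<in> S; xs \<in> qpaths S (qdom f) a b\<rbrakk>
      \<Longrightarrow> qfun f a b (ptens R S (qdom f) a b xs) = qfun g a b (ptens R S (qdom f) a b xs)"
  shows "qarr_eq R S f g"
  unfolding qarr_eq_def
proof (intro conjI ballI)
  fix a b u assume ab: "a \<in> S" "b \<in> S" and u: "u \<in> carrier (qtens R S (qdom f) a b)"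
  have "qfun g a b \<in> linear_maps R (qtens R S (qdom f) a b) (qtens R S (qcod f) a b)"
    using linear_arr_fun[OF g ab] assms(3,4) by simp
  from qtens_ext[OF linear_arr_dom[OF f] qtens_module[OF linear_arr_cod[OF f]] linear_arr_fun[OF f ab]
      this assms(5)[OF ab] u]
  show "qfun f a b u = qfun g a b u" .
qed fact+

context
  fixes f g :: "('k, 's, 'm) qarr"
  assumes f: "linear_arr R S f" and g: "linear_arr R S g"
begin

private abbreviation tens_fun where
  "tens_fun a b xs \<equiv> (let ys = take (length (qdom f)) xs; zs = drop (length (qdom f)) xs;
                 c = (if ys = [] then a else snd (snd (last ys)))
             in qcat R S (qcod f) (qcod g) a b
                  (qfun f a c (ptens R S (qdom f) a c ys))
                  (qfun g c b (ptens R S (qdom g) c b zs)))"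

text \<open>A path is cut after as many entries as \<open>f\<close> has factors, and by
  \<open>qpaths_end\<close> the vertex read off from the first piece is the actual intermediate
  vertex \<open>c\<close>.\<close>

private lemma tens_fun_append:
  assumes "xs \<in> qpaths S (qdom f) a c"
  shows "tens_fun a b (xs @ ys) = qcat R S (qcod f) (qcod g) a b
    (qfun f a c (ptens R S (qdom f) a c xs)) (qfun g c b (ptens R S (qdom g) c b ys))"
proof -
  have "c = (if xs = [] then a else snd (snd (last xs)))" by (rule qpaths_end[OF assms])
  then show ?thesis using qpaths_length[OF assms] by (simp add: Let_def)
qed

private lemma tens_fun_multilinear:
  assumes a: "a \<in> S" and b: "b \<in> S"
  shows "multilinear R S (qdom f @ qdom g) a b (qtens R S (qcod f @ qcod g) a b) (tens_fun a b)"
proof (rule multilinear_appendI[OF _ _ a])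
  fix c ys assume c: "c \<in> S" and ys: "ys \<in> qpaths S (qdom g) c b"
  have V: "qfun g c b (ptens R S (qdom g) c b ys) \<in> carrier (qtens R S (qcod g) c b)"
    by (rule linear_maps_closed[OF linear_arr_fun[OF g c b] ptens_closed[OF linear_arr_dom[OF g] ys]])
  show "multilinear R S (qdom f) a c (qtens R S (qcod f @ qcod g) a b) (\<lambda>xs. tens_fun a b (xs @ ys))"
    by (rule multilinear_cong[OF linear_arr_dom[OF f] tens_fun_append
          multilinear_comp[OF multilinear_comp[OF ptens_multilinear[OF linear_arr_dom[OF f]] linear_arr_fun[OF f a c]]
            qcat_linear_left[OF linear_arr_cod[OF f] linear_arr_cod[OF g] V]]])
next
  fix c xs assume c: "c \<in> S" and xs: "xs \<in> qpaths S (qdom f) a c"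
  have U: "qfun f a c (ptens R S (qdom f) a c xs) \<in> carrier (qtens R S (qcod f) a c)"
    by (rule linear_maps_closed[OF linear_arr_fun[OF f a c] ptens_closed[OF linear_arr_dom[OF f] xs]])
  show "multilinear R S (qdom g) c b (qtens R S (qcod f @ qcod g) a b) (\<lambda>ys. tens_fun a b (xs @ ys))"
    by (rule multilinear_cong[OF linear_arr_dom[OF g] tens_fun_append[OF xs]
          multilinear_comp[OF multilinear_comp[OF ptens_multilinear[OF linear_arr_dom[OF g]] linear_arr_fun[OF g c b]]
            qcat_linear_right[OF linear_arr_cod[OF f] linear_arr_cod[OF g] U]]])
qed

private lemma doms: "module_quivers R S (qdom f @ qdom g)" "module_quivers R S (qcod f @ qcod g)"
  using f g by (simp_all add: linear_arr_def)

lemma linear_arr_qtensor: "linear_arr R S (qtensor R S f g)"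
  unfolding linear_arr_def
proof (intro conjI ballI)
  fix a b assume "a \<in> S" "b \<in> S"
  from qtens_lift_linear[OF doms(1) qtens_module[OF doms(2)] tens_fun_multilinear[OF this]]
  show "qfun (qtensor R S f g) a b \<in> linear_maps R (qtens R S (qdom (qtensor R S f g)) a b)
    (qtens R S (qcod (qtensor R S f g)) a b)"
    by (simp add: qtensor_def)
qed (use doms in simp_all)

lemma qtensor_ptens:
  assumes "a \<in> S" "b \<in> S" and xs: "xs \<in> qpaths S (qdom f) a c" and ys: "ys \<in> qpaths S (qdom g) c b"
  shows "qfun (qtensor R S f g) a b (ptens R S (qdom f @ qdom g) a b (xs @ ys))
    = qcat R S (qcod f) (qcod g) a b (qfun f a c (ptens R S (qdom f) a c xs)) (qfun g c b (ptens R S (qdom g) c b ys))"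
  using qtens_lift_ptens[OF doms(1) qtens_module[OF doms(2)] tens_fun_multilinear[OF assms(1,2)] qpaths_append[OF xs ys]]
    tens_fun_append[OF xs]
  by (simp add: qtensor_def)

text \<open>Extends \<open>qtensor_ptens\<close> to arbitrary tensors, by linearity first in
  \<open>V\<close> and then in \<open>U\<close>. Arrows do not preserve pure tensors, so a second
  arrow can only be evaluated in this form.\<close>

lemma qtensor_qcat:
  assumes a: "a \<in> S" and b: "b \<in> S" and c: "c \<in> S"
    and U: "U \<in> carrier (qtens R S (qdom f) a c)" and V: "V \<in> carrier (qtens R S (qdom g) c b)"
  shows "qfun (qtensor R S f g) a b (qcat R S (qdom f) (qdom g) a b U V)
    = qcat R S (qcod f) (qcod g) a b (qfun f a c U) (qfun g c b V)"
proof -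
  note fd = linear_arr_dom[OF f] and gd = linear_arr_dom[OF g] and fc = linear_arr_cod[OF f] and gc = linear_arr_cod[OF g]
  note N = qtens_module[OF doms(2)]
  note T = linear_arr_fun[OF linear_arr_qtensor a b, simplified]
  have 1: "qfun (qtensor R S f g) a b (qcat R S (qdom f) (qdom g) a b (ptens R S (qdom f) a c xs) V)
    = qcat R S (qcod f) (qcod g) a b (qfun f a c (ptens R S (qdom f) a c xs)) (qfun g c b V)"
    if xs: "xs \<in> qpaths S (qdom f) a c" for xs
  proof (rule qtens_ext[OF gd N linear_maps_comp[OF qcat_linear_right[OF fd gd ptens_closed[OF fd xs]] T]
        linear_maps_comp[OF linear_arr_fun[OF g c b] qcat_linear_right[OF fc gc linear_maps_closed[OF linear_arr_fun[OF f a c] ptens_closed[OF fd xs]]]]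
        _ V])
    show "qfun (qtensor R S f g) a b (qcat R S (qdom f) (qdom g) a b (ptens R S (qdom f) a c xs) (ptens R S (qdom g) c b ys))
    = qcat R S (qcod f) (qcod g) a b (qfun f a c (ptens R S (qdom f) a c xs)) (qfun g c b (ptens R S (qdom g) c b ys))"
      if ys: "ys \<in> qpaths S (qdom g) c b" for ys
      by (simp add: qcat_ptens[OF fd gd xs ys] qtensor_ptens[OF a b xs ys])
  qed
  show ?thesis
    by (rule qtens_ext[OF fd N linear_maps_comp[OF qcat_linear_left[OF fd gd V] T]
        linear_maps_comp[OF linear_arr_fun[OF f a c] qcat_linear_left[OF fc gc linear_maps_closed[OF linear_arr_fun[OF g c b] V]]]
        1 U])
qed

end

lemma qtensor_cong:
  assumes f: "linear_arr R S f" and g: "linear_arr R S g" and ff': "qarr_eq R S f f'" and gg': "qarr_eq R S g g'"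
  shows "qarr_eq R S (qtensor R S f g) (qtensor R S f' g')"
proof (rule qarr_eqI)
  note f' = linear_arr_cong[OF ff' f] and g' = linear_arr_cong[OF gg' g]
  note eqs = qarr_eq_dom[OF ff'] qarr_eq_cod[OF ff'] qarr_eq_dom[OF gg'] qarr_eq_cod[OF gg']
  show "linear_arr R S (qtensor R S f g)" "linear_arr R S (qtensor R S f' g')"
    using f g f' g' by (auto intro: linear_arr_qtensor)
  show "qdom (qtensor R S f g) = qdom (qtensor R S f' g')" "qcod (qtensor R S f g) = qcod (qtensor R S f' g')"
    using eqs by auto
  fix a b xs assume ab: "a \<in> S" "b \<in> S" and "xs \<in> qpaths S (qdom (qtensor R S f g)) a b"
  then obtain ys zs c where *: "xs = ys @ zs" "ys \<in> qpaths S (qdom f) a c" "zs \<in> qpaths S (qdom g) c b"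
    by (auto simp: qpaths_append_iff)
  have c: "c \<in> S" by (rule qpaths_end_mem[OF *(2) ab(1)])
  have "qfun f a c (ptens R S (qdom f) a c ys) = qfun f' a c (ptens R S (qdom f) a c ys)"
    by (rule qarr_eqD[OF ff' ab(1) c ptens_closed[OF linear_arr_dom[OF f] *(2)]])
  moreover have "qfun g c b (ptens R S (qdom g) c b zs) = qfun g' c b (ptens R S (qdom g) c b zs)"
    by (rule qarr_eqD[OF gg' c ab(2) ptens_closed[OF linear_arr_dom[OF g] *(3)]])
  moreover note qtensor_ptens[OF f g ab *(2,3)]
    qtensor_ptens[OF f' g' ab *(2,3)[unfolded eqs]]
  ultimately show "qfun (qtensor R S f g) a b (ptens R S (qdom (qtensor R S f g)) a b xs)
    = qfun (qtensor R S f' g') a b (ptens R S (qdom (qtensor R S f g)) a b xs)"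
    by (simp add: * eqs)
qed

text \<open>Equality is tested on pure tensors; the first stage is then
  \<open>qtensor_ptens\<close>, and the second one, applied to tensors that need not be pure, is
  \<open>qtensor_qcat\<close>.\<close>

lemma qtensor_interchange:
  assumes f: "linear_arr R S f" and g: "linear_arr R S g" and f': "linear_arr R S f'" and g': "linear_arr R S g'"
    and ff': "qdom f' = qcod f" and gg': "qdom g' = qcod g"
  shows "qarr_eq R S (qcomp (qtensor R S f' g') (qtensor R S f g)) (qtensor R S (qcomp f' f) (qcomp g' g))"
proof (rule qarr_eqI)
  note ff = linear_arr_qcomp[OF f f' ff'] and gg = linear_arr_qcomp[OF g g' gg']
  show "linear_arr R S (qcomp (qtensor R S f' g') (qtensor R S f g))"
    by (intro linear_arr_qcomp linear_arr_qtensor f g f' g') (simp add: ff' gg')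
  show "linear_arr R S (qtensor R S (qcomp f' f) (qcomp g' g))"
    by (intro linear_arr_qtensor ff gg)
  fix a b xs assume ab: "a \<in> S" "b \<in> S"
    and "xs \<in> qpaths S (qdom (qcomp (qtensor R S f' g') (qtensor R S f g))) a b"
  then obtain ys zs c where *: "xs = ys @ zs" "ys \<in> qpaths S (qdom f) a c" "zs \<in> qpaths S (qdom g) c b"
    by (auto simp: qpaths_append_iff)
  have c: "c \<in> S" by (rule qpaths_end_mem[OF *(2) ab(1)])
  have U: "qfun f a c (ptens R S (qdom f) a c ys) \<in> carrier (qtens R S (qdom f') a c)"
    unfolding ff' by (rule linear_maps_closed[OF linear_arr_fun[OF f ab(1) c] ptens_closed[OF linear_arr_dom[OF f] *(2)]])
  have V: "qfun g c b (ptens R S (qdom g) c b zs) \<in> carrier (qtens R S (qdom g') c b)"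
    unfolding gg' by (rule linear_maps_closed[OF linear_arr_fun[OF g c ab(2)] ptens_closed[OF linear_arr_dom[OF g] *(3)]])
  show "qfun (qcomp (qtensor R S f' g') (qtensor R S f g)) a b (ptens R S (qdom (qcomp (qtensor R S f' g') (qtensor R S f g))) a b xs)
    = qfun (qtensor R S (qcomp f' f) (qcomp g' g)) a b (ptens R S (qdom (qcomp (qtensor R S f' g') (qtensor R S f g))) a b xs)"
    using qtensor_ptens[OF f g ab *(2,3)] qtensor_ptens[OF ff gg ab, of ys c zs] *
      qtensor_qcat[OF f' g' ab c U V]
    by (simp add: ff' gg')
qed simp_all

lemma qtensor_qid:
  assumes "module_quivers R S Qs" "module_quivers R S Ps"
  shows "qarr_eq R S (qtensor R S (qid Qs) (qid Ps)) (qid (Qs @ Ps))"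
proof (rule qarr_eqI)
  show "linear_arr R S (qtensor R S (qid Qs) (qid Ps))" "linear_arr R S (qid (Qs @ Ps))"
    using assms by (auto intro: linear_arr_qtensor linear_arr_qid)
  fix a b xs assume ab: "a \<in> S" "b \<in> S" and "xs \<in> qpaths S (qdom (qtensor R S (qid Qs) (qid Ps))) a b"
  then obtain ys zs c where *: "xs = ys @ zs" "ys \<in> qpaths S Qs a c" "zs \<in> qpaths S Ps c b"
    by (auto simp: qpaths_append_iff)
  then show "qfun (qtensor R S (qid Qs) (qid Ps)) a b (ptens R S (qdom (qtensor R S (qid Qs) (qid Ps))) a b xs) =
       qfun (qid (Qs @ Ps)) a b (ptens R S (qdom (qtensor R S (qid Qs) (qid Ps))) a b xs)"
    using qtensor_ptens[OF linear_arr_qid[OF assms(1)] linear_arr_qid[OF assms(2)] ab, of ys c zs]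
      qcat_ptens[OF assms *(2,3)] by simp
qed simp_all

lemma qtensor_assoc:
  assumes f: "linear_arr R S f" and g: "linear_arr R S g" and h: "linear_arr R S h"
  shows "qarr_eq R S (qtensor R S (qtensor R S f g) h) (qtensor R S f (qtensor R S g h))"
proof (rule qarr_eqI)
  note fg = linear_arr_qtensor[OF f g] and gh = linear_arr_qtensor[OF g h]
  show "linear_arr R S (qtensor R S (qtensor R S f g) h)" by (rule linear_arr_qtensor[OF fg h])
  show "linear_arr R S (qtensor R S f (qtensor R S g h))" by (rule linear_arr_qtensor[OF f gh])
  fix a b xs assume ab: "a \<in> S" "b \<in> S" and "xs \<in> qpaths S (qdom (qtensor R S (qtensor R S f g) h)) a b"
  then obtain us vs ws c d where *: "xs = us @ vs @ ws" "us \<in> qpaths S (qdom f) a c"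
    "vs \<in> qpaths S (qdom g) c d" "ws \<in> qpaths S (qdom h) d b"
    by (auto simp: qpaths_append_iff)
  have c: "c \<in> S" by (rule qpaths_end_mem[OF *(2) ab(1)])
  have d: "d \<in> S" by (rule qpaths_end_mem[OF *(3) c])
  have U: "qfun f a c (ptens R S (qdom f) a c us) \<in> carrier (qtens R S (qcod f) a c)"
    by (rule linear_maps_closed[OF linear_arr_fun[OF f ab(1) c] ptens_closed[OF linear_arr_dom[OF f] *(2)]])
  have V: "qfun g c d (ptens R S (qdom g) c d vs) \<in> carrier (qtens R S (qcod g) c d)"
    by (rule linear_maps_closed[OF linear_arr_fun[OF g c d] ptens_closed[OF linear_arr_dom[OF g] *(3)]])
  have W: "qfun h d b (ptens R S (qdom h) d b ws) \<in> carrier (qtens R S (qcod h) d b)"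
    by (rule linear_maps_closed[OF linear_arr_fun[OF h d ab(2)] ptens_closed[OF linear_arr_dom[OF h] *(4)]])
  have 1: "us @ vs \<in> qpaths S (qdom f @ qdom g) a d" "vs @ ws \<in> qpaths S (qdom g @ qdom h) c b"
    using qpaths_append[OF *(2,3)] qpaths_append[OF *(3,4)] by simp_all
  show "qfun (qtensor R S (qtensor R S f g) h) a b (ptens R S (qdom (qtensor R S (qtensor R S f g) h)) a b xs)
    = qfun (qtensor R S f (qtensor R S g h)) a b (ptens R S (qdom (qtensor R S (qtensor R S f g) h)) a b xs)"
    using qtensor_ptens[OF fg h ab, of "us @ vs" d ws] qtensor_ptens[OF f gh ab, of us c "vs @ ws"] * 1
      qtensor_ptens[OF f g ab(1) d *(2,3)] qtensor_ptens[OF g h c ab(2) *(3,4)]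
      qcat_assoc[OF f[THEN linear_arr_cod] g[THEN linear_arr_cod] h[THEN linear_arr_cod] U V W]
    by simp
qed simp_all

lemma qtensor_unit_right:
  assumes f: "linear_arr R S f"
  shows "qarr_eq R S (qtensor R S f (qid [])) f"
proof (rule qarr_eqI)
  note e = linear_arr_qid[OF module_quivers_Nil]
  show "linear_arr R S (qtensor R S f (qid []))" by (rule linear_arr_qtensor[OF f e])
  show "linear_arr R S f" by fact
  fix a b xs assume ab: "a \<in> S" "b \<in> S" and "xs \<in> qpaths S (qdom (qtensor R S f (qid []))) a b"
  then have xs: "xs \<in> qpaths S (qdom f) a b" by simp
  have U: "qfun f a b (ptens R S (qdom f) a b xs) \<in> carrier (qtens R S (qcod f) a b)"
    by (rule linear_maps_closed[OF linear_arr_fun[OF f ab] ptens_closed[OF linear_arr_dom[OF f] xs]])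
  show "qfun (qtensor R S f (qid [])) a b (ptens R S (qdom (qtensor R S f (qid []))) a b xs)
    = qfun f a b (ptens R S (qdom (qtensor R S f (qid []))) a b xs)"
    using qtensor_ptens[OF f e ab xs, of "[]"] qcat_unit_right[OF linear_arr_cod[OF f] U] by simp
qed simp_all

lemma qtensor_unit_left:
  assumes f: "linear_arr R S f"
  shows "qarr_eq R S (qtensor R S (qid []) f) f"
proof (rule qarr_eqI)
  note e = linear_arr_qid[OF module_quivers_Nil]
  show "linear_arr R S (qtensor R S (qid []) f)" by (rule linear_arr_qtensor[OF e f])
  show "linear_arr R S f" by fact
  fix a b xs assume ab: "a \<in> S" "b \<in> S" and "xs \<in> qpaths S (qdom (qtensor R S (qid []) f)) a b"
  then have xs: "xs \<in> qpaths S (qdom f) a b" by simp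
  have U: "qfun f a b (ptens R S (qdom f) a b xs) \<in> carrier (qtens R S (qcod f) a b)"
    by (rule linear_maps_closed[OF linear_arr_fun[OF f ab] ptens_closed[OF linear_arr_dom[OF f] xs]])
  show "qfun (qtensor R S (qid []) f) a b (ptens R S (qdom (qtensor R S (qid []) f)) a b xs)
    = qfun f a b (ptens R S (qdom (qtensor R S (qid []) f)) a b xs)"
    using qtensor_ptens[OF e f ab _ xs, of "[]"] qcat_unit_left[OF linear_arr_cod[OF f] U] by simp
qed simp_all

lemma qtensor_list_simps [simp]:
  "qtensor_list R S [] = qid []" "qtensor_list R S (f # fs) = qtensor R S f (qtensor_list R S fs)"
  by (simp_all add: qtensor_list_def)

context
  fixes Q :: "('k, 's, 'm) quiver"
  assumes Q: "\<And>c d. \<lbrakk>c \<in> S; d \<in> S\<rbrakk> \<Longrightarrow> module R (Q c d)"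
begin

private lemma mQ: "module_quivers R S [Q]"
  using Q by (simp add: module_quivers_Cons)

lemma qwrap_linear:
  assumes "a \<in> S" "b \<in> S"
  shows "qwrap R S Q a b \<in> linear_maps R (Q a b) (qtens R S [Q] a b)"
  using multilinear_head[OF ptens_multilinear[OF mQ], where c = b and xs = "[]"] assms by (simp add: qwrap_def[abs_def])

private lemma proj_multilinear:
  assumes "a \<in> S" "b \<in> S"
  shows "multilinear R S [Q] a b (Q a b) (\<lambda>xs. fst (snd (hd xs)))"
  using assms by (intro multilinear_ConsI) (auto simp: multilinear_Nil linear_maps_id)

text \<open>The inverse is the lift of the map that reads off the module element from the only entry
  of a path.\<close>

lemma qwrap_bij:
  assumes ab: "a \<in> S" "b \<in> S"
  shows "bij_betw (qwrap R S Q a b) (carrier (Q a b)) (carrier (qtens R S [Q] a b))"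
proof -
  let ?p = "qtens_lift R (Q a b) (\<lambda>xs. fst (snd (hd xs)))"
  note p = qtens_lift_linear[OF mQ Q[OF ab] proj_multilinear[OF ab]]
  have 1: "?p (qwrap R S Q a b x) = x" if "x \<in> carrier (Q a b)" for x
    unfolding qwrap_def using that ab
    by (subst qtens_lift_ptens[OF mQ Q[OF ab] proj_multilinear[OF ab]]) auto
  have 2: "qwrap R S Q a b (?p U) = U" if "U \<in> carrier (qtens R S [Q] a b)" for U
  proof (rule qtens_ext[OF mQ qtens_module[OF mQ] linear_maps_comp[OF p qwrap_linear[OF ab]] linear_maps_id _ that])
    fix xs assume "xs \<in> qpaths S [Q] a b"
    then obtain x where "x \<in> carrier (Q a b)" "xs = [(a, x, b)]" by auto
    then show "qwrap R S Q a b (?p (ptens R S [Q] a b xs)) = ptens R S [Q] a b xs"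
      using 1[of x] by (simp add: qwrap_def)
  qed
  show ?thesis
    using 1 2 linear_maps_closed[OF p] linear_maps_closed[OF qwrap_linear[OF ab]]
    by (intro bij_betw_byWitness[where f' = ?p]) auto
qed

lemma qunwrap_linear:
  assumes "a \<in> S" "b \<in> S"
  shows "qunwrap R S Q a b \<in> linear_maps R (qtens R S [Q] a b) (Q a b)"
  unfolding qunwrap_def using assms by (intro linear_maps_inv_into[OF Q qwrap_linear qwrap_bij])

lemma qunwrap_qwrap: "\<lbrakk>a \<in> S; b \<in> S; x \<in> carrier (Q a b)\<rbrakk> \<Longrightarrow> qunwrap R S Q a b (qwrap R S Q a b x) = x"
  unfolding qunwrap_def by (rule bij_betw_inv_into_left[OF qwrap_bij])

lemma qwrap_qunwrap: "\<lbrakk>a \<in> S; b \<in> S; U \<in> carrier (qtens R S [Q] a b)\<rbrakk> \<Longrightarrow> qwrap R S Q a b (qunwrap R S Q a b U) = U"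
  unfolding qunwrap_def by (rule bij_betw_inv_into_right[OF qwrap_bij])

end

end

section \<open>Necklaces\<close>

lemma necklaces_iff: "(T, p) \<in> necklaces \<longleftrightarrow> T \<subseteq> {0..p} \<and> 0 \<in> T \<and> p \<in> T"
  by (simp add: necklaces_def)

lemma necklace_finite: "(T, p) \<in> necklaces \<Longrightarrow> finite T"
  by (auto simp: necklaces_iff intro: finite_subset)

lemma necklace_join:
  "\<lbrakk>(T, p) \<in> necklaces; (U, q) \<in> necklaces\<rbrakk> \<Longrightarrow> (T \<union> (+) p ` U, p + q) \<in> necklaces"
  by (force simp: necklaces_iff)

lemma necklace_insert: "(T, p) \<in> necklaces \<Longrightarrow> (insert 0 ((+) n ` T), n + p) \<in> necklaces"
  by (force simp: necklaces_iff)

text \<open>Strips off the first bead, of length \<open>n\<close>, and moves the rest back to start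
  at 0. Along this decomposition \<open>steps\<close>, \<open>gaps\<close> and the inert and active
  arrows all satisfy simple recursions.\<close>

lemma necklace_induct [consumes 1, case_names zero join]:
  assumes "(T, p) \<in> necklaces"
    and "P {0} 0"
    and step: "\<And>n T p. \<lbrakk>0 < n; (T, p) \<in> necklaces; P T p\<rbrakk> \<Longrightarrow> P (insert 0 ((+) n ` T)) (n + p)"
  shows "P T p"
  using assms(1)
proof (induction p arbitrary: T rule: less_induct)
  case (less p)
  show ?case
  proof (cases "p = 0")
    case True
    with less.prems have "T = {0}" by (auto simp: necklaces_iff)
    with True show ?thesis using assms(2) by simp
  next
    case False
    \<comment> \<open>The length of the first bead is the least positive joint; one exists since
      \<open>p\<close> is a positive joint.\<close>
    define n where "n = Min (T - {0})"
    have fin: "finite (T - {0})" using necklace_finite[OF less.prems] by simp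
    have ne: "T - {0} \<noteq> {}" using False less.prems by (auto simp: necklaces_iff)
    have n: "n \<in> T" "n > 0" using Min_in[OF fin ne] by (auto simp: n_def)
    have le: "n \<le> i" if "i \<in> T" "i \<noteq> 0" for i using fin that by (simp add: n_def)
    define T' where "T' = (\<lambda>i. i - n) ` (T - {0})"
    have T: "T = insert 0 ((+) n ` T')"
      using less.prems le by (force simp: T'_def necklaces_iff image_iff)
    have np: "n \<le> p" using n less.prems by (auto simp: necklaces_iff)
    have "(T', p - n) \<in> necklaces"
      unfolding necklaces_iff
    proof (intro conjI)
      show "T' \<subseteq> {0..p - n}" using less.prems by (auto simp: T'_def necklaces_iff)
      show "0 \<in> T'" using n by (force simp: T'_def)
      show "p - n \<in> T'" using less.prems False by (auto simp: T'_def necklaces_iff)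
    qed
    then have "P (insert 0 ((+) n ` T')) (n + (p - n))"
      using less.IH[of "p - n" T'] n False by (intro step) auto
    then show ?thesis using T np by simp
  qed
qed

lemma steps_zero [simp]: "steps {0} = []"
  by (simp add: steps_def)

lemma sorted_list_of_set_insert_shift:
  assumes "finite T" "0 < n"
  shows "sorted_list_of_set (insert (0::nat) ((+) n ` T)) = 0 # map ((+) n) (sorted_list_of_set T)"
proof -
  have "sorted_wrt (<) (0 # map ((+) n) (sorted_list_of_set T))"
    using assms by (auto simp: sorted_wrt_map strict_sorted_iff)
  moreover have "set (0 # map ((+) n) (sorted_list_of_set T)) = insert 0 ((+) n ` T)"
    using assms by simp
  ultimately show ?thesis
    using sorted_list_of_set.idem_if_sorted_distinct[of "0 # map ((+) n) (sorted_list_of_set T)"]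
    by (simp only: strict_sorted_iff)
qed

lemma steps_insert:
  assumes "(T, p) \<in> necklaces" "0 < n"
  shows "steps (insert 0 ((+) n ` T)) = (0, n) # map (\<lambda>(s, t). (n + s, n + t)) (steps T)"
proof -
  have fin: "finite T" by (rule necklace_finite[OF assms(1)])
  have "0 \<in> T" using assms by (simp add: necklaces_iff)
  \<comment> \<open>\<open>steps\<close> pairs the sorted list with its own tail, so its first pair
    is known only once the list is seen to begin with 0.\<close>
  obtain ts where ts: "sorted_list_of_set T = 0 # ts"
  proof (cases "sorted_list_of_set T")
    case Nil
    then show ?thesis using fin \<open>0 \<in> T\<close> by (metis empty_iff empty_set set_sorted_list_of_set)
  next
    case (Cons t ts)
    then have "sorted (t # ts)" "0 \<in> set (t # ts)"
      using fin \<open>0 \<in> T\<close> by (metis sorted_sorted_list_of_set, metis set_sorted_list_of_set)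
    then show ?thesis using that Cons by auto
  qed
  have "zip (butlast (map ((+) n) xs)) (tl (map ((+) n) xs)) = map (\<lambda>(s, t). (n + s, n + t)) (zip (butlast xs) (tl xs))"
    for xs by (simp add: map_butlast[symmetric] map_tl[symmetric] zip_map_map)
  from this[of "0 # ts"] show ?thesis
    unfolding steps_def Let_def sorted_list_of_set_insert_shift[OF fin assms(2)] ts by simp
qed

lemma steps_range:
  "\<lbrakk>(T, p) \<in> necklaces; (s, t) \<in> set (steps T)\<rbrakk> \<Longrightarrow> s < t \<and> t \<le> p \<and> s \<in> T \<and> t \<in> T"
  by (induction T p arbitrary: s t rule: necklace_induct) (auto simp: steps_insert necklaces_iff)

lemma gaps_zero [simp]: "gaps {0} = []"
  by (simp add: gaps_def)

lemma gaps_insert: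
  "\<lbrakk>(T, p) \<in> necklaces; 0 < n\<rbrakk> \<Longrightarrow> gaps (insert 0 ((+) n ` T)) = n # gaps T"
  by (simp add: gaps_def steps_insert case_prod_unfold)

lemma sum_list_gaps: "(T, p) \<in> necklaces \<Longrightarrow> sum_list (gaps T) = p"
  by (induction T p rule: necklace_induct) (auto simp: gaps_insert)

lemma gaps_join:
  assumes "(T, p) \<in> necklaces" "(U, q) \<in> necklaces"
  shows "gaps (T \<union> (+) p ` U) = gaps T @ gaps U"
  using assms
proof (induction T p rule: necklace_induct)
  case zero
  then have "insert 0 U = U" by (auto simp: necklaces_iff)
  with zero show ?case by simp
next
  case (join n T p)
  have "insert 0 ((+) n ` T) \<union> (+) (n + p) ` U = insert 0 ((+) n ` (T \<union> (+) p ` U))"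
    by (auto simp: image_Un image_image add.assoc)
  then show ?case using join gaps_insert[OF necklace_join[OF join(2) join.prems] join(1)] by (simp add: gaps_insert)
qed

lemma necklace_split:
  assumes "(T, n + p) \<in> necklaces" "n \<in> T"
  shows "({i \<in> T. i \<le> n}, n) \<in> necklaces" "({i. n + i \<in> T}, p) \<in> necklaces"
    "T = {i \<in> T. i \<le> n} \<union> (+) n ` {i. n + i \<in> T}"
proof -
  show "({i \<in> T. i \<le> n}, n) \<in> necklaces" "({i. n + i \<in> T}, p) \<in> necklaces"
    using assms by (auto simp: necklaces_iff)
  have "i \<in> (+) n ` {i. n + i \<in> T}" if "i \<in> T" "\<not> i \<le> n" for i
    using that by (intro image_eqI[of _ _ "i - n"]) auto
  then show "T = {i \<in> T. i \<le> n} \<union> (+) n ` {i. n + i \<in> T}" by auto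
qed

lemma gaps_split:
  "\<lbrakk>(T, n + p) \<in> necklaces; n \<in> T\<rbrakk> \<Longrightarrow> gaps T = gaps {i \<in> T. i \<le> n} @ gaps {i. n + i \<in> T}"
  using arg_cong[where f = gaps, OF necklace_split(3)] gaps_join[OF necklace_split(1,2)] by (rule trans)

lemma gaps_two: "0 < p \<Longrightarrow> gaps {0, p} = [p]"
  using gaps_insert[of "{0}" 0 p] by (simp add: necklaces_iff)

lemma gaps_three:
  assumes "0 < p" "p < q"
  shows "gaps {0, p, q} = [p, q - p]"
proof -
  have "insert 0 ((+) p ` {0, q - p}) = {0, p, q}" using assms by auto
  moreover have "({0, q - p}, q - p) \<in> necklaces" by (simp add: necklaces_iff)
  ultimately show ?thesis using gaps_insert[of "{0, q - p}" "q - p" p] gaps_two[of "q - p"] assms by simp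
qed


section \<open>Maps of finite intervals\<close>

text \<open>The second summand of \<open>f\<close> when \<open>f\<close> is cut at \<open>n\<close>,
  the first being \<open>restrict f {0..n}\<close>; the values are lowered so that it starts at 0
  again.\<close>

definition tail_map :: "nat \<Rightarrow> nat \<Rightarrow> (nat \<Rightarrow> nat) \<Rightarrow> nat \<Rightarrow> nat" where
  "tail_map n p f = (\<lambda>i\<in>{0..p}. f (n + i) - f n)"

lemma fint_mapsD:
  assumes "f \<in> fint_maps p q"
  shows "f 0 = 0" "f p = q" "\<And>i j. \<lbrakk>i \<le> j; j \<le> p\<rbrakk> \<Longrightarrow> f i \<le> f j" "\<And>i. i \<le> p \<Longrightarrow> f i \<le> q"
    "\<And>i. p < i \<Longrightarrow> f i = undefined"
proof -
  show "f 0 = 0" "f p = q" using assms by (auto simp: fint_maps_def)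
  show m: "\<And>i j. \<lbrakk>i \<le> j; j \<le> p\<rbrakk> \<Longrightarrow> f i \<le> f j"
    using assms by (auto simp: fint_maps_def mono_maps_def mono_on_def)
  show "\<And>i. i \<le> p \<Longrightarrow> f i \<le> q" using m[of _ p] \<open>f p = q\<close> by auto
  show "\<And>i. p < i \<Longrightarrow> f i = undefined"
    using assms by (auto simp: fint_maps_def mono_maps_def PiE_def extensional_def)
qed

lemma fint_mapsI:
  assumes "f 0 = 0" "f p = q" "\<And>i j. \<lbrakk>i \<le> j; j \<le> p\<rbrakk> \<Longrightarrow> f i \<le> f j" "\<And>i. p < i \<Longrightarrow> f i = undefined"
  shows "f \<in> fint_maps p q"
  using assms(1,2,4) assms(3) assms(3)[of _ p]
  by (auto simp: fint_maps_def mono_maps_def mono_on_def PiE_def extensional_def)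

lemma fint_maps_id: "(\<lambda>i\<in>{0..p}. i) \<in> fint_maps p p"
  by (rule fint_mapsI) auto

lemma fint_maps_compose:
  assumes f: "f \<in> fint_maps p q" and g: "g \<in> fint_maps q r"
  shows "compose {0..p} g f \<in> fint_maps p r"
  using fint_mapsD[OF f] fint_mapsD[OF g] by (intro fint_mapsI) (auto simp: compose_def)

lemma fint_maps_split:
  assumes f: "f \<in> fint_maps (n + p) q"
  shows "restrict f {0..n} \<in> fint_maps n (f n)" "tail_map n p f \<in> fint_maps p (q - f n)" "f n \<le> q"
    "fint_sum n (f n) p (restrict f {0..n}) (tail_map n p f) = f"
proof -
  note fD = fint_mapsD[OF f]
  show "restrict f {0..n} \<in> fint_maps n (f n)" using fD by (intro fint_mapsI) auto
  show "tail_map n p f \<in> fint_maps p (q - f n)"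
    using fD by (intro fint_mapsI) (auto simp: tail_map_def diff_le_mono)
  show "f n \<le> q" using fD by simp
  show "fint_sum n (f n) p (restrict f {0..n}) (tail_map n p f) = f"
  proof
    fix i
    show "fint_sum n (f n) p (restrict f {0..n}) (tail_map n p f) i = f i"
      using fD(3)[of n i] fD(5)[of i] by (auto simp: fint_sum_def tail_map_def)
  qed
qed

text \<open>The image has the shape of \<open>necklace_induct\<close> once more, with a first bead
  of length \<open>f n\<close>. This length is 0 if \<open>f\<close> collapses the bead, a case that
  the inductions on active maps have to separate.\<close>

lemma fint_maps_image:
  assumes f: "f \<in> fint_maps (n + p) q" and T: "(T, p) \<in> necklaces"
  shows "f ` insert 0 ((+) n ` T) = insert 0 ((+) (f n) ` tail_map n p f ` T)"
proof -
  have "f (n + i) = f n + tail_map n p f i" if "i \<in> T" for i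
    using fint_mapsD(3)[OF f, of n "n + i"] that T by (auto simp: tail_map_def necklaces_iff)
  then show ?thesis using fint_mapsD(1)[OF f] by (auto simp: image_image)
qed

lemma necklace_image:
  assumes T: "(T, p) \<in> necklaces" and f: "f \<in> fint_maps p q"
  shows "(f ` T, q) \<in> necklaces"
  unfolding necklaces_iff
proof (intro conjI)
  note fD = fint_mapsD[OF f]
  show "f ` T \<subseteq> {0..q}" using T fD(4) by (auto simp: necklaces_iff)
  show "0 \<in> f ` T" using T fD(1) by (force simp: necklaces_iff)
  show "q \<in> f ` T" using T fD(2) by (force simp: necklaces_iff)
qed

section \<open>The necklace functor\<close>

text \<open>The typing part of the axioms: it makes all structure arrows linear and the counit
  invertible. Both \<open>X\<close> and the free templicial modules of horns and simplices are
  instances.\<close>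

locale linear_templicial = quiver_tensors R "tverts X"
  for R :: "('k, 'z) ring_scheme" (structure) and X :: "('k, 's, 'm) templicial" +
  assumes tsimp_module: "\<lbrakk>a \<in> tverts X; b \<in> tverts X\<rbrakk> \<Longrightarrow> module R (tsimp X n a b)"
    and tact_linear: "\<lbrakk>f \<in> fint_maps m n; a \<in> tverts X; b \<in> tverts X\<rbrakk>
      \<Longrightarrow> tact X m n f a b \<in> linear_maps R (tsimp X n a b) (tsimp X m a b)"
    and tcomult_linear: "\<lbrakk>a \<in> tverts X; b \<in> tverts X\<rbrakk> \<Longrightarrow> tcomult X p q a b \<in>
      linear_maps R (tsimp X (p + q) a b) (qtens R (tverts X) [tsimp X p, tsimp X q] a b)"
    and tcounit_linear: "\<lbrakk>a \<in> tverts X; b \<in> tverts X\<rbrakk>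
      \<Longrightarrow> tcounit X a b \<in> linear_maps R (tsimp X 0 a b) (qtens R (tverts X) [] a b)"
    and tcounit_bij: "\<lbrakk>a \<in> tverts X; b \<in> tverts X\<rbrakk>
      \<Longrightarrow> bij_betw (tcounit X a b) (carrier (tsimp X 0 a b)) (carrier (qtens R (tverts X) [] a b))"
begin

abbreviation arr_eq (infix \<open>\<approx>\<close> 50) where "f \<approx> g \<equiv> qarr_eq R (tverts X) f g"
abbreviation arr_tensor (infixr \<open>\<star>\<close> 60) where "f \<star> g \<equiv> qtensor R (tverts X) f g"
abbreviation arr_comp (infixr \<open>\<bullet>\<close> 55) where "g \<bullet> f \<equiv> qcomp g f"
abbreviation lin where "lin f \<equiv> linear_arr R (tverts X) f"
abbreviation objs where "objs ns \<equiv> map (tsimp X) ns"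

lemma module_quivers_objs [simp]: "module_quivers R (tverts X) (objs ns)"
  using tsimp_module by (auto simp: module_quivers_def)

lemma qwrap_tsimp: "\<lbrakk>a \<in> tverts X; b \<in> tverts X\<rbrakk> \<Longrightarrow> qwrap R (tverts X) (tsimp X n) a b
    \<in> linear_maps R (tsimp X n a b) (qtens R (tverts X) [tsimp X n] a b)"
  by (rule qwrap_linear[OF tsimp_module])

lemma qunwrap_tsimp: "\<lbrakk>a \<in> tverts X; b \<in> tverts X\<rbrakk> \<Longrightarrow> qunwrap R (tverts X) (tsimp X n) a b
    \<in> linear_maps R (qtens R (tverts X) [tsimp X n] a b) (tsimp X n a b)"
  by (rule qunwrap_linear[OF tsimp_module])

lemma arr_simps [simp]:
  "qdom (id_arr X n) = [tsimp X n]" "qcod (id_arr X n) = [tsimp X n]" "qfun (id_arr X n) a b u = u"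
  "qdom (act_arr R X m n f) = [tsimp X n]" "qcod (act_arr R X m n f) = [tsimp X m]"
  "qdom (comult_arr R X p q) = [tsimp X (p + q)]" "qcod (comult_arr R X p q) = [tsimp X p, tsimp X q]"
  "qdom (counit_arr R X) = [tsimp X 0]" "qcod (counit_arr R X) = []"
  "qdom (counit_inv_arr R X) = []" "qcod (counit_inv_arr R X) = [tsimp X 0]"
  by (simp_all add: id_arr_def act_arr_def comult_arr_def counit_arr_def counit_inv_arr_def)

lemma mq_objs [simp]:
  "module_quivers R (tverts X) [tsimp X n]" "module_quivers R (tverts X) [tsimp X n, tsimp X m]"
  using module_quivers_objs[of "[n]"] module_quivers_objs[of "[n, m]"] by simp_all

lemma lin_id [simp]: "lin (id_arr X n)"
  unfolding id_arr_def by (rule linear_arr_qid) simp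

lemma lin_qid_single [simp]: "lin (qid [tsimp X n])"
  using lin_id[of n] by (simp add: id_arr_def)

lemma lin_qid_Nil [simp]: "lin (qid [])"
  by (rule linear_arr_qid) simp

lemma lin_act [simp]:
  assumes "f \<in> fint_maps m n"
  shows "lin (act_arr R X m n f)"
proof -
  have "qfun (act_arr R X m n f) a b
      \<in> linear_maps R (qtens R (tverts X) [tsimp X n] a b) (qtens R (tverts X) [tsimp X m] a b)"
    if "a \<in> tverts X" "b \<in> tverts X" for a b
    using linear_maps_comp[OF linear_maps_comp[OF qunwrap_tsimp[OF that] tact_linear[OF assms that]] qwrap_tsimp[OF that]]
    by (simp add: act_arr_def)
  then show ?thesis by (simp add: linear_arr_def)
qed

lemma lin_comult [simp]: "lin (comult_arr R X p q)"
proof -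
  have "qfun (comult_arr R X p q) a b \<in> linear_maps R (qtens R (tverts X) (qdom (comult_arr R X p q)) a b)
      (qtens R (tverts X) (qcod (comult_arr R X p q)) a b)"
    if "a \<in> tverts X" "b \<in> tverts X" for a b
    using linear_maps_comp[OF qunwrap_tsimp[OF that] tcomult_linear[OF that]]
    by (simp add: comult_arr_def)
  then show ?thesis by (simp add: linear_arr_def)
qed

lemma lin_counit [simp]: "lin (counit_arr R X)"
proof -
  have "qfun (counit_arr R X) a b \<in> linear_maps R (qtens R (tverts X) (qdom (counit_arr R X)) a b)
      (qtens R (tverts X) (qcod (counit_arr R X)) a b)"
    if "a \<in> tverts X" "b \<in> tverts X" for a b
    using linear_maps_comp[OF qunwrap_tsimp[OF that] tcounit_linear[OF that]]
    by (simp add: counit_arr_def)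
  then show ?thesis by (simp add: linear_arr_def)
qed

lemma lin_counit_inv [simp]: "lin (counit_inv_arr R X)"
proof -
  have "qfun (counit_inv_arr R X) a b \<in> linear_maps R (qtens R (tverts X) (qdom (counit_inv_arr R X)) a b)
      (qtens R (tverts X) (qcod (counit_inv_arr R X)) a b)"
    if "a \<in> tverts X" "b \<in> tverts X" for a b
    using linear_maps_comp[OF linear_maps_inv_into[OF tsimp_module[OF that] tcounit_linear[OF that] tcounit_bij[OF that]] qwrap_tsimp[OF that]]
    by (simp add: counit_inv_arr_def)
  then show ?thesis by (simp add: linear_arr_def)
qed

lemma lin_tensor [simp]: "\<lbrakk>lin f; lin g\<rbrakk> \<Longrightarrow> lin (f \<star> g)"
  by (rule linear_arr_qtensor)

lemma lin_comp [simp]: "\<lbrakk>lin f; lin g; qdom g = qcod f\<rbrakk> \<Longrightarrow> lin (g \<bullet> f)"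
  by (rule linear_arr_qcomp)

lemma counit_inv_counit: "counit_inv_arr R X \<bullet> counit_arr R X \<approx> id_arr X 0"
  unfolding qarr_eq_def
proof (simp, intro ballI)
  fix a b u assume ab: "a \<in> tverts X" "b \<in> tverts X" and u: "u \<in> carrier (qtens R (tverts X) [tsimp X 0] a b)"
  have "qunwrap R (tverts X) (tsimp X 0) a b u \<in> carrier (tsimp X 0 a b)"
    by (rule linear_maps_closed[OF qunwrap_tsimp[OF ab] u])
  then show "qfun (counit_inv_arr R X) a b (qfun (counit_arr R X) a b u) = u"
    using u ab by (simp add: counit_arr_def counit_inv_arr_def qwrap_qunwrap[OF tsimp_module]
      bij_betw_inv_into_left[OF tcounit_bij])
qed

lemma iterated_comult_dom [simp]: "qdom (iterated_comult R X ns) = [tsimp X (sum_list ns)]"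
  by (cases "(R, X, ns)" rule: iterated_comult.cases) simp_all

lemma iterated_comult_cod [simp]: "qcod (iterated_comult R X ns) = objs ns"
  by (induction ns rule: induct_list012) simp_all

lemma lin_iterated_comult [simp]: "lin (iterated_comult R X ns)"
proof (induction ns rule: induct_list012)
  case (3 n m ns)
  then show ?case by simp
qed simp_all

lemma inert_arr_zero [simp]: "inert_arr R X T {0} = qid []"
  by (simp add: inert_arr_def)

text \<open>The first bead of the joined necklace is cut at the points of \<open>T\<close> up to
  \<open>n\<close>; the remaining beads see \<open>T\<close> moved back by \<open>n\<close>.\<close>

lemma inert_arr_insert:
  assumes U: "(U, q) \<in> necklaces" and n: "0 < n"
  shows "inert_arr R X T (insert 0 ((+) n ` U))
    = iterated_comult R X (gaps {i \<in> T. i \<le> n}) \<star> inert_arr R X {i. n + i \<in> T} U"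
proof -
  have "(\<lambda>i. i - (n + s)) ` {i \<in> T. n + s \<le> i \<and> i \<le> n + t} = (\<lambda>i. i - s) ` {i \<in> {i. n + i \<in> T}. s \<le> i \<and> i \<le> t}"
    for s t
  proof -
    have "{i \<in> T. n + s \<le> i \<and> i \<le> n + t} = (+) n ` {i \<in> {i. n + i \<in> T}. s \<le> i \<and> i \<le> t}"
    proof (intro equalityI subsetI)
      fix i assume "i \<in> {i \<in> T. n + s \<le> i \<and> i \<le> n + t}"
      then show "i \<in> (+) n ` {i \<in> {i. n + i \<in> T}. s \<le> i \<and> i \<le> t}"
        by (intro image_eqI[of _ _ "i - n"]) auto
    qed auto
    then show ?thesis by (simp add: image_image)
  qed
  then show ?thesis unfolding inert_arr_def steps_insert[OF U n] by (simp add: case_prod_unfold comp_def)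
qed

lemma inert_arr_lin:
  assumes "(U, q) \<in> necklaces" "(T, q) \<in> necklaces" "U \<subseteq> T"
  shows "lin (inert_arr R X T U) \<and> qdom (inert_arr R X T U) = objs (gaps U) \<and> qcod (inert_arr R X T U) = objs (gaps T)"
  using assms
proof (induction U q arbitrary: T rule: necklace_induct)
  case zero
  then have "T = {0}" by (auto simp: necklaces_iff)
  then show ?case by simp
next
  case (join n U q)
  have nT: "n \<in> T" using join.prems join.hyps by (auto simp: necklaces_iff)
  note split = necklace_split(1,2)[OF join.prems(1) nT]
  have "U \<subseteq> {i. n + i \<in> T}" using join.prems(2) by auto
  with join.IH[OF split(2)] show ?case
    using sum_list_gaps[OF split(1)]
    by (simp add: inert_arr_insert[OF join.hyps(2,1)] gaps_insert[OF join.hyps(2,1)] gaps_split[OF join.prems(1) nT])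
qed

lemma active_arr_zero [simp]: "active_arr R X {0} f = qid [] \<bullet> qid []"
  by (simp add: active_arr_def)

text \<open>The factor of \<open>active_arr\<close> that belongs to the first bead. If
  \<open>f\<close> collapses this bead, its module in degree 0 is created from the unit, so the
  domain is empty.\<close>

definition active_head :: "nat \<Rightarrow> (nat \<Rightarrow> nat) \<Rightarrow> ('k, 's, 'm) qarr" where
  "active_head n f = act_arr R X n (f n) (restrict f {0..n}) \<bullet>
     (if f n = 0 then counit_inv_arr R X else id_arr X (f n))"

lemma active_head_lin:
  assumes "f \<in> fint_maps (n + p) q"
  shows "lin (active_head n f)" "qdom (active_head n f) = (if f n = 0 then [] else [tsimp X (f n)])"
    "qcod (active_head n f) = [tsimp X n]"
  using fint_maps_split(1)[OF assms] by (auto simp: active_head_def)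

text \<open>\<open>active_arr\<close> composes two tensor lists. Naming them allows each to be
  unfolded separately, before the interchange law pairs them up bead by bead in
  \<open>active_arr_insert\<close>.\<close>

definition active_acts :: "nat set \<Rightarrow> (nat \<Rightarrow> nat) \<Rightarrow> ('k, 's, 'm) qarr" where
  "active_acts T f = qtensor_list R (tverts X)
    (map (\<lambda>(s, t). act_arr R X (t - s) (f t - f s) (\<lambda>i\<in>{0..t - s}. f (s + i) - f s)) (steps T))"

definition active_units :: "nat set \<Rightarrow> (nat \<Rightarrow> nat) \<Rightarrow> ('k, 's, 'm) qarr" where
  "active_units T f = qtensor_list R (tverts X)
    (map (\<lambda>(s, t). if f t = f s then counit_inv_arr R X else id_arr X (f t - f s)) (steps T))"

lemma active_arr_eq: "active_arr R X T f = active_acts T f \<bullet> active_units T f"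
  by (simp add: active_arr_def active_acts_def active_units_def)

lemma active_acts_zero: "active_acts {0} f = qid []"
  and active_units_zero: "active_units {0} f = qid []"
  by (simp_all add: active_acts_def active_units_def)

lemma active_factors_insert:
  assumes T: "(T, p) \<in> necklaces" and n: "0 < n" and f: "f \<in> fint_maps (n + p) q"
  shows "active_acts (insert 0 ((+) n ` T)) f
      = act_arr R X n (f n) (restrict f {0..n}) \<star> active_acts T (tail_map n p f)"
    and "active_units (insert 0 ((+) n ` T)) f
      = (if f n = 0 then counit_inv_arr R X else id_arr X (f n)) \<star> active_units T (tail_map n p f)"
proof -
  note fD = fint_mapsD[OF f]
  have r: "s < t \<and> t \<le> p" if "(s, t) \<in> set (steps T)" for s t
    using steps_range[OF T that] by simp
  have ge: "f n \<le> f (n + i)" if "i \<le> p" for i using fD(3)[of n "n + i"] that by simp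
  have 1: "(\<lambda>i\<in>{0..t - s}. f (n + s + i) - f (n + s)) = (\<lambda>i\<in>{0..t - s}. tail_map n p f (s + i) - tail_map n p f s)"
    if "s < t" "t \<le> p" for s t
    using that ge by (intro restrict_ext) (auto simp: tail_map_def add.assoc)
  have 2: "f (n + t) - f (n + s) = tail_map n p f t - tail_map n p f s" if "s < t" "t \<le> p" for s t
    using that ge[of t] ge[of s] by (auto simp: tail_map_def)
  have 3: "f (n + t) = f (n + s) \<longleftrightarrow> tail_map n p f t = tail_map n p f s" if "s < t" "t \<le> p" for s t
    using that ge[of t] ge[of s] by (auto simp: tail_map_def)
  have "map (\<lambda>(s, t). act_arr R X (t - s) (f t - f s) (\<lambda>i\<in>{0..t - s}. f (s + i) - f s)) (steps (insert 0 ((+) n ` T)))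
    = act_arr R X n (f n) (restrict f {0..n}) #
      map (\<lambda>(s, t). act_arr R X (t - s) (tail_map n p f t - tail_map n p f s) (\<lambda>i\<in>{0..t - s}. tail_map n p f (s + i) - tail_map n p f s)) (steps T)"
    unfolding steps_insert[OF T n]
    using r 1 2 fD(1) by auto
  then show "active_acts (insert 0 ((+) n ` T)) f
      = act_arr R X n (f n) (restrict f {0..n}) \<star> active_acts T (tail_map n p f)"
    by (simp add: active_acts_def)
  have "map (\<lambda>(s, t). if f t = f s then counit_inv_arr R X else id_arr X (f t - f s)) (steps (insert 0 ((+) n ` T)))
    = (if f n = 0 then counit_inv_arr R X else id_arr X (f n)) #
      map (\<lambda>(s, t). if tail_map n p f t = tail_map n p f s then counit_inv_arr R X
        else id_arr X (tail_map n p f t - tail_map n p f s)) (steps T)"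
    unfolding steps_insert[OF T n]
    using r 2 3 fD(1) by auto
  then show "active_units (insert 0 ((+) n ` T)) f
      = (if f n = 0 then counit_inv_arr R X else id_arr X (f n)) \<star> active_units T (tail_map n p f)"
    by (simp add: active_units_def)
qed

lemma active_factors_lin:
  assumes "(T, p) \<in> necklaces" "f \<in> fint_maps p q"
  shows "lin (active_acts T f) \<and> lin (active_units T f) \<and> qdom (active_acts T f) = qcod (active_units T f)
    \<and> qdom (active_units T f) = objs (gaps (f ` T)) \<and> qcod (active_acts T f) = objs (gaps T)"
  using assms
proof (induction T p arbitrary: f q rule: necklace_induct)
  case zero
  then show ?case using fint_mapsD(1)[OF zero] by (simp add: active_acts_zero active_units_zero)
next
  case (join n T p)
  note s = fint_maps_split[OF join.prems]
  \<comment> \<open>A collapsed first bead leaves no gap in the image, in agreement with the empty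
    domain of \<open>counit_inv_arr\<close>.\<close>
  have im: "gaps (f ` insert 0 ((+) n ` T)) = (if f n = 0 then [] else [f n]) @ gaps (tail_map n p f ` T)"
  proof (cases "f n = 0")
    case True
    have "insert 0 (tail_map n p f ` T) = tail_map n p f ` T"
      using fint_mapsD(1)[OF s(2)] join.hyps(2) by (force simp: necklaces_iff)
    then show ?thesis using True unfolding fint_maps_image[OF join.prems join.hyps(2)] by simp
  next
    case False
    then show ?thesis
      using gaps_insert[OF necklace_image[OF join.hyps(2) s(2)], of "f n"]
      unfolding fint_maps_image[OF join.prems join.hyps(2)] by simp
  qed
  have "lin (act_arr R X n (f n) (restrict f {0..n}))" using s(1) by simp
  then show ?case
    unfolding active_factors_insert[OF join.hyps(2,1) join.prems] im gaps_insert[OF join.hyps(2,1)]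
    using join.IH[OF s(2)] by simp
qed

lemma active_arr_lin:
  assumes "(T, p) \<in> necklaces" "f \<in> fint_maps p q"
  shows "lin (active_arr R X T f)" "qdom (active_arr R X T f) = objs (gaps (f ` T))"
    "qcod (active_arr R X T f) = objs (gaps T)"
  using active_factors_lin[OF assms] by (auto simp: active_arr_eq)

lemma active_arr_insert:
  assumes T: "(T, p) \<in> necklaces" and n: "0 < n" and f: "f \<in> fint_maps (n + p) q"
  shows "active_arr R X (insert 0 ((+) n ` T)) f \<approx> active_head n f \<star> active_arr R X T (tail_map n p f)"
  unfolding active_arr_eq active_factors_insert[OF T n f] active_head_def
  by (rule qtensor_interchange)
    (use active_factors_lin[OF T fint_maps_split(2)[OF f]] fint_maps_split(1)[OF f] in auto)

end

section \<open>Naturality of the iterated comultiplication in the necklace\<close>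

locale templicial = linear_templicial R X
  for R :: "('k, 'z) ring_scheme" (structure) and X :: "('k, 's, 'm) templicial" +
  assumes tact_id: "\<lbrakk>a \<in> tverts X; b \<in> tverts X; x \<in> carrier (tsimp X n a b)\<rbrakk>
      \<Longrightarrow> tact X n n (\<lambda>i\<in>{0..n}. i) a b x = x"
    and tact_comp: "\<lbrakk>f \<in> fint_maps l m; g \<in> fint_maps m n; a \<in> tverts X; b \<in> tverts X;
        x \<in> carrier (tsimp X n a b)\<rbrakk>
      \<Longrightarrow> tact X l n (compose {0..l} g f) a b x = tact X l m f a b (tact X m n g a b x)"
    and comult_natural: "\<lbrakk>f \<in> fint_maps p p'; g \<in> fint_maps q q'\<rbrakk>
      \<Longrightarrow> qarr_eq R (tverts X)
        (qcomp (qtensor R (tverts X) (act_arr R X p p' f) (act_arr R X q q' g)) (comult_arr R X p' q'))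
        (qcomp (comult_arr R X p q) (act_arr R X (p + q) (p' + q') (fint_sum p p' q f g)))"
    and coassoc: "qarr_eq R (tverts X)
        (qcomp (qtensor R (tverts X) (comult_arr R X p q) (id_arr X r)) (comult_arr R X (p + q) r))
        (qcomp (qtensor R (tverts X) (id_arr X p) (comult_arr R X q r)) (comult_arr R X p (q + r)))"
    and counit_left: "qarr_eq R (tverts X)
        (qcomp (qtensor R (tverts X) (counit_arr R X) (id_arr X n)) (comult_arr R X 0 n)) (id_arr X n)"
    and counit_right: "qarr_eq R (tverts X)
        (qcomp (qtensor R (tverts X) (id_arr X n) (counit_arr R X)) (comult_arr R X n 0)) (id_arr X n)"
begin

lemma act_arr_id: "act_arr R X n n (\<lambda>i\<in>{0..n}. i) \<approx> id_arr X n"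
  unfolding qarr_eq_def
proof (simp, intro ballI)
  fix a b u assume ab: "a \<in> tverts X" "b \<in> tverts X" and u: "u \<in> carrier (qtens R (tverts X) [tsimp X n] a b)"
  then show "qfun (act_arr R X n n (\<lambda>i\<in>{0..n}. i)) a b u = u"
    using linear_maps_closed[OF qunwrap_tsimp[OF ab] u]
    by (simp add: act_arr_def tact_id[simplified] qwrap_qunwrap[OF tsimp_module])
qed

text \<open>Insert \<open>counit_left\<close> on the right and cancel the counit against its
  inverse. A collapsed bead can thus be treated like any other, with a comultiplication whose first
  index is 0.\<close>

lemma counit_inv_tensor: "counit_inv_arr R X \<star> id_arr X n \<approx> comult_arr R X 0 n"
proof -
  have "counit_inv_arr R X \<star> id_arr X n = (counit_inv_arr R X \<star> id_arr X n) \<bullet> id_arr X n"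
    by (simp add: id_arr_def qcomp_qid_right)
  also have "\<dots> \<approx> (counit_inv_arr R X \<star> id_arr X n) \<bullet> ((counit_arr R X \<star> id_arr X n) \<bullet> comult_arr R X 0 n)"
    by (rule qcomp_cong_right[OF qarr_eq_sym[OF counit_left]])
  also have "\<dots> = ((counit_inv_arr R X \<star> id_arr X n) \<bullet> (counit_arr R X \<star> id_arr X n)) \<bullet> comult_arr R X 0 n"
    by (rule qcomp_assoc)
  also have "\<dots> \<approx> ((counit_inv_arr R X \<bullet> counit_arr R X) \<star> (id_arr X n \<bullet> id_arr X n)) \<bullet> comult_arr R X 0 n"
    by (rule qcomp_cong_left[OF qtensor_interchange]) simp_all
  also have "\<dots> \<approx> (id_arr X 0 \<star> id_arr X n) \<bullet> comult_arr R X 0 n"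
    by (intro qcomp_cong_left qtensor_cong counit_inv_counit) (simp_all add: id_arr_def qcomp_qid_right qarr_eq_refl)
  also have "\<dots> \<approx> qid [tsimp X 0, tsimp X n] \<bullet> comult_arr R X 0 n"
    using qtensor_qid[of "[tsimp X 0]" "[tsimp X n]"] by (intro qcomp_cong_left) (simp_all add: id_arr_def)
  also have "\<dots> = comult_arr R X 0 n" by (simp add: qcomp_qid_left)
  finally show ?thesis .
qed

text \<open>The recursion of \<open>iterated_comult\<close> stops with an identity at one-element
  lists. By the right counit law the general step holds there as well, which spares later inductions
  this special case.\<close>

lemma iterated_comult_Cons:
  "iterated_comult R X (n # ns) \<approx> (id_arr X n \<star> iterated_comult R X ns) \<bullet> comult_arr R X n (sum_list ns)"
proof (cases ns)
  case Nil
  then show ?thesis using qarr_eq_sym[OF counit_right] by simp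
qed (simp add: qarr_eq_refl)

text \<open>Coassociativity for arbitrary bracketings: the left counit law starts the induction, and
  each further entry of \<open>ns\<close> is moved across by one use of
  \<open>coassoc\<close>.\<close>

lemma iterated_comult_append:
  "iterated_comult R X (ns @ ms)
    \<approx> (iterated_comult R X ns \<star> iterated_comult R X ms) \<bullet> comult_arr R X (sum_list ns) (sum_list ms)"
proof (induction ns)
  case Nil
  let ?m = "iterated_comult R X ms"
  have "?m = ?m \<bullet> id_arr X (sum_list ms)" by (simp add: id_arr_def qcomp_qid_right)
  also have "\<dots> \<approx> ?m \<bullet> ((counit_arr R X \<star> id_arr X (sum_list ms)) \<bullet> comult_arr R X 0 (sum_list ms))"
    by (rule qcomp_cong_right[OF qarr_eq_sym[OF counit_left]])
  also have "\<dots> \<approx> (qid [] \<star> ?m) \<bullet> ((counit_arr R X \<star> id_arr X (sum_list ms)) \<bullet> comult_arr R X 0 (sum_list ms))"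
    by (rule qcomp_cong_left[OF qarr_eq_sym[OF qtensor_unit_left]]) simp_all
  also have "\<dots> = ((qid [] \<star> ?m) \<bullet> (counit_arr R X \<star> id_arr X (sum_list ms))) \<bullet> comult_arr R X 0 (sum_list ms)"
    by (rule qcomp_assoc)
  also have "\<dots> \<approx> ((qid [] \<bullet> counit_arr R X) \<star> (?m \<bullet> id_arr X (sum_list ms))) \<bullet> comult_arr R X 0 (sum_list ms)"
    by (rule qcomp_cong_left[OF qtensor_interchange]) simp_all
  also have "\<dots> = (counit_arr R X \<star> ?m) \<bullet> comult_arr R X 0 (sum_list ms)"
    by (simp add: qcomp_qid_left id_arr_def qcomp_qid_right)
  finally show ?case by simp
next
  case (Cons n ns)
  let ?n = "iterated_comult R X ns" and ?m = "iterated_comult R X ms" and ?i = "id_arr X n"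
    and ?N = "sum_list ns" and ?M = "sum_list ms"
  have "iterated_comult R X ((n # ns) @ ms)
      \<approx> (?i \<star> iterated_comult R X (ns @ ms)) \<bullet> comult_arr R X n (?N + ?M)"
    using iterated_comult_Cons[of n "ns @ ms"] by simp
  also have "\<dots> \<approx> ((?i \<bullet> ?i) \<star> ((?n \<star> ?m) \<bullet> comult_arr R X ?N ?M)) \<bullet> comult_arr R X n (?N + ?M)"
    by (intro qcomp_cong_left qtensor_cong Cons.IH) (simp_all add: id_arr_def qcomp_qid_right qarr_eq_refl)
  also have "\<dots> \<approx> ((?i \<star> (?n \<star> ?m)) \<bullet> (?i \<star> comult_arr R X ?N ?M)) \<bullet> comult_arr R X n (?N + ?M)"
    by (rule qcomp_cong_left[OF qarr_eq_sym[OF qtensor_interchange]]) simp_all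
  also have "\<dots> = (?i \<star> (?n \<star> ?m)) \<bullet> ((?i \<star> comult_arr R X ?N ?M) \<bullet> comult_arr R X n (?N + ?M))"
    by (rule qcomp_assoc[symmetric])
  also have "\<dots> \<approx> (?i \<star> (?n \<star> ?m)) \<bullet> ((comult_arr R X n ?N \<star> id_arr X ?M) \<bullet> comult_arr R X (n + ?N) ?M)"
    by (rule qcomp_cong_right[OF qarr_eq_sym[OF coassoc]])
  also have "\<dots> \<approx> ((?i \<star> ?n) \<star> ?m) \<bullet> ((comult_arr R X n ?N \<star> id_arr X ?M) \<bullet> comult_arr R X (n + ?N) ?M)"
    by (rule qcomp_cong_left[OF qarr_eq_sym[OF qtensor_assoc]]) simp_all
  also have "\<dots> = (((?i \<star> ?n) \<star> ?m) \<bullet> (comult_arr R X n ?N \<star> id_arr X ?M)) \<bullet> comult_arr R X (n + ?N) ?M"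
    by (rule qcomp_assoc)
  also have "\<dots> \<approx> (((?i \<star> ?n) \<bullet> comult_arr R X n ?N) \<star> (?m \<bullet> id_arr X ?M)) \<bullet> comult_arr R X (n + ?N) ?M"
    by (rule qcomp_cong_left[OF qtensor_interchange]) simp_all
  also have "\<dots> \<approx> (iterated_comult R X (n # ns) \<star> ?m) \<bullet> comult_arr R X (n + ?N) ?M"
    by (intro qcomp_cong_left qtensor_cong qarr_eq_sym[OF iterated_comult_Cons])
      (simp_all add: id_arr_def qcomp_qid_right qarr_eq_refl)
  finally show ?case by simp
qed

text \<open>Bead by bead this is \<open>iterated_comult_append\<close>: a first cut at
  \<open>n\<close> followed by cuts within both parts.\<close>

lemma inert_iterated_comult:
  assumes "(U, q) \<in> necklaces" "(T, q) \<in> necklaces" "U \<subseteq> T"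
  shows "inert_arr R X T U \<bullet> iterated_comult R X (gaps U) \<approx> iterated_comult R X (gaps T)"
  using assms
proof (induction U q arbitrary: T rule: necklace_induct)
  case zero
  then have "T = {0}" by (auto simp: necklaces_iff)
  then show ?case by (simp add: qcomp_qid_left qarr_eq_refl)
next
  case (join n U q)
  have nT: "n \<in> T" using join.prems join.hyps by (auto simp: necklaces_iff)
  note split = necklace_split(1,2)[OF join.prems(1) nT]
  let ?T0 = "{i \<in> T. i \<le> n}" and ?T' = "{i. n + i \<in> T}"
  have sub: "U \<subseteq> ?T'" using join.prems(2) by auto
  let ?I = "iterated_comult R X (gaps ?T0)" and ?J = "inert_arr R X ?T' U" and ?c = "comult_arr R X n q"
  have s: "sum_list (gaps ?T0) = n" "sum_list (gaps ?T') = q" "sum_list (gaps U) = q"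
    using sum_list_gaps split join.hyps by auto
  note J = inert_arr_lin[OF join.hyps(2) split(2) sub]
  have "inert_arr R X T (insert 0 ((+) n ` U)) \<bullet> iterated_comult R X (gaps (insert 0 ((+) n ` U)))
      \<approx> (?I \<star> ?J) \<bullet> ((id_arr X n \<star> iterated_comult R X (gaps U)) \<bullet> ?c)"
    unfolding inert_arr_insert[OF join.hyps(2,1)] gaps_insert[OF join.hyps(2,1)]
    using iterated_comult_Cons[of n "gaps U"] by (intro qcomp_cong_right) (simp add: s)
  also have "\<dots> = ((?I \<star> ?J) \<bullet> (id_arr X n \<star> iterated_comult R X (gaps U))) \<bullet> ?c"
    by (rule qcomp_assoc)
  also have "\<dots> \<approx> ((?I \<bullet> id_arr X n) \<star> (?J \<bullet> iterated_comult R X (gaps U))) \<bullet> ?c"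
    using J by (intro qcomp_cong_left qtensor_interchange) (simp_all add: s)
  also have "\<dots> \<approx> (?I \<star> iterated_comult R X (gaps ?T')) \<bullet> ?c"
    using J by (intro qcomp_cong_left qtensor_cong join.IH[OF split(2) sub])
      (simp_all add: s id_arr_def qcomp_qid_right qarr_eq_refl)
  also have "\<dots> \<approx> iterated_comult R X (gaps T)"
    using iterated_comult_append[of "gaps ?T0" "gaps ?T'"]
    by (simp add: s gaps_split[OF join.prems(1) nT] qarr_eq_sym)
  finally show ?case .
qed

lemma act_arr_split:
  assumes f: "f \<in> fint_maps (n + p) q"
  shows "(act_arr R X n (f n) (restrict f {0..n}) \<star> act_arr R X p (q - f n) (tail_map n p f)) \<bullet> comult_arr R X (f n) (q - f n)
    \<approx> comult_arr R X n p \<bullet> act_arr R X (n + p) q f"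
  using comult_natural[OF fint_maps_split(1,2)[OF f]] fint_maps_split(3,4)[OF f] by simp

text \<open>The map \<open>f\<close> is the sum of its part on the first bead and
  \<open>tail_map\<close>, so naturality of a single comultiplication treats the first bead and the
  induction hypothesis the others.\<close>

lemma active_iterated_comult:
  assumes "(T, p) \<in> necklaces" "f \<in> fint_maps p q"
  shows "active_arr R X T f \<bullet> iterated_comult R X (gaps (f ` T)) \<approx> iterated_comult R X (gaps T) \<bullet> act_arr R X p q f"
  using assms
proof (induction T p arbitrary: f q rule: necklace_induct)
  case zero
  \<comment> \<open>A map out of [0] has to reach both ends of its target, so the target is [0]
    too.\<close>
  then have q: "q = 0" and f: "f = (\<lambda>i\<in>{0..0}. i)"
    using fint_mapsD(1,2,5)[OF zero] by (auto simp: fun_eq_iff)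
  have "active_arr R X {0} f \<bullet> iterated_comult R X (gaps (f ` {0})) = counit_arr R X \<bullet> id_arr X 0"
    by (simp add: f qcomp_qid_left id_arr_def qcomp_qid_right)
  also have "\<dots> \<approx> counit_arr R X \<bullet> act_arr R X 0 q f"
    unfolding q f by (rule qcomp_cong_right[OF qarr_eq_sym[OF act_arr_id]])
  finally show ?case by simp
next
  case (join n T p)
  let ?f = "tail_map n p f" and ?A = "act_arr R X n (f n) (restrict f {0..n})"
  let ?B = "act_arr R X p (q - f n) ?f" and ?t = "iterated_comult R X (gaps T)" and ?h = "active_head n f"
    and ?r = "active_arr R X T ?f" and ?u = "iterated_comult R X (gaps (?f ` T))"
  note s = fint_maps_split[OF join.prems]
  note h = active_head_lin[OF join.prems]
  note r = active_arr_lin[OF join.hyps(2) s(2)]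
  note sums = sum_list_gaps[OF join.hyps(2)] sum_list_gaps[OF necklace_image[OF join.hyps(2) s(2)]]
  have A: "lin ?A" "lin ?B" using s by simp_all
  have ins: "active_arr R X (insert 0 ((+) n ` T)) f \<approx> ?h \<star> ?r"
    by (rule active_arr_insert[OF join.hyps(2,1) join.prems])
  \<comment> \<open>Both cases arrive at the same term. A collapsed bead brings in the inverse
    counit, which \<open>counit_inv_tensor\<close> turns into the comultiplication with first index
    \<open>f n = 0\<close>.\<close>
  have L: "active_arr R X (insert 0 ((+) n ` T)) f \<bullet> iterated_comult R X (gaps (f ` insert 0 ((+) n ` T)))
      \<approx> (?A \<star> (?t \<bullet> ?B)) \<bullet> comult_arr R X (f n) (q - f n)"
  proof (cases "f n = 0")
    case True
    have im: "f ` insert 0 ((+) n ` T) = ?f ` T"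
      using fint_mapsD(1)[OF s(2)] join.hyps(2) unfolding fint_maps_image[OF join.prems join.hyps(2)] True
      by (force simp: necklaces_iff)
    have hd: "?h = ?A \<bullet> counit_inv_arr R X" by (simp add: active_head_def True)
    have "active_arr R X (insert 0 ((+) n ` T)) f \<bullet> iterated_comult R X (gaps (f ` insert 0 ((+) n ` T)))
      \<approx> (?h \<star> ?r) \<bullet> ?u"
      unfolding im
      using active_arr_lin[OF necklace_insert[OF join.hyps(2)] join.prems] necklace_insert[OF join.hyps(2), of n] im
      by (intro qcomp_cong_left[OF ins]) simp_all
    also have "\<dots> \<approx> (?h \<star> ?r) \<bullet> (qid [] \<star> ?u)"
      by (intro qcomp_cong_right qarr_eq_sym[OF qtensor_unit_left]) simp
    also have "\<dots> \<approx> (?h \<bullet> qid []) \<star> (?r \<bullet> ?u)"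
      using h r True by (intro qtensor_interchange) simp_all
    also have "\<dots> \<approx> (?A \<bullet> counit_inv_arr R X) \<star> ((?t \<bullet> ?B) \<bullet> id_arr X q)"
      using h r True join.IH[OF s(2)]
      by (intro qtensor_cong) (simp_all add: sums hd id_arr_def qcomp_qid_right qarr_eq_refl)
    also have "\<dots> \<approx> (?A \<star> (?t \<bullet> ?B)) \<bullet> (counit_inv_arr R X \<star> id_arr X q)"
      using A True by (intro qarr_eq_sym[OF qtensor_interchange]) (simp_all add: sums)
    also have "\<dots> \<approx> (?A \<star> (?t \<bullet> ?B)) \<bullet> comult_arr R X 0 q"
      by (rule qcomp_cong_right[OF counit_inv_tensor])
    finally show ?thesis using True by simp
  next
    case False
    have hd: "?h \<bullet> id_arr X (f n) = ?A" by (simp add: active_head_def False id_arr_def qcomp_qid_right)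
    have g: "gaps (f ` insert 0 ((+) n ` T)) = f n # gaps (?f ` T)"
      unfolding fint_maps_image[OF join.prems join.hyps(2)]
      using False by (intro gaps_insert[OF necklace_image[OF join.hyps(2) s(2)]]) simp
    let ?c = "comult_arr R X (f n) (q - f n)"
    have "active_arr R X (insert 0 ((+) n ` T)) f \<bullet> iterated_comult R X (gaps (f ` insert 0 ((+) n ` T)))
      \<approx> (?h \<star> ?r) \<bullet> iterated_comult R X (f n # gaps (?f ` T))"
      unfolding g
      using active_arr_lin[OF necklace_insert[OF join.hyps(2)] join.prems] g
      by (intro qcomp_cong_left[OF ins]) simp_all
    also have "\<dots> \<approx> (?h \<star> ?r) \<bullet> ((id_arr X (f n) \<star> ?u) \<bullet> ?c)"
      using iterated_comult_Cons[of "f n" "gaps (?f ` T)"] by (intro qcomp_cong_right) (simp add: sums)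
    also have "\<dots> = ((?h \<star> ?r) \<bullet> (id_arr X (f n) \<star> ?u)) \<bullet> ?c"
      by (rule qcomp_assoc)
    also have "\<dots> \<approx> ((?h \<bullet> id_arr X (f n)) \<star> (?r \<bullet> ?u)) \<bullet> ?c"
      using h r False by (intro qcomp_cong_left qtensor_interchange) (simp_all add: sums)
    also have "\<dots> \<approx> (?A \<star> (?t \<bullet> ?B)) \<bullet> ?c"
      using A h r False join.IH[OF s(2)] unfolding hd
      by (intro qcomp_cong_left qtensor_cong) (simp_all add: sums qarr_eq_refl)
    finally show ?thesis .
  qed
  let ?c = "comult_arr R X (f n) (q - f n)" and ?d = "comult_arr R X n p"
  note L
  also have "(?A \<star> (?t \<bullet> ?B)) \<bullet> ?c \<approx> ((id_arr X n \<bullet> ?A) \<star> (?t \<bullet> ?B)) \<bullet> ?c"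
    by (simp add: id_arr_def qcomp_qid_left qarr_eq_refl)
  also have "\<dots> \<approx> ((id_arr X n \<star> ?t) \<bullet> (?A \<star> ?B)) \<bullet> ?c"
    using A by (intro qcomp_cong_left qarr_eq_sym[OF qtensor_interchange]) (simp_all add: sums)
  also have "\<dots> = (id_arr X n \<star> ?t) \<bullet> ((?A \<star> ?B) \<bullet> ?c)"
    by (rule qcomp_assoc[symmetric])
  \<comment> \<open>Naturality of the comultiplication for the two summands of
    \<open>f\<close>.\<close>
  also have "\<dots> \<approx> (id_arr X n \<star> ?t) \<bullet> (?d \<bullet> act_arr R X (n + p) q f)"
    by (rule qcomp_cong_right[OF act_arr_split[OF join.prems]])
  also have "\<dots> = ((id_arr X n \<star> ?t) \<bullet> ?d) \<bullet> act_arr R X (n + p) q f"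
    by (rule qcomp_assoc)
  also have "\<dots> \<approx> iterated_comult R X (gaps (insert 0 ((+) n ` T))) \<bullet> act_arr R X (n + p) q f"
    unfolding gaps_insert[OF join.hyps(2,1)]
    using iterated_comult_Cons[of n "gaps T"] join.prems
    by (intro qcomp_cong_left) (simp_all add: sums qarr_eq_sym)
  finally show ?case .
qed

text \<open>The inert part of \<open>f\<close> is absorbed by coassociativity, the active part by
  naturality of the comultiplication and, for collapsed beads, the counit.\<close>

lemma necklace_map_iterated_comult:
  assumes T: "(T, p) \<in> necklaces" and U: "(U, q) \<in> necklaces" and f: "f \<in> necklace_maps (T, p) (U, q)"
  shows "(active_arr R X T f \<bullet> inert_arr R X (f ` T) U) \<bullet> iterated_comult R X (gaps U)
    \<approx> iterated_comult R X (gaps T) \<bullet> act_arr R X p q f"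
proof -
  have f': "f \<in> fint_maps p q" "U \<subseteq> f ` T" using f by (auto simp: necklace_maps_def)
  have "(active_arr R X T f \<bullet> inert_arr R X (f ` T) U) \<bullet> iterated_comult R X (gaps U)
    = active_arr R X T f \<bullet> (inert_arr R X (f ` T) U \<bullet> iterated_comult R X (gaps U))"
    by (rule qcomp_assoc[symmetric])
  also have "\<dots> \<approx> active_arr R X T f \<bullet> iterated_comult R X (gaps (f ` T))"
    by (rule qcomp_cong_right[OF inert_iterated_comult[OF U necklace_image[OF T f'(1)] f'(2)]])
  also have "\<dots> \<approx> iterated_comult R X (gaps T) \<bullet> act_arr R X p q f"
    by (rule active_iterated_comult[OF T f'(1)])
  finally show ?thesis .
qed

end

context linear_templicial
begin

context
  fixes a b assumes a: "a \<in> tverts X" and b: "b \<in> tverts X"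
begin

abbreviation obj where "obj \<equiv> nobj (necklace_functor R X a b)"
abbreviation nm where "nm \<equiv> nmap (necklace_functor R X a b)"

lemma obj_eq: "obj (T, p) = qtens R (tverts X) (objs (gaps T)) a b"
  by (simp add: necklace_functor_def)

lemma nm_eq: "nm (T, p) (U, q) f = qfun (active_arr R X T f \<bullet> inert_arr R X (f ` T) U) a b"
  by (simp add: necklace_functor_def)

lemma obj_module: "module R (obj A)"
  by (cases A) (simp add: obj_eq qtens_module)

lemma nm_linear:
  assumes T: "(T, p) \<in> necklaces" and U: "(U, q) \<in> necklaces" and f: "f \<in> necklace_maps (T, p) (U, q)"
  shows "nm (T, p) (U, q) f \<in> linear_maps R (obj (U, q)) (obj (T, p))"
proof -
  have f': "f \<in> fint_maps p q" "U \<subseteq> f ` T" using f by (auto simp: necklace_maps_def)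
  note A = active_arr_lin[OF T f'(1)] and I = inert_arr_lin[OF U necklace_image[OF T f'(1)] f'(2)]
  have "lin (active_arr R X T f \<bullet> inert_arr R X (f ` T) U)" using A I by simp
  from linear_arr_fun[OF this a b] show ?thesis using A I by (simp add: obj_eq nm_eq)
qed

end

end

section \<open>The iterated comultiplications on elements\<close>

context templicial
begin

lemma qunwrap_qwrap_tsimp: "\<lbrakk>a \<in> tverts X; b \<in> tverts X; x \<in> carrier (tsimp X n a b)\<rbrakk>
    \<Longrightarrow> qunwrap R (tverts X) (tsimp X n) a b (qwrap R (tverts X) (tsimp X n) a b x) = x"
  by (rule qunwrap_qwrap[OF tsimp_module])

text \<open>The necklace functor composes every inert map with the active arrow of an identity map;
  this result removes that factor.\<close>

lemma active_arr_id: "(T, p) \<in> necklaces \<Longrightarrow> active_arr R X T (\<lambda>i\<in>{0..p}. i) \<approx> qid (objs (gaps T))"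
proof (induction T p rule: necklace_induct)
  case zero
  then show ?case by (simp add: qcomp_qid_left qarr_eq_refl)
next
  case (join n T p)
  have tl: "tail_map n p (\<lambda>i\<in>{0..n + p}. i) = (\<lambda>i\<in>{0..p}. i)"
    by (auto simp: tail_map_def fun_eq_iff)
  have re: "restrict (\<lambda>i\<in>{0..n + p}. i) {0..n} = (\<lambda>i\<in>{0..n}. i)"
    by (auto simp: fun_eq_iff)
  have hd: "active_head n (\<lambda>i\<in>{0..n + p}. i) \<approx> id_arr X n"
    using act_arr_id[of n] join.hyps(1) unfolding active_head_def re
    by (simp add: id_arr_def qcomp_qid_right)
  have "active_arr R X (insert 0 ((+) n ` T)) (\<lambda>i\<in>{0..n + p}. i)
      \<approx> active_head n (\<lambda>i\<in>{0..n + p}. i) \<star> active_arr R X T (\<lambda>i\<in>{0..p}. i)"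
    using active_arr_insert[OF join.hyps(2,1) fint_maps_id] unfolding tl .
  also have "\<dots> \<approx> id_arr X n \<star> qid (objs (gaps T))"
    by (rule qtensor_cong[OF active_head_lin(1)[OF fint_maps_id] active_arr_lin(1)[OF join.hyps(2) fint_maps_id]
          hd join.IH])
  also have "\<dots> \<approx> qid (objs (gaps (insert 0 ((+) n ` T))))"
    using qtensor_qid[of "[tsimp X n]" "objs (gaps T)"]
    by (simp add: id_arr_def gaps_insert[OF join.hyps(2,1)])
  finally show ?case .
qed

text \<open>Only the first bead is cut further. The right-hand side is the arrow that
  \<open>frobenius_right\<close> applies first for \<open>p = m\<close> and
  \<open>q = n - m\<close>.\<close>

lemma inert_arr_refine:
  assumes "0 < k" "k < m" "m < n"
  shows "inert_arr R X {0, k, m, n} {0, m, n} \<approx> comult_arr R X k (m - k) \<star> id_arr X (n - m)"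
proof -
  have U: "insert 0 ((+) m ` {0, n - m}) = {0, m, n}" "insert 0 ((+) (n - m) ` {0}) = {0, n - m}"
    using assms by auto
  have T: "{i \<in> {0, k, m, n}. i \<le> m} = {0, k, m}" "{i. m + i \<in> {0, k, m, n}} = {0, n - m}"
    "{i \<in> {0, n - m}. i \<le> n - m} = {0, n - m}"
    using assms by auto
  have nU: "({0, n - m}, n - m) \<in> necklaces" "({0}, 0) \<in> necklaces" by (auto simp: necklaces_iff)
  have "inert_arr R X {0, k, m, n} {0, m, n}
    = iterated_comult R X [k, m - k] \<star> (id_arr X (n - m) \<star> qid [])"
    using inert_arr_insert[OF nU(1), of m "{0, k, m, n}", unfolded U T]
      inert_arr_insert[OF nU(2), of "n - m" "{0, n - m}", unfolded U T] assms
    by (simp add: gaps_three gaps_two)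
  also have "\<dots> \<approx> comult_arr R X k (m - k) \<star> id_arr X (n - m)"
  proof (intro qtensor_cong qtensor_unit_right)
    show "iterated_comult R X [k, m - k] \<approx> comult_arr R X k (m - k)"
      using qcomp_cong_left[OF qtensor_qid[of "[tsimp X k]" "[tsimp X (m - k)]"], of "comult_arr R X k (m - k)"]
      by (simp add: id_arr_def qcomp_qid_left)
  qed simp_all
  finally show ?thesis .
qed

context
  fixes a b assumes a: "a \<in> tverts X" and b: "b \<in> tverts X"
begin

text \<open>This is \<open>\<mu>\<^sub>T : X\<^sub>p(a,b) \<rightarrow> X\<^sub>T(a,b)\<close>, where \<open>(T, p)\<close> is a necklace.\<close>
definition spread :: "nat set \<Rightarrow> nat \<Rightarrow> 'm \<Rightarrow> ('k, 's, 'm) tens" where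
  "spread T p x = qfun (iterated_comult R X (gaps T)) a b (qwrap R (tverts X) (tsimp X p) a b x)"

lemma spread_linear: "(T, p) \<in> necklaces \<Longrightarrow> spread T p \<in> linear_maps R (tsimp X p a b) (obj a b (T, p))"
  unfolding spread_def[abs_def] obj_eq[OF a b]
  using linear_maps_comp[OF qwrap_tsimp[OF a b]
      linear_arr_fun[OF lin_iterated_comult a b, of "gaps T", unfolded iterated_comult_dom iterated_comult_cod]]
  by (simp add: sum_list_gaps)

text \<open>The compatibilities needed later are instances of this: between comultiplications at two
  joints, and between comultiplications and faces or degeneracies.\<close>

lemma nm_spread:
  assumes T: "(T, p) \<in> necklaces" and U: "(U, q) \<in> necklaces" and f: "f \<in> necklace_maps (T, p) (U, q)"
    and x: "x \<in> carrier (tsimp X q a b)"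
  shows "nm a b (T, p) (U, q) f (spread U q x) = spread T p (tact X p q f a b x)"
proof -
  have "qwrap R (tverts X) (tsimp X q) a b x \<in> carrier (qtens R (tverts X) [tsimp X q] a b)"
    by (rule linear_maps_closed[OF qwrap_tsimp[OF a b] x])
  then have "nm a b (T, p) (U, q) f (spread U q x)
    = qfun (iterated_comult R X (gaps T)) a b (qfun (act_arr R X p q f) a b (qwrap R (tverts X) (tsimp X q) a b x))"
    using qarr_eqD[OF necklace_map_iterated_comult[OF T U f] a b] by (simp add: nm_eq[OF a b] spread_def sum_list_gaps[OF U])
  then show ?thesis
    by (simp add: act_arr_def spread_def qunwrap_qwrap_tsimp[OF a b x])
qed

lemma spread_two: "0 < p \<Longrightarrow> spread {0, p} p x = qwrap R (tverts X) (tsimp X p) a b x"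
  by (simp add: spread_def gaps_two)

lemma spread_three:
  assumes "0 < m" "m < n" "x \<in> carrier (tsimp X n a b)"
  shows "spread {0, m, n} n x
    = qfun (comult_arr R X m (n - m)) a b (qwrap R (tverts X) (tsimp X n) a b x)"
proof -
  have "iterated_comult R X [m, n - m] \<approx> comult_arr R X m (n - m)"
    using qcomp_cong_left[OF qtensor_qid[of "[tsimp X m]" "[tsimp X (n - m)]"], of "comult_arr R X m (n - m)"]
    by (simp add: id_arr_def qcomp_qid_left)
  from qarr_eqD[OF this a b] show ?thesis
    using assms linear_maps_closed[OF qwrap_tsimp[OF a b] assms(3)]
    by (simp add: spread_def gaps_three)
qed

end

end

section \<open>Filling horns with a nonassociative Frobenius structure\<close>

locale naF_templicial = templicial R X
  for R :: "('k, 'z) ring_scheme" (structure) and X :: "('k, 's, 'm) templicial" +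
  fixes Z :: "('k, 's, 'm) naF_data"
  assumes naF_linear: "\<lbrakk>a \<in> tverts X; b \<in> tverts X\<rbrakk> \<Longrightarrow> Z p q a b \<in>
        linear_maps R (qtens R (tverts X) [tsimp X p, tsimp X q] a b) (tsimp X (p + q) a b)"
    and naF_unit_right: "qarr_eq R (tverts X)
        (qcomp (naF_arr R X Z p 0) (qtensor R (tverts X) (id_arr X p) (counit_inv_arr R X))) (id_arr X p)"
    and frobenius_left: "k + l = p + q \<Longrightarrow> p \<le> k \<Longrightarrow> qarr_eq R (tverts X)
        (qcomp (comult_arr R X k l) (naF_arr R X Z p q))
        (qcomp (qtensor R (tverts X) (naF_arr R X Z p (k - p)) (id_arr X l))
               (qtensor R (tverts X) (id_arr X p) (comult_arr R X (k - p) l)))"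
    and frobenius_right: "k + l = p + q \<Longrightarrow> k \<le> p \<Longrightarrow> qarr_eq R (tverts X)
        (qcomp (comult_arr R X k l) (naF_arr R X Z p q))
        (qcomp (qtensor R (tverts X) (id_arr X k) (naF_arr R X Z (p - k) q))
               (qtensor R (tverts X) (comult_arr R X k (p - k)) (id_arr X q)))"
begin

lemma naF_arr_simps [simp]:
  "qdom (naF_arr R X Z p q) = [tsimp X p, tsimp X q]" "qcod (naF_arr R X Z p q) = [tsimp X (p + q)]"
  by (simp_all add: naF_arr_def)

lemma lin_naF [simp]: "lin (naF_arr R X Z p q)"
proof -
  have "qfun (naF_arr R X Z p q) a b \<in> linear_maps R (qtens R (tverts X) [tsimp X p, tsimp X q] a b)
      (qtens R (tverts X) [tsimp X (p + q)] a b)"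
    if "a \<in> tverts X" "b \<in> tverts X" for a b
    using linear_maps_comp[OF naF_linear[OF that] qwrap_tsimp[OF that]] by (simp add: naF_arr_def)
  then show ?thesis by (simp add: linear_arr_def)
qed

text \<open>For \<open>k = p\<close> the Frobenius identity leaves a comultiplication with first
  index 0. By \<open>counit_inv_tensor\<close> it is the inverse counit, which the unit law of
  \<open>Z\<close> absorbs.\<close>

lemma comult_naF: "comult_arr R X p q \<bullet> naF_arr R X Z p q \<approx> qid [tsimp X p, tsimp X q]"
proof -
  let ?Z = "naF_arr R X Z p 0" and ?i = "id_arr X p" and ?j = "id_arr X q" and ?e = "counit_inv_arr R X"
  have "comult_arr R X p q \<bullet> naF_arr R X Z p q \<approx> (?Z \<star> ?j) \<bullet> (?i \<star> comult_arr R X 0 q)"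
    using frobenius_left[of p q p q] by simp
  also have "\<dots> \<approx> (?Z \<star> ?j) \<bullet> (?i \<star> (?e \<star> ?j))"
    by (intro qcomp_cong_right qtensor_cong qarr_eq_sym[OF counit_inv_tensor] qarr_eq_refl) simp_all
  also have "\<dots> \<approx> (?Z \<star> ?j) \<bullet> ((?i \<star> ?e) \<star> ?j)"
    by (intro qcomp_cong_right qarr_eq_sym[OF qtensor_assoc]) simp_all
  also have "\<dots> \<approx> (?Z \<bullet> (?i \<star> ?e)) \<star> (?j \<bullet> ?j)"
    by (rule qtensor_interchange) simp_all
  also have "\<dots> \<approx> ?i \<star> ?j"
    by (intro qtensor_cong naF_unit_right) (simp_all add: id_arr_def qcomp_qid_right qarr_eq_refl)
  also have "\<dots> \<approx> qid [tsimp X p, tsimp X q]"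
    using qtensor_qid[of "[tsimp X p]" "[tsimp X q]"] by (simp add: id_arr_def)
  finally show ?thesis .
qed

context
  fixes a b assumes a: "a \<in> tverts X" and b: "b \<in> tverts X"
begin

text \<open>\<open>Z\<close> is a section by \<open>comult_naF\<close>. For \<open>k < m\<close> the
  second Frobenius identity lets the comultiplication at \<open>k\<close> act on the first factor of
  \<open>w\<close> before \<open>Z\<close> does; this is the refinement of \<open>w\<close> at
  \<open>k\<close>, and if it vanishes then \<open>z\<close> is not seen at
  \<open>k\<close>.\<close>

lemma naF_section:
  assumes m: "0 < m" "m < n" and w: "w \<in> carrier (obj a b ({0, m, n}, n))"
  obtains z where "z \<in> carrier (tsimp X n a b)" "spread a b {0, m, n} n z = w"
    "\<And>k. \<lbrakk>0 < k; k < m; nm a b ({0, k, m, n}, n) ({0, m, n}, n) (\<lambda>i\<in>{0..n}. i) w = \<zero>\<^bsub>obj a b ({0, k, m, n}, n)\<^esub>\<rbrakk>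
      \<Longrightarrow> spread a b {0, k, n} n z = \<zero>\<^bsub>obj a b ({0, k, n}, n)\<^esub>"
proof
  let ?l = "n - m" let ?z = "Z m ?l a b w"
  have w': "w \<in> carrier (qtens R (tverts X) [tsimp X m, tsimp X ?l] a b)"
    using w m by (simp add: obj_eq[OF a b] gaps_three)
  show z: "?z \<in> carrier (tsimp X n a b)"
    using linear_maps_closed[OF naF_linear[OF a b] w'] m by simp
  have zw: "qwrap R (tverts X) (tsimp X n) a b ?z = qfun (naF_arr R X Z m ?l) a b w"
    using m by (simp add: naF_arr_def)
  show "spread a b {0, m, n} n ?z = w"
    using qarr_eqD[OF comult_naF[of m ?l] a b, of w] w' by (simp add: spread_three[OF a b m z] zw)
  fix k assume k: "0 < k" "k < m"
    and 0: "nm a b ({0, k, m, n}, n) ({0, m, n}, n) (\<lambda>i\<in>{0..n}. i) w = \<zero>\<^bsub>obj a b ({0, k, m, n}, n)\<^esub>"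
  let ?c = "comult_arr R X k (m - k) \<star> id_arr X ?l" and ?T = "{0, k, m, n}" and ?U = "{0, m, n}"
  have T: "(?T, n) \<in> necklaces" and U: "(?U, n) \<in> necklaces" using k m by (auto simp: necklaces_iff)
  have im: "(\<lambda>i\<in>{0..n}. i) ` ?T = ?T" using k m by auto
  have gU: "gaps ?U = [m, ?l]" using m by (simp add: gaps_three)
  have I: "lin (inert_arr R X ?T ?U)" "qcod (inert_arr R X ?T ?U) = objs (gaps ?T)"
    "qdom (inert_arr R X ?T ?U) = objs (gaps ?U)"
    using inert_arr_lin[OF U T] by auto
  \<comment> \<open>The refinement map of the necklace functor is brought to the form
    \<open>?c\<close>, so that the vanishing assumption becomes one about the arrow in the Frobenius
    identity.\<close>
  have "active_arr R X ?T (\<lambda>i\<in>{0..n}. i) \<bullet> inert_arr R X ?T ?U \<approx> qid (objs (gaps ?T)) \<bullet> inert_arr R X ?T ?U"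
    using active_arr_lin(2)[OF T fint_maps_id] I unfolding im
    by (intro qcomp_cong_left[OF active_arr_id[OF T]]) simp_all
  also have "\<dots> = inert_arr R X ?T ?U" using I by (simp add: qcomp_qid_left)
  also have "\<dots> \<approx> ?c" by (rule inert_arr_refine[OF k m(2)])
  finally have c: "active_arr R X ?T (\<lambda>i\<in>{0..n}. i) \<bullet> inert_arr R X ?T ?U \<approx> ?c" .
  have "qfun ?c a b w = nm a b (?T, n) (?U, n) (\<lambda>i\<in>{0..n}. i) w"
    unfolding nm_eq[OF a b] im using qarr_eqD[OF c a b, of w] w' I(3) by (simp add: gU)
  moreover have "gaps ?T = [k, m - k, ?l]"
  proof -
    have "{i \<in> ?T. i \<le> m} = {0, k, m}" "{i. m + i \<in> ?T} = {0, ?l}" using k m by auto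
    then show ?thesis using gaps_split[of ?T m ?l] T k m by (simp add: gaps_three gaps_two)
  qed
  ultimately have cw: "qfun ?c a b w = \<zero>\<^bsub>qtens R (tverts X) (objs [k, m - k, ?l]) a b\<^esub>"
    using 0 by (simp add: obj_eq[OF a b])
  have F: "comult_arr R X k (n - k) \<bullet> naF_arr R X Z m ?l \<approx> (id_arr X k \<star> naF_arr R X Z (m - k) ?l) \<bullet> ?c"
    using k m by (intro frobenius_right) simp_all
  have L: "lin (id_arr X k \<star> naF_arr R X Z (m - k) ?l)" by simp
  have "spread a b {0, k, n} n ?z = qfun (id_arr X k \<star> naF_arr R X Z (m - k) ?l) a b (qfun ?c a b w)"
    using qarr_eqD[OF F a b, of w] w' k m by (simp add: spread_three[OF a b _ _ z] zw)
  also have "\<dots> = \<zero>\<^bsub>qtens R (tverts X) (objs [k, n - k]) a b\<^esub>"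
    using linear_maps_zero[OF qtens_module[OF linear_arr_dom[OF L], of a b]
        qtens_module[OF linear_arr_cod[OF L], of a b] linear_arr_fun[OF L a b]] k m
    by (simp add: cw)
  also have "\<dots> = \<zero>\<^bsub>obj a b ({0, k, n}, n)\<^esub>" using k m by (simp add: obj_eq[OF a b] gaps_three)
  finally show "spread a b {0, k, n} n ?z = \<zero>\<^bsub>obj a b ({0, k, n}, n)\<^esub>" .
qed

end

end

section \<open>Cofaces, codegeneracies and their cosimplicial identities\<close>

definition coface :: "nat \<Rightarrow> nat \<Rightarrow> nat \<Rightarrow> nat" where
  "coface p i = (\<lambda>t\<in>{0..p}. if t < i then t else Suc t)"

text \<open>As for \<open>coface\<close>, the parameter \<open>p\<close> is the smaller of the two
  dimensions: this map goes from [p + 1] to [p] and takes the value \<open>i\<close> twice.\<close>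

definition codegeneracy :: "nat \<Rightarrow> nat \<Rightarrow> nat \<Rightarrow> nat" where
  "codegeneracy p i = (\<lambda>t\<in>{0..Suc p}. if t \<le> i then t else t - 1)"

lemma coface_fint: "\<lbrakk>0 < i; i \<le> p\<rbrakk> \<Longrightarrow> coface p i \<in> fint_maps p (Suc p)"
  by (rule fint_mapsI) (auto simp: coface_def)

lemma codegeneracy_fint: "i \<le> p \<Longrightarrow> codegeneracy p i \<in> fint_maps (Suc p) p"
  by (rule fint_mapsI) (auto simp: codegeneracy_def)

lemma codegeneracy_coface:
  "i \<le> p \<Longrightarrow> j = i \<or> j = Suc i \<Longrightarrow> compose {0..p} (codegeneracy p i) (coface p j) = (\<lambda>t\<in>{0..p}. t)"
  by (auto simp: compose_def coface_def codegeneracy_def fun_eq_iff)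

lemma codegeneracy_coface_less:
  "\<lbrakk>l < i; i \<le> Suc p\<rbrakk> \<Longrightarrow> compose {0..Suc p} (codegeneracy (Suc p) i) (coface (Suc p) l)
    = compose {0..Suc p} (coface p l) (codegeneracy p (i - 1))"
  by (auto simp: compose_def coface_def codegeneracy_def fun_eq_iff)

lemma codegeneracy_coface_greater:
  "\<lbrakk>Suc i < l; i \<le> p\<rbrakk> \<Longrightarrow> compose {0..Suc p} (codegeneracy (Suc p) i) (coface (Suc p) l)
    = compose {0..Suc p} (coface p (l - 1)) (codegeneracy p i)"
  by (auto simp: compose_def coface_def codegeneracy_def fun_eq_iff)

lemma coface_coface:
  "\<lbrakk>i < l; l \<le> Suc p\<rbrakk> \<Longrightarrow> compose {0..p} (coface (Suc p) l) (coface p i)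
    = compose {0..p} (coface (Suc p) i) (coface p (l - 1))"
  by (auto simp: compose_def coface_def fun_eq_iff)

text \<open>The invariant kept while faces are corrected. The element has dimension
  \<open>p + 1\<close>, so \<open>0 < k \<le> p\<close> runs over all inner joints.\<close>

definition (in templicial) wedge_fill where
  "wedge_fill a b p w x \<longleftrightarrow> x \<in> carrier (tsimp X (Suc p) a b) \<and>
    (\<forall>k. 0 < k \<and> k \<le> p \<longrightarrow> spread a b {0, k, Suc p} (Suc p) x = w k)"

section \<open>Elements with prescribed comultiplications and faces\<close>

context naF_templicial
begin

context
  fixes a b assumes a: "a \<in> tverts X" and b: "b \<in> tverts X"
begin

abbreviation act where "act m n f \<equiv> tact X m n f a b"
abbreviation V where "V n \<equiv> tsimp X n a b"

lemma V_module: "module R (V n)" by (rule tsimp_module[OF a b])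

text \<open>\<open>compat\<close> asks that \<open>w m\<close> and \<open>w k\<close> agree after
  cutting at both joints, as the comultiplications of one element do. It makes the error at
  \<open>m\<close> vanish when cut at \<open>k < m\<close>, which is the condition under which
  \<open>naF_section\<close> leaves the value at \<open>k\<close> alone.\<close>

lemma wedge_filler:
  assumes w: "\<And>m. \<lbrakk>0 < m; m < n\<rbrakk> \<Longrightarrow> w m \<in> carrier (obj a b ({0, m, n}, n))"
    and compat: "\<And>k m. \<lbrakk>0 < k; k < m; m < n\<rbrakk>
      \<Longrightarrow> nm a b ({0, k, m, n}, n) ({0, m, n}, n) (\<lambda>i\<in>{0..n}. i) (w m)
        = nm a b ({0, k, m, n}, n) ({0, k, n}, n) (\<lambda>i\<in>{0..n}. i) (w k)"
    and "m \<le> n"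
  shows "\<exists>x\<in>carrier (V n). \<forall>k. 0 < k \<and> k < m \<longrightarrow> spread a b {0, k, n} n x = w k"
  using assms(3)
proof (induction m)
  case 0
  interpret module R "V n" by (rule V_module)
  show ?case by (intro bexI[of _ "\<zero>\<^bsub>V n\<^esub>"]) auto
next
  case (Suc m)
  then obtain x where x: "x \<in> carrier (V n)" and xw: "\<And>k. \<lbrakk>0 < k; k < m\<rbrakk> \<Longrightarrow> spread a b {0, k, n} n x = w k"
    by auto
  show ?case
  proof (cases "m = 0")
    case True
    with x show ?thesis by auto
  next
    case False
    then have m: "0 < m" "m < n" using Suc.prems by auto
    let ?id = "\<lambda>i\<in>{0..n}. i"
    have neck: "({0, k, n}, n) \<in> necklaces" if "k < n" for k using that by (auto simp: necklaces_iff)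
    have neck4: "({0, k, m, n}, n) \<in> necklaces" if "k < m" for k using that m by (auto simp: necklaces_iff)
    have id: "?id \<in> necklace_maps ({0, k, m, n}, n) ({0, k, n}, n)" "?id \<in> necklace_maps ({0, k, m, n}, n) ({0, m, n}, n)"
      if "k < m" for k
      using that m fint_maps_id[of n] by (auto simp: necklace_maps_def)
    interpret W: module R "obj a b ({0, m, n}, n)" by (rule obj_module[OF a b])
    interpret V: module R "V n" by (rule V_module)
    let ?v = "w m \<ominus>\<^bsub>obj a b ({0, m, n}, n)\<^esub> spread a b {0, m, n} n x"
    have sx: "spread a b {0, m, n} n x \<in> carrier (obj a b ({0, m, n}, n))"
      by (rule linear_maps_closed[OF spread_linear[OF a b neck[OF m(2)]] x])
    have v: "?v \<in> carrier (obj a b ({0, m, n}, n))" using w[OF m] sx by simp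
    obtain z where z: "z \<in> carrier (V n)" "spread a b {0, m, n} n z = ?v"
      and z0: "\<And>k. \<lbrakk>0 < k; k < m; nm a b ({0, k, m, n}, n) ({0, m, n}, n) ?id ?v = \<zero>\<^bsub>obj a b ({0, k, m, n}, n)\<^esub>\<rbrakk>
        \<Longrightarrow> spread a b {0, k, n} n z = \<zero>\<^bsub>obj a b ({0, k, n}, n)\<^esub>"
      using naF_section[OF a b m v] by metis
    have "spread a b {0, k, n} n (x \<oplus>\<^bsub>V n\<^esub> z) = w k" if k: "0 < k" "k < Suc m" for k
    proof (cases "k = m")
      case True
      have "spread a b {0, m, n} n (x \<oplus>\<^bsub>V n\<^esub> z) = spread a b {0, m, n} n x \<oplus>\<^bsub>obj a b ({0, m, n}, n)\<^esub> ?v"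
        using linear_maps_add[OF spread_linear[OF a b neck[OF m(2)]] x z(1)] z(2) by simp
      also have "\<dots> = w m" using sx w[OF m]
        by (simp add: W.M.a_lcomm a_minus_def W.M.r_neg)
      finally show ?thesis using True by simp
    next
      case False
      then have km: "k < m" and kn: "k < n" using k m by auto
      interpret K: module R "obj a b ({0, k, m, n}, n)" by (rule obj_module[OF a b])
      interpret L: module R "obj a b ({0, k, n}, n)" by (rule obj_module[OF a b])
      note nl = nm_linear[OF a b neck4[OF km] neck[OF m(2)] id(2)[OF km]]
      \<comment> \<open>The values of \<open>x\<close> at \<open>m\<close> and at \<open>k\<close>
        refine to the same iterated comultiplication, so the refined error is the difference of the
        two sides of \<open>compat\<close>.\<close>
      have "nm a b ({0, k, m, n}, n) ({0, m, n}, n) ?id (spread a b {0, m, n} n x) = spread a b {0, k, m, n} n x"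
        using nm_spread[OF a b neck4[OF km] neck[OF m(2)] id(2)[OF km] x] tact_id[OF a b x] by simp
      also have "\<dots> = nm a b ({0, k, m, n}, n) ({0, k, n}, n) ?id (spread a b {0, k, n} n x)"
        using nm_spread[OF a b neck4[OF km] neck[OF kn] id(1)[OF km] x] tact_id[OF a b x] by simp
      also have "\<dots> = nm a b ({0, k, m, n}, n) ({0, m, n}, n) ?id (w m)"
        using compat[OF k(1) km m(2)] xw[OF k(1) km] by simp
      finally have "nm a b ({0, k, m, n}, n) ({0, m, n}, n) ?id ?v = \<zero>\<^bsub>obj a b ({0, k, m, n}, n)\<^esub>"
        using linear_maps_minus[OF W.module_axioms K.module_axioms nl w[OF m] sx]
          linear_maps_closed[OF nl w[OF m]] by (simp add: a_minus_def K.M.r_neg)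
      from z0[OF k(1) km this] have "spread a b {0, k, n} n z = \<zero>\<^bsub>obj a b ({0, k, n}, n)\<^esub>" .
      then show ?thesis
        using linear_maps_add[OF spread_linear[OF a b neck[OF kn]] x z(1)] xw[OF k(1) km]
          linear_maps_closed[OF spread_linear[OF a b neck[OF kn]] x] by simp
    qed
    then show ?thesis using x z(1) by (intro bexI[of _ "x \<oplus>\<^bsub>V n\<^esub> z"]) auto
  qed
qed

text \<open>What a horn of dimension \<open>p + 1\<close> prescribes: comultiplications
  \<open>w\<close>, faces \<open>y\<close>, and the relations between them that any filler forces.
  In \<open>yy\<close> the indices give \<open>p \<ge> 2\<close>, so the truncated difference
  \<open>p - 1\<close> is a true one.\<close>

context
  fixes p j :: nat and w :: "nat \<Rightarrow> ('k, 's, 'm) tens" and y :: "nat \<Rightarrow> 'm"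
  assumes j: "0 < j" "j < Suc p"
    and y: "\<And>i. \<lbrakk>0 < i; i \<le> p; i \<noteq> j\<rbrakk> \<Longrightarrow> y i \<in> carrier (V p)"
    and wy: "\<And>i k. \<lbrakk>0 < i; i \<le> p; i \<noteq> j; 0 < k; k < p\<rbrakk> \<Longrightarrow> spread a b {0, k, p} p (y i)
        = nm a b ({0, k, p}, p) ({0, coface p i k, Suc p}, Suc p) (coface p i) (w (coface p i k))"
    and yy: "\<And>i l. \<lbrakk>0 < i; i < l; l \<le> p; i \<noteq> j; l \<noteq> j\<rbrakk>
      \<Longrightarrow> act (p - 1) p (coface (p - 1) i) (y l) = act (p - 1) p (coface (p - 1) (l - 1)) (y i)"
begin

text \<open>The degeneracy s_t is a section of both faces \<open>t\<close> and \<open>t + 1\<close>,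
  so adding the degenerate error repairs \<open>r\<close>. The set \<open>I\<close> of faces already
  right has to avoid these two indices; the bounds \<open>0 < t < p\<close> protect the
  comultiplications.\<close>

lemma face_step:
  assumes x: "wedge_fill a b p w x" and r: "0 < r" "r \<le> p" "r \<noteq> j" and t: "r = t \<or> r = Suc t" "0 < t" "t < p"
    and I: "\<And>i. i \<in> I \<Longrightarrow> 0 < i \<and> i \<le> p \<and> i \<noteq> j \<and> (i < t \<or> Suc t < i) \<and> act p (Suc p) (coface p i) x = y i"
  shows "\<exists>x'. wedge_fill a b p w x' \<and> (\<forall>i\<in>insert r I. act p (Suc p) (coface p i) x' = y i)"
proof -
  have xc: "x \<in> carrier (V (Suc p))" using x by (simp add: wedge_fill_def)
  obtain q where p: "p = Suc q" using t by (cases p) auto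
  interpret V: module R "V p" by (rule V_module)
  interpret V': module R "V (Suc p)" by (rule V_module)
  interpret V'': module R "V q" by (rule V_module)
  note ld = tact_linear[OF coface_fint a b]
  note ls = tact_linear[OF codegeneracy_fint a b]
  let ?e = "y r \<ominus>\<^bsub>V p\<^esub> act p (Suc p) (coface p r) x"
  have dx: "act p (Suc p) (coface p i) x \<in> carrier (V p)" if "0 < i" "i \<le> p" for i
    by (rule linear_maps_closed[OF ld[OF that] xc])
  have e: "?e \<in> carrier (V p)" using y[OF r] dx[OF r(1,2)] by simp
  \<comment> \<open>\<open>y r\<close> and the face \<open>r\<close> of \<open>x\<close> have the
    same inner comultiplications: both are read off from \<open>w\<close>, one by \<open>wy\<close>
    and the other because \<open>x\<close> attains \<open>w\<close>.\<close>
  have e_wedge: "spread a b {0, k, p} p ?e = \<zero>\<^bsub>obj a b ({0, k, p}, p)\<^esub>" if k: "0 < k" "k < p" for k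
  proof -
    interpret K: module R "obj a b ({0, k, p}, p)" by (rule obj_module[OF a b])
    let ?k = "coface p r k"
    have kp: "0 < ?k" "?k \<le> p" using k by (auto simp: coface_def)
    have T: "({0, k, p}, p) \<in> necklaces" and U: "({0, ?k, Suc p}, Suc p) \<in> necklaces"
      using k kp by (auto simp: necklaces_iff)
    have f: "coface p r \<in> necklace_maps ({0, k, p}, p) ({0, ?k, Suc p}, Suc p)"
      using coface_fint[OF r(1,2)] fint_mapsD(1,2)[OF coface_fint[OF r(1,2)]] by (auto simp: necklace_maps_def)
    have "spread a b {0, k, p} p (y r) = spread a b {0, k, p} p (act p (Suc p) (coface p r) x)"
      using wy[OF r k] nm_spread[OF a b T U f xc] x kp by (simp add: wedge_fill_def)
    then show ?thesis
      using linear_maps_minus[OF V_module obj_module[OF a b] spread_linear[OF a b T] y[OF r] dx[OF r(1,2)]]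
        linear_maps_closed[OF spread_linear[OF a b T] y[OF r]] by (simp add: a_minus_def K.M.r_neg)
  qed
  let ?s = "act (Suc p) p (codegeneracy p t) ?e"
  have tp: "t \<le> p" using t by simp
  have s: "?s \<in> carrier (V (Suc p))" by (rule linear_maps_closed[OF ls[OF tp] e])
  \<comment> \<open>Because \<open>0 < t < p\<close>, the codegeneracy sends inner joints to inner
    joints, and the claim reduces to \<open>e_wedge\<close>.\<close>
  have s_wedge: "spread a b {0, k, Suc p} (Suc p) ?s = \<zero>\<^bsub>obj a b ({0, k, Suc p}, Suc p)\<^esub>" if k: "0 < k" "k \<le> p" for k
  proof -
    let ?k = "codegeneracy p t k"
    have kp: "0 < ?k" "?k < p" using k t by (auto simp: codegeneracy_def)
    have T: "({0, k, Suc p}, Suc p) \<in> necklaces" and U: "({0, ?k, p}, p) \<in> necklaces"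
      using k kp by (auto simp: necklaces_iff)
    have f: "codegeneracy p t \<in> necklace_maps ({0, k, Suc p}, Suc p) ({0, ?k, p}, p)"
      using codegeneracy_fint[OF tp] fint_mapsD(1,2)[OF codegeneracy_fint[OF tp]] by (auto simp: necklace_maps_def)
    have "spread a b {0, k, Suc p} (Suc p) ?s = nm a b ({0, k, Suc p}, Suc p) ({0, ?k, p}, p) (codegeneracy p t) (spread a b {0, ?k, p} p ?e)"
      using nm_spread[OF a b T U f e] by simp
    also have "\<dots> = \<zero>\<^bsub>obj a b ({0, k, Suc p}, Suc p)\<^esub>"
      using e_wedge[OF kp] linear_maps_zero[OF obj_module[OF a b] obj_module[OF a b] nm_linear[OF a b T U f]] by simp
    finally show ?thesis .
  qed
  let ?x = "x \<oplus>\<^bsub>V (Suc p)\<^esub> ?s"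
  have "wedge_fill a b p w ?x"
    unfolding wedge_fill_def
  proof (intro conjI allI impI)
    show "?x \<in> carrier (V (Suc p))" using xc s by simp
    fix k assume k: "0 < k \<and> k \<le> p"
    interpret K: module R "obj a b ({0, k, Suc p}, Suc p)" by (rule obj_module[OF a b])
    have T: "({0, k, Suc p}, Suc p) \<in> necklaces" using k by (auto simp: necklaces_iff)
    show "spread a b {0, k, Suc p} (Suc p) ?x = w k"
      using linear_maps_add[OF spread_linear[OF a b T] xc s] s_wedge k x
        linear_maps_closed[OF spread_linear[OF a b T] xc] by (simp add: wedge_fill_def)
  qed
  moreover have "act p (Suc p) (coface p r) ?x = y r"
  proof -
    have "act p (Suc p) (coface p r) ?s = act p p (compose {0..p} (codegeneracy p t) (coface p r)) ?e"
      using tact_comp[OF coface_fint[OF r(1,2)] codegeneracy_fint[OF tp] a b e] by simp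
    also have "\<dots> = ?e" using codegeneracy_coface[OF tp t(1)] tact_id[OF a b e] by simp
    finally have "act p (Suc p) (coface p r) ?x = act p (Suc p) (coface p r) x \<oplus>\<^bsub>V p\<^esub> ?e"
      using linear_maps_add[OF ld[OF r(1,2)] xc s] by simp
    also have "\<dots> = y r" using y[OF r] dx[OF r(1,2)]
      by (simp add: V.M.a_lcomm a_minus_def V.M.r_neg)
    finally show ?thesis .
  qed
  moreover have "act p (Suc p) (coface p i) ?x = y i" if i: "i \<in> I" for i
  proof -
    have i': "0 < i" "i \<le> p" "i \<noteq> j" "i < t \<or> Suc t < i" "act p (Suc p) (coface p i) x = y i" using I[OF i] by auto
    \<comment> \<open>Chosen such that face \<open>i\<close> after s_t is degeneracy
      \<open>t0\<close> of face \<open>i0\<close>. As \<open>i\<close> avoids \<open>t\<close> and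
      \<open>t + 1\<close>, it lies on the same side of \<open>r\<close> as of \<open>t\<close>, so
      the same \<open>i0\<close> appears when the faces \<open>i\<close> and \<open>r\<close> of
      \<open>x\<close> are exchanged.\<close>
    define i0 where "i0 = (if i < r then i else i - 1)"
    define t0 where "t0 = (if i < t then t - 1 else t)"
    have i0: "0 < i0" "i0 \<le> q" using i' t r by (auto simp: i0_def p)
    have t0: "t0 \<le> q" using i' t by (auto simp: t0_def p)
    have ci0: "coface q i0 \<in> fint_maps q p" and ct0: "codegeneracy q t0 \<in> fint_maps p q"
      and ci: "coface p i \<in> fint_maps p (Suc p)" and cr: "coface p r \<in> fint_maps p (Suc p)"
      using coface_fint[OF i0] codegeneracy_fint[OF t0] coface_fint[OF i'(1,2)] coface_fint[OF r(1,2)] p by simp_all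
    \<comment> \<open>Exchanging the two faces brings \<open>i\<close> next to \<open>x\<close>,
      where \<open>x\<close> already agrees with \<open>y i\<close>; \<open>yy\<close> then leads
      back to \<open>y r\<close>. Hence face \<open>i0\<close> kills the error.\<close>
    have y0: "act q p (coface q i0) (act p (Suc p) (coface p r) x) = act q p (coface q i0) (y r)"
    proof (cases "i < r")
      case True
      have r1: "0 < r - 1" "r - 1 \<le> q" using True i'(1) r by (auto simp: p)
      have "act q p (coface q i0) (act p (Suc p) (coface p r) x)
        = act q (Suc p) (compose {0..q} (coface p r) (coface q i)) x"
        using tact_comp[OF ci0 cr a b xc] True by (simp add: p i0_def)
      also have "\<dots> = act q (Suc p) (compose {0..q} (coface p i) (coface q (r - 1))) x"
        using coface_coface[of i r q] True r by (simp add: p)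
      also have "\<dots> = act q p (coface q (r - 1)) (y i)"
        using tact_comp[OF _ ci a b xc, of "coface q (r - 1)" q] coface_fint[OF r1] i'(5) by (simp add: p)
      also have "\<dots> = act q p (coface q i0) (y r)"
        using yy[of i r] True i' r by (simp add: p i0_def)
      finally show ?thesis .
    next
      case False
      then have "r < i" using i'(4) t by auto
      have r1: "r \<le> q" using \<open>r < i\<close> i'(2) by (simp add: p)
      have "act q p (coface q i0) (act p (Suc p) (coface p r) x)
        = act q (Suc p) (compose {0..q} (coface p r) (coface q (i - 1))) x"
        using tact_comp[OF ci0 cr a b xc] False by (simp add: p i0_def)
      also have "\<dots> = act q (Suc p) (compose {0..q} (coface p i) (coface q r)) x"
        using coface_coface[of r i q] \<open>r < i\<close> i' by (simp add: p)
      also have "\<dots> = act q p (coface q r) (y i)"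
        using tact_comp[OF _ ci a b xc, of "coface q r" q] coface_fint[OF r(1) r1] i'(5) by (simp add: p)
      also have "\<dots> = act q p (coface q i0) (y r)"
        using yy[of r i] \<open>r < i\<close> i' r by (simp add: p i0_def)
      finally show ?thesis .
    qed
    have de: "act q p (coface q i0) ?e = \<zero>\<^bsub>V q\<^esub>"
      using linear_maps_minus[OF V_module V_module tact_linear[OF ci0 a b] y[OF r] dx[OF r(1,2)]] y0
        linear_maps_closed[OF tact_linear[OF ci0 a b] y[OF r]] by (simp add: a_minus_def V''.M.r_neg)
    have "compose {0..p} (codegeneracy p t) (coface p i) = compose {0..p} (coface q i0) (codegeneracy q t0)"
      using codegeneracy_coface_less[of i t q] codegeneracy_coface_greater[of t i q] i'(4) t
      by (auto simp: p i0_def t0_def)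
    then have "act p (Suc p) (coface p i) ?s = act p p (compose {0..p} (coface q i0) (codegeneracy q t0)) ?e"
      using tact_comp[OF ci codegeneracy_fint[OF tp] a b e] by simp
    also have "\<dots> = act p q (codegeneracy q t0) (act q p (coface q i0) ?e)"
      using tact_comp[OF ct0 ci0 a b e] by simp
    also have "\<dots> = \<zero>\<^bsub>V p\<^esub>"
      using linear_maps_zero[OF V_module V_module tact_linear[OF ct0 a b]] by (simp add: de)
    finally have "act p (Suc p) (coface p i) ?x = act p (Suc p) (coface p i) x"
      using linear_maps_add[OF ld[OF i'(1,2)] xc s] dx[OF i'(1,2)] by simp
    then show ?thesis using i'(5) by simp
  qed
  ultimately show ?thesis by blast
qed

text \<open>Moving towards \<open>j\<close> from both ends, the second face touched by each
  degeneracy is one not treated so far or the missing face \<open>j\<close>.\<close>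

lemma face_filler:
  assumes x: "wedge_fill a b p w x"
  shows "\<exists>x. wedge_fill a b p w x \<and> (\<forall>i. 0 < i \<and> i \<le> p \<and> i \<noteq> j \<longrightarrow> act p (Suc p) (coface p i) x = y i)"
proof -
  \<comment> \<open>Here \<open>face_step\<close> is used with \<open>r = t\<close>: the other face
    touched is the next higher one.\<close>
  have low: "\<exists>x. wedge_fill a b p w x \<and> (\<forall>i\<in>{0<..<Suc r}. act p (Suc p) (coface p i) x = y i)" if "Suc r \<le> j" for r
    using that
  proof (induction r)
    case 0
    then show ?case using x by (intro exI[of _ x]) auto
  next
    case (Suc r)
    then obtain x where "wedge_fill a b p w x" "\<And>i. i \<in> {0<..<Suc r} \<Longrightarrow> act p (Suc p) (coface p i) x = y i" by force
    moreover have "insert (Suc r) {0<..<Suc r} = {0<..<Suc (Suc r)}" by auto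
    ultimately show ?case
      using face_step[of x "Suc r" "Suc r" "{0<..<Suc r}"] Suc.prems j by auto
  qed
  \<comment> \<open>\<open>d\<close> is the distance from \<open>j\<close> above which faces are
    right, and it descends to 0. At \<open>d = p - j\<close> nothing is required above
    \<open>j\<close>, and \<open>low\<close> supplies the faces below.\<close>
  have high: "\<exists>x. wedge_fill a b p w x \<and> (\<forall>i\<in>{0<..<j} \<union> {j + d<..p}. act p (Suc p) (coface p i) x = y i)" if "d \<le> p - j" for d
    using that
  proof (induction "p - j - d" arbitrary: d)
    case 0
    then have "{j + d<..p} = {}" by auto
    then show ?case using low[of "j - 1"] j by auto
  next
    case (Suc e)
    from Suc.hyps(1)[of "Suc d"] Suc.hyps(2) Suc.prems obtain x where x: "wedge_fill a b p w x"
      "\<And>i. i \<in> {0<..<j} \<union> {j + Suc d<..p} \<Longrightarrow> act p (Suc p) (coface p i) x = y i" by force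
    have "insert (j + Suc d) ({0<..<j} \<union> {j + Suc d<..p}) = {0<..<j} \<union> {j + d<..p}"
      using Suc.hyps(2) by auto
    moreover have "\<exists>x'. wedge_fill a b p w x' \<and>
        (\<forall>i\<in>insert (j + Suc d) ({0<..<j} \<union> {j + Suc d<..p}). act p (Suc p) (coface p i) x' = y i)"
    \<comment> \<open>Here \<open>t = j + d\<close> and \<open>r = t + 1\<close>. For
      \<open>d = 0\<close> the other face touched is \<open>j\<close> itself.\<close>
    proof (rule face_step[OF x(1)])
      show "0 < i \<and> i \<le> p \<and> i \<noteq> j \<and> (i < j + d \<or> Suc (j + d) < i) \<and> act p (Suc p) (coface p i) x = y i"
        if "i \<in> {0<..<j} \<union> {j + Suc d<..p}" for i
        using that x(2)[OF that] j by (auto simp del: Un_iff) 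
    qed (use Suc.hyps(2) j in auto)
    ultimately show ?case by simp
  qed
  have "{0<..<j} \<union> {j + 0<..p} = {i. 0 < i \<and> i \<le> p \<and> i \<noteq> j}" using j by auto
  with high[of 0] show ?thesis by auto
qed

end

end

end

section \<open>Free templicial modules of subcomplexes of a simplex\<close>

lemma mono_mapsD:
  assumes "x \<in> mono_maps m n"
  shows "\<And>i j. \<lbrakk>i \<le> j; j \<le> m\<rbrakk> \<Longrightarrow> x i \<le> x j" "\<And>i. i \<le> m \<Longrightarrow> x i \<le> n" "\<And>i. m < i \<Longrightarrow> x i = undefined"
  using assms by (auto simp: mono_maps_def mono_on_def PiE_def extensional_def)

lemma mono_mapsI:
  assumes "\<And>i j. \<lbrakk>i \<le> j; j \<le> m\<rbrakk> \<Longrightarrow> x i \<le> x j" "\<And>i. i \<le> m \<Longrightarrow> x i \<le> n" "\<And>i. m < i \<Longrightarrow> x i = undefined"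
  shows "x \<in> mono_maps m n"
  using assms by (auto simp: mono_maps_def mono_on_def PiE_def extensional_def)

lemma std_vertex_inject [simp]: "std_vertex i = std_vertex j \<longleftrightarrow> i = j"
  by (auto simp: std_vertex_def fun_eq_iff restrict_def split: if_splits)

lemma finite_fint_maps: "finite (fint_maps p n)"
  by (rule finite_subset[of _ "{0..p} \<rightarrow>\<^sub>E {0..n}"]) (auto simp: fint_maps_def mono_maps_def intro: finite_PiE)

lemma qpaths_Cons_iff:
  "(a', x, c) # xs \<in> qpaths S (Q # Qs) a b
    \<longleftrightarrow> a' = a \<and> a \<in> S \<and> c \<in> S \<and> x \<in> carrier (Q a c) \<and> xs \<in> qpaths S Qs c b"
  by auto

lemma qpaths_Nil_iff: "[] \<in> qpaths S [] a b \<longleftrightarrow> a = b"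
  by simp

text \<open>Treats the standard simplex and the horn at once. Simplices are monotone maps into [n],
  hence determined by their vertices, and the simplicial structure is precomposition.\<close>

locale simplex_part = cring R
  for R :: "('k, 'z) ring_scheme" (structure) +
  fixes n :: nat and K :: "(nat \<Rightarrow> nat) simplicial_set"
  assumes K_mono: "ssimp K m \<subseteq> mono_maps m n"
    and K_act: "sact K l m f x = compose {0..l} x f"
    and K_closed: "\<lbrakk>x \<in> ssimp K m; f \<in> mono_maps l m\<rbrakk> \<Longrightarrow> compose {0..l} x f \<in> ssimp K l"
begin

abbreviation F where "F \<equiv> free_templicial R K"

text \<open>The 0-simplices of \<open>K\<close> are maps on \<open>{0..0}\<close>, so the end values
  of \<open>x\<close> pass through \<open>std_vertex\<close> before they are compared with
  \<open>a\<close> and \<open>b\<close>.\<close>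

definition simplices :: "nat \<Rightarrow> (nat \<Rightarrow> nat) \<Rightarrow> (nat \<Rightarrow> nat) \<Rightarrow> (nat \<Rightarrow> nat) set" where
  "simplices m a b = {x \<in> ssimp K m. std_vertex (x 0) = a \<and> std_vertex (x m) = b}"

lemma svertex_eq: "svertex K m i x = std_vertex (x i)"
  by (auto simp: svertex_def K_act std_vertex_def compose_def fun_eq_iff)

lemma F_verts: "tverts F = ssimp K 0"
  by (simp add: free_templicial_def Let_def)

lemma F_simp: "tsimp F m a b = free_module R (simplices m a b)"
  by (simp add: free_templicial_def Let_def simplices_def svertex_eq)

lemma F_act: "tact F m l f a b = free_lift R (tsimp F m a b) (\<lambda>x. free_gen R (compose {0..m} x f))"
  by (simp add: free_templicial_def Let_def K_act)

lemma F_comult: "tcomult F p q a b = free_lift R (qtens R (tverts F) [tsimp F p, tsimp F q] a b)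
    (\<lambda>x. ptens R (tverts F) [tsimp F p, tsimp F q] a b
      [(a, free_gen R (restrict x {0..p}), std_vertex (x p)), (std_vertex (x p), free_gen R (\<lambda>i\<in>{0..q}. x (p + i)), b)])"
proof -
  have "compose {0..p} x (\<lambda>i\<in>{0..p}. i) = restrict x {0..p}"
    "compose {0..q} x (\<lambda>i\<in>{0..q}. p + i) = (\<lambda>i\<in>{0..q}. x (p + i))" for x :: "nat \<Rightarrow> nat"
    by (auto simp: compose_def fun_eq_iff)
  then show ?thesis by (simp add: free_templicial_def Let_def K_act svertex_eq)
qed

lemma F_counit: "tcounit F a b = free_lift R (qtens R (tverts F) [] a b) (\<lambda>x. ptens R (tverts F) [] a b [])"
  by (simp add: free_templicial_def Let_def)

lemma vertex_mem:
  assumes "x \<in> ssimp K m" "i \<le> m"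
  shows "std_vertex (x i) \<in> tverts F"
proof -
  have "compose {0..0} x (\<lambda>_\<in>{0..0}. i) \<in> ssimp K 0"
    using assms(2) by (intro K_closed[OF assms(1)] mono_mapsI) auto
  also have "compose {0..0} x (\<lambda>_\<in>{0..0}. i) = std_vertex (x i)"
    by (auto simp: compose_def std_vertex_def fun_eq_iff)
  finally show ?thesis by (simp add: F_verts)
qed

lemma vertex_eq: "a \<in> tverts F \<Longrightarrow> std_vertex (a 0) = a"
  using mono_mapsD(3)[of a 0 n] K_mono[of 0] by (auto simp: std_vertex_def fun_eq_iff F_verts)

lemma simplices_zero: "a \<in> tverts F \<Longrightarrow> simplices 0 a b = (if a = b then {a} else {})"
  using vertex_eq by (auto simp: simplices_def F_verts)

lemma K_restrict: "\<lbrakk>x \<in> ssimp K m; l \<le> m\<rbrakk> \<Longrightarrow> restrict x {0..l} \<in> ssimp K l"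
proof -
  assume *: "x \<in> ssimp K m" "l \<le> m"
  then have "compose {0..l} x (\<lambda>i\<in>{0..l}. i) \<in> ssimp K l"
    by (intro K_closed[OF *(1)] mono_mapsI) auto
  also have "compose {0..l} x (\<lambda>i\<in>{0..l}. i) = restrict x {0..l}" by (auto simp: compose_def fun_eq_iff)
  finally show ?thesis .
qed

lemma K_tail: "x \<in> ssimp K (p + q) \<Longrightarrow> (\<lambda>i\<in>{0..q}. x (p + i)) \<in> ssimp K q"
proof -
  assume x: "x \<in> ssimp K (p + q)"
  have "compose {0..q} x (\<lambda>i\<in>{0..q}. p + i) \<in> ssimp K q"
    by (intro K_closed[OF x] mono_mapsI) auto
  also have "compose {0..q} x (\<lambda>i\<in>{0..q}. p + i) = (\<lambda>i\<in>{0..q}. x (p + i))" by (auto simp: compose_def fun_eq_iff)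
  finally show ?thesis .
qed

lemma F_gen: "x \<in> simplices m a b \<Longrightarrow> free_gen R x \<in> carrier (tsimp F m a b)"
  unfolding F_simp by (rule free_gen_closed)

lemma F_module: "module R (tsimp F m a b)"
  unfolding F_simp by (rule free_module_module)

lemma F_quivers: "module_quivers R (tverts F) (map (tsimp F) ms)"
  by (simp add: module_quivers_def F_module)

lemma comult_path:
  assumes "x \<in> simplices (p + q) a b"
  shows "[(a, free_gen R (restrict x {0..p}), std_vertex (x p)), (std_vertex (x p), free_gen R (\<lambda>i\<in>{0..q}. x (p + i)), b)]
    \<in> qpaths (tverts F) [tsimp F p, tsimp F q] a b"
proof -
  have x: "x \<in> ssimp K (p + q)" "std_vertex (x 0) = a" "std_vertex (x (p + q)) = b"
    using assms by (auto simp: simplices_def)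
  have 1: "restrict x {0..p} \<in> simplices p a (std_vertex (x p))"
    using K_restrict[OF x(1), of p] x by (simp add: simplices_def)
  have 2: "(\<lambda>i\<in>{0..q}. x (p + i)) \<in> simplices q (std_vertex (x p)) b"
    using K_tail[OF x(1)] x by (simp add: simplices_def)
  have "a \<in> tverts F" "std_vertex (x p) \<in> tverts F" "b \<in> tverts F"
    using vertex_mem[OF x(1), of 0] vertex_mem[OF x(1), of p] vertex_mem[OF x(1), of "p + q"] x(2,3) by simp_all
  then show ?thesis
    unfolding qpaths_Cons_iff qpaths_Nil_iff using F_gen[OF 1] F_gen[OF 2] by blast
qed

interpretation T: quiver_tensors R "tverts F" ..

lemma act_simplices:
  assumes x: "x \<in> simplices l a b" and f: "f \<in> fint_maps m l"
  shows "compose {0..m} x f \<in> simplices m a b"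
proof -
  have "compose {0..m} x f \<in> ssimp K m"
    using x f by (intro K_closed[of x l]) (auto simp: simplices_def fint_maps_def)
  moreover have "compose {0..m} x f 0 = x 0" "compose {0..m} x f m = x l"
    using fint_mapsD(1,2)[OF f] by (simp_all add: compose_def)
  ultimately show ?thesis using x by (simp add: simplices_def)
qed

lemma F_mq: "module_quivers R (tverts F) [tsimp F p, tsimp F q]"
  using F_quivers[of "[p, q]"] by simp

lemma counit_multilinear:
  assumes "a \<in> tverts F"
  shows "multilinear R (tverts F) ([] :: ('k, nat \<Rightarrow> nat, (nat \<Rightarrow> nat) \<Rightarrow> 'k) quiver list) a b (tsimp F 0 a b) (\<lambda>_. free_gen R a)"
  unfolding multilinear_Nil
proof
  assume "a = b"
  then show "free_gen R a \<in> carrier (tsimp F 0 a b)"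
    using assms by (intro F_gen) (simp add: simplices_zero)
qed

lemma F_counit_gen:
  assumes "a \<in> tverts F"
  shows "tcounit F a a (free_gen R a) = ptens R (tverts F) [] a a []"
  unfolding F_counit
  by (rule free_lift_gen[where \<phi> = "\<lambda>_. ptens R (tverts F) [] a a []",
        OF T.qtens_module[OF module_quivers_Nil] T.ptens_Nil_closed])

text \<open>For \<open>a = b\<close> both modules are free on one generator, the vertex
  \<open>a\<close> and the empty path; otherwise both are zero. The inverse sends the empty path to
  the generator \<open>a\<close>.\<close>

lemma F_counit_bij:
  assumes a: "a \<in> tverts F" and b: "b \<in> tverts F"
  shows "bij_betw (tcounit F a b) (carrier (tsimp F 0 a b)) (carrier (qtens R (tverts F) [] a b))"
proof -
  let ?Q = "qtens R (tverts F) ([] :: ('k, nat \<Rightarrow> nat, (nat \<Rightarrow> nat) \<Rightarrow> 'k) quiver list) a b"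
  let ?g = "qtens_lift R (tsimp F 0 a b)
    (\<lambda>_ :: ((nat \<Rightarrow> nat) \<times> ((nat \<Rightarrow> nat) \<Rightarrow> 'k) \<times> (nat \<Rightarrow> nat)) list. free_gen R a)"
  note Qm = T.qtens_module[OF module_quivers_Nil]
  have t: "tcounit F a b \<in> linear_maps R (tsimp F 0 a b) ?Q"
    unfolding F_counit F_simp
    using a T.ptens_Nil_closed by (intro free_lift_linear Qm) (auto simp: simplices_zero split: if_splits)
  have g: "?g \<in> linear_maps R ?Q (tsimp F 0 a b)"
    by (rule T.qtens_lift_linear[OF module_quivers_Nil F_module counit_multilinear[OF a]])
  have gp: "?g (ptens R (tverts F) [] a b []) = free_gen R a" if "a = b"
    by (rule T.qtens_lift_ptens[OF module_quivers_Nil F_module counit_multilinear[OF a]]) (simp add: that)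
  have 1: "?g (tcounit F a b u) = u" if "u \<in> carrier (tsimp F 0 a b)" for u
    using that unfolding F_simp
  proof (rule free_module_ext[OF free_module_module linear_maps_comp[OF t[unfolded F_simp] g[unfolded F_simp]] linear_maps_id, rotated])
    fix x assume "x \<in> simplices 0 a b"
    then have "x = a" "a = b" using a by (auto simp: simplices_zero split: if_splits)
    then show "qtens_lift R (free_module R (simplices 0 a b)) (\<lambda>_. free_gen R a) (tcounit F a b (free_gen R x)) = free_gen R x"
      using F_counit_gen[OF a] gp by (simp add: F_simp)
  qed
  have 2: "tcounit F a b (?g U) = U" if "U \<in> carrier ?Q" for U
  proof (rule T.qtens_ext[OF module_quivers_Nil Qm linear_maps_comp[OF g t] linear_maps_id _ that])
    fix xs assume "xs \<in> qpaths (tverts F) ([] :: ('k, nat \<Rightarrow> nat, (nat \<Rightarrow> nat) \<Rightarrow> 'k) quiver list) a b"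
    then show "tcounit F a b (?g (ptens R (tverts F) [] a b xs)) = ptens R (tverts F) [] a b xs"
      using gp F_counit_gen[OF a] by auto
  qed
  show ?thesis
    using 1 2 linear_maps_closed[OF t] linear_maps_closed[OF g]
    by (intro bij_betw_byWitness[where f' = ?g]) auto
qed

sublocale linear_templicial R F
proof (intro linear_templicial.intro linear_templicial_axioms.intro)
  show "quiver_tensors R" by (rule T.quiver_tensors_axioms)
  show "module R (tsimp F m a b)" for m a b by (rule F_module)
  show "tact F m l f a b \<in> linear_maps R (tsimp F l a b) (tsimp F m a b)" if "f \<in> fint_maps m l" for f m l a b
    unfolding F_act F_simp[of l]
    by (rule free_lift_linear[OF F_module F_gen[OF act_simplices[OF _ that]]])
  show "tcomult F p q a b \<in> linear_maps R (tsimp F (p + q) a b) (qtens R (tverts F) [tsimp F p, tsimp F q] a b)" for p q a b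
    unfolding F_comult F_simp[of "p + q"]
    by (intro free_lift_linear T.qtens_module F_mq T.ptens_closed[OF F_mq] comult_path)
  show "tcounit F a b \<in> linear_maps R (tsimp F 0 a b) (qtens R (tverts F) [] a b)"
    if "a \<in> tverts F" for a b
    unfolding F_counit F_simp
    using that T.ptens_Nil_closed
    by (intro free_lift_linear T.qtens_module[OF module_quivers_Nil]) (auto simp: simplices_zero split: if_splits)
  show "bij_betw (tcounit F a b) (carrier (tsimp F 0 a b)) (carrier (qtens R (tverts F) [] a b))"
    if "a \<in> tverts F" "b \<in> tverts F" for a b
    using F_counit_bij that by simp
qed

end

section \<open>Basis vectors of the free necklace modules and the action of necklace maps on
  them\<close>

context simplex_part
begin

text \<open>A map \<open>f : [p] \<rightarrow> [n]\<close> whose restrictions to the beads of a necklace \<open>(T, p)\<close> all lie in \<open>K\<close>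
  stands for a basis element of \<open>F\<^sub>T\<close>; its vertices are read off from \<open>f\<close>. Necklaces are given by their gaps.\<close>
fun cutpath :: "nat list \<Rightarrow> (nat \<Rightarrow> nat) \<Rightarrow> ((nat \<Rightarrow> nat) \<times> ((nat \<Rightarrow> nat) \<Rightarrow> 'k) \<times> (nat \<Rightarrow> nat)) list" where
  "cutpath [] f = []"
| "cutpath (m # ms) f = (std_vertex (f 0), free_gen R (restrict f {0..m}), std_vertex (f m)) # cutpath ms (\<lambda>i. f (m + i))"

text \<open>For the empty list the condition is not vacuous: it asks for the final vertex, so that
  the vector at an empty necklace also sits at a vertex of \<open>K\<close>.\<close>

fun beads_in :: "nat list \<Rightarrow> (nat \<Rightarrow> nat) \<Rightarrow> bool" where
  "beads_in [] f \<longleftrightarrow> std_vertex (f 0) \<in> tverts F"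
| "beads_in (m # ms) f \<longleftrightarrow> restrict f {0..m} \<in> ssimp K m \<and> beads_in ms (\<lambda>i. f (m + i))"

lemma cutpath_cong: "(\<And>i. i \<le> sum_list ms \<Longrightarrow> f i = g i) \<Longrightarrow> cutpath ms f = cutpath ms g"
proof (induction ms arbitrary: f g)
  case (Cons m ms)
  have "restrict f {0..m} = restrict g {0..m}" using Cons.prems by (auto simp: fun_eq_iff)
  then show ?case using Cons.prems Cons.IH[of "\<lambda>i. f (m + i)" "\<lambda>i. g (m + i)"] by simp
qed simp

lemma beads_in_cong: "(\<And>i. i \<le> sum_list ms \<Longrightarrow> f i = g i) \<Longrightarrow> beads_in ms f \<longleftrightarrow> beads_in ms g"
proof (induction ms arbitrary: f g)
  case (Cons m ms)
  have "restrict f {0..m} = restrict g {0..m}" using Cons.prems by (auto simp: fun_eq_iff)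
  then show ?case using Cons.prems Cons.IH[of "\<lambda>i. f (m + i)" "\<lambda>i. g (m + i)"] by simp
qed simp

lemma cutpath_append: "cutpath (ms @ ls) f = cutpath ms f @ cutpath ls (\<lambda>i. f (sum_list ms + i))"
  by (induction ms arbitrary: f) (simp_all add: add.assoc)

lemma beads_in_vertex: "beads_in ms f \<Longrightarrow> std_vertex (f 0) \<in> tverts F"
  using vertex_mem[of "restrict f {0.._}" _ 0] by (cases ms) auto

lemma beads_in_single: "beads_in [m] f \<longleftrightarrow> restrict f {0..m} \<in> ssimp K m"
  using vertex_mem[of "restrict f {0..m}" m m] by auto

lemma bead_simplex: "restrict f {0..m} \<in> ssimp K m \<Longrightarrow> restrict f {0..m} \<in> simplices m (std_vertex (f 0)) (std_vertex (f m))"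
  by (simp add: simplices_def)

lemma cutpath_path:
  "beads_in ms f \<Longrightarrow> cutpath ms f \<in> qpaths (tverts F) (map (tsimp F) ms) (std_vertex (f 0)) (std_vertex (f (sum_list ms)))"
proof (induction ms arbitrary: f)
  case (Cons m ms)
  have r: "restrict f {0..m} \<in> ssimp K m" and t: "beads_in ms (\<lambda>i. f (m + i))" using Cons.prems by auto
  have v: "std_vertex (f 0) \<in> tverts F" "std_vertex (f m) \<in> tverts F"
    using vertex_mem[OF r, of 0] vertex_mem[OF r, of m] by simp_all
  show ?case
    unfolding cutpath.simps list.map qpaths_Cons_iff
    using Cons.IH[OF t] v F_gen[OF bead_simplex[OF r]] by simp
qed simp

lemma bead_restrict: "\<lbrakk>restrict f {0..m} \<in> ssimp K m; l \<le> m\<rbrakk> \<Longrightarrow> restrict f {0..l} \<in> ssimp K l"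
  using K_restrict[of "restrict f {0..m}" m l] by (simp add: Int_absorb1)

lemma bead_tail: "restrict f {0..p + q} \<in> ssimp K (p + q) \<Longrightarrow> (\<lambda>i\<in>{0..q}. f (p + i)) \<in> ssimp K q"
  using K_tail[of "restrict f {0..p + q}" p q] by (simp cong: restrict_cong)

text \<open>The basis element that belongs to \<open>f\<close>. Its end vertices are taken from
  \<open>f\<close> too, so that \<open>f\<close> and the gaps are its only parameters.\<close>

definition bvec where
  "bvec ms f = ptens R (tverts F) (map (tsimp F) ms) (std_vertex (f 0)) (std_vertex (f (sum_list ms))) (cutpath ms f)"

lemma bvec_cong: "(\<And>i. i \<le> sum_list ms \<Longrightarrow> f i = g i) \<Longrightarrow> bvec ms f = bvec ms g"
  unfolding bvec_def using cutpath_cong[of ms f g] by simp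

lemma bvec_closed: "beads_in ms f \<Longrightarrow>
    bvec ms f \<in> carrier (qtens R (tverts F) (map (tsimp F) ms) (std_vertex (f 0)) (std_vertex (f (sum_list ms))))"
  unfolding bvec_def using ptens_closed[OF module_quivers_objs] cutpath_path by simp

lemma bvec_append:
  assumes "beads_in ms f" "beads_in ls (\<lambda>i. f (sum_list ms + i))"
  shows "qcat R (tverts F) (map (tsimp F) ms) (map (tsimp F) ls) (std_vertex (f 0)) (std_vertex (f (sum_list ms + sum_list ls)))
      (bvec ms f) (bvec ls (\<lambda>i. f (sum_list ms + i))) = bvec (ms @ ls) f"
  using qcat_ptens[OF module_quivers_objs module_quivers_objs] cutpath_path[OF assms(1)] cutpath_path[OF assms(2)]
  by (simp add: bvec_def cutpath_append)

lemma tensor_bvec: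
  assumes g: "linear_arr R (tverts F) g" "qdom g = map (tsimp F) ms" and h: "linear_arr R (tverts F) h" "qdom h = map (tsimp F) ls"
    and "beads_in ms f" "beads_in ls (\<lambda>i. f (sum_list ms + i))"
    and b: "b = std_vertex (f (sum_list ms + sum_list ls))" and c: "c = std_vertex (f (sum_list ms))"
  shows "qfun (qtensor R (tverts F) g h) (std_vertex (f 0)) b (bvec (ms @ ls) f)
    = qcat R (tverts F) (qcod g) (qcod h) (std_vertex (f 0)) b
       (qfun g (std_vertex (f 0)) c (bvec ms f)) (qfun h c b (bvec ls (\<lambda>i. f (sum_list ms + i))))"
proof -
  note p1 = cutpath_path[OF assms(5)] and p2 = cutpath_path[OF assms(6)]
  have a: "std_vertex (f 0) \<in> tverts F" using beads_in_vertex[OF assms(5)] by simp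
  have c': "std_vertex (f (sum_list ms)) \<in> tverts F" using qpaths_end_mem[OF p1] a by simp
  have b': "b \<in> tverts F" using qpaths_end_mem[OF p2] c' by (simp add: b)
  show ?thesis
    using qtensor_ptens[OF g(1) h(1) a b', of "cutpath ms f" c "cutpath ls (\<lambda>i. f (sum_list ms + i))"] p1 p2
    by (simp add: g h b c bvec_def cutpath_append)
qed

lemma qwrap_gen: "x \<in> ssimp K m \<Longrightarrow>
    qwrap R (tverts F) (tsimp F m) (std_vertex (x 0)) (std_vertex (x m)) (free_gen R x) = bvec [m] x"
proof -
  assume "x \<in> ssimp K m"
  then have "restrict x {0..m} = x" using K_mono[of m] mono_mapsD(3)[of x m n] by (auto simp: fun_eq_iff)
  then show ?thesis by (simp add: qwrap_def bvec_def)
qed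

lemma qunwrap_bvec:
  assumes x: "x \<in> ssimp K m"
  shows "qunwrap R (tverts F) (tsimp F m) (std_vertex (x 0)) (std_vertex (x m)) (bvec [m] x) = free_gen R x"
  using qunwrap_qwrap[of "tsimp F m" "std_vertex (x 0)" "std_vertex (x m)" "free_gen R x", OF F_module] vertex_mem[OF x, of 0]
    vertex_mem[OF x, of m] F_gen[of x m "std_vertex (x 0)" "std_vertex (x m)"] x
  by (simp add: qwrap_gen simplices_def)

lemma bvec_single_restrict: "bvec [m] (restrict f {0..m}) = bvec [m] f"
  by (intro bvec_cong) simp

text \<open>The comultiplication restricts a simplex to its front and back parts, so iterating it
  cuts \<open>f\<close> at the partial sums of \<open>ms\<close>. Membership of the beads in
  \<open>K\<close> is carried along because concatenation with the tail depends on it.\<close>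

lemma iterated_comult_bvec:
  assumes "restrict f {0..sum_list ms} \<in> ssimp K (sum_list ms)"
  shows "qfun (iterated_comult R F ms) (std_vertex (f 0)) (std_vertex (f (sum_list ms))) (bvec [sum_list ms] f) = bvec ms f
    \<and> beads_in ms f"
  using assms
proof (induction ms arbitrary: f rule: induct_list012)
  case 1
  have r0: "restrict f {0..0} = std_vertex (f 0)" by (auto simp: std_vertex_def fun_eq_iff)
  have "restrict f {0..0} \<in> ssimp K 0" using 1 by (simp only: sum_list.Nil)
  then have v: "std_vertex (f 0) \<in> tverts F" "std_vertex (f 0) \<in> ssimp K 0" unfolding r0 F_verts by blast+
  have "qunwrap R (tverts F) (tsimp F 0) (std_vertex (f 0)) (std_vertex (f 0)) (bvec [0] f) = free_gen R (std_vertex (f 0))"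
    using qunwrap_bvec[OF v(2)] bvec_single_restrict[of 0 f, unfolded r0] by (simp add: std_vertex_def)
  then show ?case using F_counit_gen[OF v(1)] v by (simp add: counit_arr_def bvec_def)
next
  case (2 m)
  then have "restrict f {0..m} \<in> ssimp K m" by (simp only: sum_list.Cons sum_list.Nil add_0_right)
  then show ?case using beads_in_single[of m f] by simp
next
  case (3 m l ms)
  let ?s = "sum_list (l # ms)" and ?t = "\<lambda>i. f (m + i)"
  have r: "restrict f {0..m + ?s} \<in> ssimp K (m + ?s)" using 3(3) by (simp only: sum_list.Cons)
  have r1: "restrict f {0..m} \<in> ssimp K m" by (rule bead_restrict[OF r]) simp
  have r2: "restrict ?t {0..?s} \<in> ssimp K ?s" by (rule bead_tail[OF r])
  note IH = 3(2)[OF r2]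
  let ?a = "std_vertex (f 0)" and ?b = "std_vertex (f (m + ?s))"
  have x: "restrict f {0..m + ?s} \<in> simplices (m + ?s) ?a ?b" using r by (simp add: simplices_def)
  have "qunwrap R (tverts F) (tsimp F (m + ?s)) ?a ?b (bvec [m + ?s] f) = free_gen R (restrict f {0..m + ?s})"
    using qunwrap_bvec[OF r] bvec_single_restrict[of "m + ?s" f] by simp
  then have "qfun (comult_arr R F m ?s) ?a ?b (bvec [m + ?s] f) = tcomult F m ?s ?a ?b (free_gen R (restrict f {0..m + ?s}))"
    by (simp add: comult_arr_def)
  also have "\<dots> = bvec [m, ?s] f"
  proof -
    have e: "restrict (restrict f {0..m + ?s}) {0..m} = restrict f {0..m}"
      "(\<lambda>i\<in>{0..?s}. restrict f {0..m + ?s} (m + i)) = restrict ?t {0..?s}" by (auto simp: fun_eq_iff)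
    show ?thesis
      unfolding F_comult
    proof (subst free_lift_gen[OF qtens_module[OF F_mq]])
      from ptens_closed[OF F_mq comult_path[OF x]]
      show "ptens R (tverts F) [tsimp F m, tsimp F ?s] ?a ?b
        [(?a, free_gen R (restrict (restrict f {0..m + ?s}) {0..m}), std_vertex (restrict f {0..m + ?s} m)),
         (std_vertex (restrict f {0..m + ?s} m), free_gen R (\<lambda>i\<in>{0..?s}. restrict f {0..m + ?s} (m + i)), ?b)]
        \<in> carrier (qtens R (tverts F) [tsimp F m, tsimp F ?s] ?a ?b)" .
    qed (simp only: e, simp add: bvec_def)
  qed
  finally have c: "qfun (comult_arr R F m ?s) ?a ?b (bvec [m + ?s] f) = bvec [m, ?s] f" .
  have b1: "beads_in [m] f" by (rule iffD2[OF beads_in_single r1])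
  have b2: "beads_in [?s] ?t" by (rule iffD2[OF beads_in_single r2])
  have s1: "sum_list [m] = m" "sum_list [?s] = ?s" by simp_all
  note tb = tensor_bvec[of "id_arr F m" "[m]" "iterated_comult R F (l # ms)" "[?s]" f ?b "std_vertex (f m)", unfolded s1]
  note ba = bvec_append[of "[m]" f "l # ms", unfolded s1]
  have "qfun (qtensor R (tverts F) (id_arr F m) (iterated_comult R F (l # ms))) ?a ?b (bvec ([m] @ [?s]) f)
    = qcat R (tverts F) (map (tsimp F) [m]) (map (tsimp F) (l # ms)) ?a ?b (bvec [m] f) (bvec (l # ms) ?t)"
    using tb[OF lin_id _ lin_iterated_comult _ b1 b2] IH
    by (simp del: beads_in.simps sum_list.Cons iterated_comult.simps)
  also have "\<dots> = bvec ([m] @ (l # ms)) f"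
    using ba[OF b1] IH by blast
  finally have "qfun (iterated_comult R F (m # l # ms)) ?a ?b (bvec [m + ?s] f) = bvec (m # l # ms) f"
    using c by simp
  then show ?case using IH r1 by simp
qed

text \<open>Inert maps leave \<open>f\<close> as it is and only cut it at more points.\<close>

lemma inert_arr_bvec:
  assumes "(U, q) \<in> necklaces" "(T, q) \<in> necklaces" "U \<subseteq> T" "beads_in (gaps U) f"
  shows "qfun (inert_arr R F T U) (std_vertex (f 0)) (std_vertex (f q)) (bvec (gaps U) f) = bvec (gaps T) f
    \<and> beads_in (gaps T) f"
  using assms
proof (induction U q arbitrary: T f rule: necklace_induct)
  case zero
  then have "T = {0}" by (auto simp: necklaces_iff)
  then show ?case using zero by simp
next
  case (join m U q)
  have nT: "m \<in> T" using join.prems join.hyps by (auto simp: necklaces_iff)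
  note split = necklace_split(1,2)[OF join.prems(1) nT]
  let ?T0 = "{i \<in> T. i \<le> m}" and ?T' = "{i. m + i \<in> T}" and ?t = "\<lambda>i. f (m + i)"
  have sub: "U \<subseteq> ?T'" using join.prems(2) by auto
  have s: "sum_list (gaps ?T0) = m" "sum_list (gaps ?T') = q" "sum_list (gaps U) = q"
    using sum_list_gaps split join.hyps by auto
  note J = inert_arr_lin[OF join.hyps(2) split(2) sub]
  have b: "restrict f {0..m} \<in> ssimp K m" "beads_in (gaps U) ?t"
    using join.prems(3) by (simp_all add: gaps_insert[OF join.hyps(2,1)])
  note IH = join.IH[OF split(2) sub b(2)]
  note I = iterated_comult_bvec[of f "gaps ?T0", unfolded s, OF b(1)]
  have "qfun (inert_arr R F T (insert 0 ((+) m ` U))) (std_vertex (f 0)) (std_vertex (f (m + q))) (bvec ([m] @ gaps U) f)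
    = qcat R (tverts F) (map (tsimp F) (gaps ?T0)) (map (tsimp F) (gaps ?T')) (std_vertex (f 0)) (std_vertex (f (m + q)))
       (bvec (gaps ?T0) f) (bvec (gaps ?T') ?t)"
    unfolding inert_arr_insert[OF join.hyps(2,1)]
    using tensor_bvec[of "iterated_comult R F (gaps ?T0)" "[m]" "inert_arr R F ?T' U" "gaps U" f "std_vertex (f (m + q))" "std_vertex (f m)"]
      J b beads_in_single[of m f] I IH by (simp add: s del: beads_in.simps)
  also have "\<dots> = bvec (gaps ?T0 @ gaps ?T') f"
    using bvec_append[of "gaps ?T0" f "gaps ?T'"] I IH by (simp add: s)
  finally have e: "qfun (inert_arr R F T (insert 0 ((+) m ` U))) (std_vertex (f 0)) (std_vertex (f (m + q))) (bvec (gaps (insert 0 ((+) m ` U))) f)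
    = bvec (gaps T) f"
    unfolding gaps_insert[OF join.hyps(2,1)] gaps_split[OF join.prems(1) nT] by simp
  have "beads_in (ms @ ls) f" if "beads_in ms f" "beads_in ls (\<lambda>i. f (sum_list ms + i))" for ms ls f
    using that by (induction ms arbitrary: f) (auto simp: add.assoc)
  from this[of "gaps ?T0" f "gaps ?T'"] show ?case
    unfolding gaps_split[OF join.prems(1) nT] using I IH e[unfolded gaps_split[OF join.prems(1) nT]] by (simp add: s)
qed

lemma active_head_bvec:
  assumes g: "g \<in> fint_maps (m + p) q" and f: "restrict f {0..g m} \<in> ssimp K (g m)"
  shows "qfun (active_head m g) (std_vertex (f 0)) (std_vertex (f (g m))) (bvec (if g m = 0 then [] else [g m]) f)
      = bvec [m] (\<lambda>i. f (g i))"
    "beads_in [m] (\<lambda>i. f (g i))"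
proof -
  let ?x = "restrict f {0..g m}" and ?g = "restrict g {0..m}"
  have g1: "?g \<in> fint_maps m (g m)" by (rule fint_maps_split(1)[OF g])
  have gle: "g i \<le> g m" if "i \<le> m" for i using fint_mapsD(3)[OF g, of i m] that by simp
  have g0: "g 0 = 0" by (rule fint_mapsD(1)[OF g])
  have c: "compose {0..m} ?x ?g = restrict (\<lambda>i. f (g i)) {0..m}" using gle by (auto simp: compose_def fun_eq_iff)
  have x: "?x \<in> simplices (g m) (std_vertex (f 0)) (std_vertex (f (g m)))" using f by (simp add: simplices_def)
  have cx: "restrict (\<lambda>i. f (g i)) {0..m} \<in> simplices m (std_vertex (f 0)) (std_vertex (f (g m)))"
    using act_simplices[OF x g1] by (simp add: c)
  show "beads_in [m] (\<lambda>i. f (g i))" unfolding beads_in_single using cx by (simp add: simplices_def)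
  have u: "qunwrap R (tverts F) (tsimp F (g m)) (std_vertex (f 0)) (std_vertex (f (g m))) (bvec [g m] f) = free_gen R ?x"
    using qunwrap_bvec[OF f] bvec_single_restrict[of "g m" f] by simp
  have "qfun (act_arr R F m (g m) ?g) (std_vertex (f 0)) (std_vertex (f (g m))) (bvec [g m] f)
    = qwrap R (tverts F) (tsimp F m) (std_vertex (f 0)) (std_vertex (f (g m))) (free_gen R (restrict (\<lambda>i. f (g i)) {0..m}))"
    unfolding act_arr_def using u
    by (simp add: F_act, subst free_lift_gen[OF F_module]) (simp_all add: c F_gen[OF cx])
  also have "\<dots> = bvec [m] (\<lambda>i. f (g i))"
    using qwrap_gen[of "restrict (\<lambda>i. f (g i)) {0..m}" m] cx bvec_single_restrict[of m "\<lambda>i. f (g i)"]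
    by (simp add: simplices_def g0)
  finally have act: "qfun (act_arr R F m (g m) ?g) (std_vertex (f 0)) (std_vertex (f (g m))) (bvec [g m] f) = bvec [m] (\<lambda>i. f (g i))" .
  show "qfun (active_head m g) (std_vertex (f 0)) (std_vertex (f (g m))) (bvec (if g m = 0 then [] else [g m]) f)
      = bvec [m] (\<lambda>i. f (g i))"
  proof (cases "g m = 0")
    case False
    then show ?thesis using act by (simp add: active_head_def)
  next
    \<comment> \<open>For a collapsed bead the inverse counit turns the empty path at
      \<open>f 0\<close> into that vertex, of which the action then takes a degenerate
      simplex.\<close>
    case True
    have v: "std_vertex (f 0) \<in> tverts F" using vertex_mem[OF f, of 0] by simp
    have x0: "?x = std_vertex (f 0)" using True by (auto simp: std_vertex_def fun_eq_iff)
    have 1: "free_gen R (std_vertex (f 0)) \<in> carrier (tsimp F 0 (std_vertex (f 0)) (std_vertex (f 0)))"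
      using F_gen[OF x] x0 True by simp
    have "inv_into (carrier (tsimp F 0 (std_vertex (f 0)) (std_vertex (f 0)))) (tcounit F (std_vertex (f 0)) (std_vertex (f 0)))
        (bvec [] f) = free_gen R (std_vertex (f 0))"
      using bij_betw_inv_into_left[OF tcounit_bij[OF v v] 1] F_counit_gen[of "std_vertex (f 0)"] v
      by (simp add: bvec_def)
    then have "qfun (counit_inv_arr R F) (std_vertex (f 0)) (std_vertex (f 0)) (bvec [] f) = bvec [0] f"
      using qwrap_gen[of "std_vertex (f 0)" 0] v bvec_single_restrict[of 0 f] x0 True v[unfolded F_verts]
      by (simp add: counit_inv_arr_def std_vertex_def)
    then show ?thesis using act True by (simp add: active_head_def)
  qed
qed

lemma active_arr_bvec:
  assumes "(T, p) \<in> necklaces" "g \<in> fint_maps p q" "beads_in (gaps (g ` T)) f"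
  shows "qfun (active_arr R F T g) (std_vertex (f 0)) (std_vertex (f q)) (bvec (gaps (g ` T)) f) = bvec (gaps T) (\<lambda>i. f (g i))
    \<and> beads_in (gaps T) (\<lambda>i. f (g i))"
  using assms
proof (induction T p arbitrary: g q f rule: necklace_induct)
  case zero
  then show ?case using fint_mapsD(1,2)[OF zero(1)] by (simp add: bvec_def)
next
  case (join m T p)
  note g = join.prems(1)
  note s = fint_maps_split[OF g]
  let ?g = "tail_map m p g" and ?t = "\<lambda>i. f (g m + i)"
  have g0: "g 0 = 0" by (rule fint_mapsD(1)[OF g])
  have tg: "g m + ?g i = g (m + i)" if "i \<le> p" for i
    using fint_mapsD(3)[OF g, of m "m + i"] that by (simp add: tail_map_def)
  have neck: "(?g ` T, q - g m) \<in> necklaces" by (rule necklace_image[OF join.hyps(2) s(2)])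
  let ?h = "if g m = 0 then [] else [g m]"
  have gp: "gaps (g ` insert 0 ((+) m ` T)) = ?h @ gaps (?g ` T)"
  proof (cases "g m = 0")
    case True
    have "insert 0 (?g ` T) = ?g ` T" using neck by (auto simp: necklaces_iff)
    then show ?thesis using True unfolding fint_maps_image[OF g join.hyps(2)] by simp
  next
    case False
    then show ?thesis using gaps_insert[OF neck, of "g m"] unfolding fint_maps_image[OF g join.hyps(2)] by simp
  qed
  have bt: "beads_in (gaps (?g ` T)) ?t" and bh: "restrict f {0..g m} \<in> ssimp K (g m)" and bh': "beads_in ?h f"
  proof -
    have b: "beads_in (?h @ gaps (?g ` T)) f" using join.prems(2) unfolding gp .
    show t: "beads_in (gaps (?g ` T)) ?t" using b by (auto split: if_splits)
    show h: "restrict f {0..g m} \<in> ssimp K (g m)"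
    proof (cases "g m = 0")
      case True
      have "restrict f {0..0} = std_vertex (f 0)" by (auto simp: std_vertex_def fun_eq_iff)
      then show ?thesis using beads_in_vertex[OF t] True by (simp add: F_verts)
    qed (use b in simp)
    show "beads_in ?h f" using beads_in_vertex[OF t] h beads_in_single[of "g m" f] by (auto simp del: beads_in.simps(2))
  qed
  have sums: "sum_list ?h = g m" "sum_list (gaps (?g ` T)) = q - g m" "sum_list (gaps T) = p"
    using sum_list_gaps[OF neck] sum_list_gaps[OF join.hyps(2)] by auto
  have q: "g m + (q - g m) = q" using s(3) by simp
  have fg: "f (g (m + i)) = ?t (?g i)" if "i \<le> p" for i using tg[OF that] by simp
  note hd = active_head_bvec[OF g bh]
  note IH = join.IH[OF s(2) bt]
  have tl: "bvec (gaps T) (\<lambda>i. f (g (m + i))) = bvec (gaps T) (\<lambda>i. ?t (?g i))"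
    "beads_in (gaps T) (\<lambda>i. f (g (m + i))) = beads_in (gaps T) (\<lambda>i. ?t (?g i))"
    using fg sums(3) by (auto intro!: bvec_cong beads_in_cong)
  have ain: "bvec (?h @ gaps (?g ` T)) f \<in> carrier (qtens R (tverts F) (map (tsimp F) (gaps (g ` insert 0 ((+) m ` T)))) (std_vertex (f 0)) (std_vertex (f q)))"
    using bvec_closed[OF join.prems(2)] unfolding gp by (simp add: sums q del: sum_list.Cons)
  have va: "std_vertex (f 0) \<in> tverts F" using beads_in_vertex[OF join.prems(2)] by simp
  have vb: "std_vertex (f q) \<in> tverts F"
    using qpaths_end_mem[OF cutpath_path[OF bt]] beads_in_vertex[OF bt] by (simp add: sums q)
  have "qfun (active_arr R F (insert 0 ((+) m ` T)) g) (std_vertex (f 0)) (std_vertex (f q)) (bvec (?h @ gaps (?g ` T)) f)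
    = qfun (qtensor R (tverts F) (active_head m g) (active_arr R F T ?g)) (std_vertex (f 0)) (std_vertex (f q)) (bvec (?h @ gaps (?g ` T)) f)"
    using qarr_eqD[OF active_arr_insert[OF join.hyps(2,1) g] va vb] ain
      active_arr_lin(2)[OF necklace_insert[OF join.hyps(2)] g] by simp
  also have "\<dots> = qcat R (tverts F) (map (tsimp F) [m]) (map (tsimp F) (gaps T)) (std_vertex (f 0)) (std_vertex (f q))
      (bvec [m] (\<lambda>i. f (g i))) (bvec (gaps T) (\<lambda>i. f (g (m + i))))"
    using tensor_bvec[of "active_head m g" ?h "active_arr R F T ?g" "gaps (?g ` T)" f "std_vertex (f q)" "std_vertex (f (g m))"]
      active_head_lin[OF g] active_arr_lin[OF join.hyps(2) s(2)] bt bh' hd(1) IH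
    unfolding sums q tl by simp
  also have "\<dots> = bvec ([m] @ gaps T) (\<lambda>i. f (g i))"
  proof -
    have "sum_list [m] + sum_list (gaps T) = m + p" by (simp add: sums)
    then show ?thesis
      using bvec_append[of "[m]" "\<lambda>i. f (g i)" "gaps T"] hd(2) IH tl g0 fint_mapsD(2)[OF g] by simp
  qed
  finally have "qfun (active_arr R F (insert 0 ((+) m ` T)) g) (std_vertex (f 0)) (std_vertex (f q)) (bvec (gaps (g ` insert 0 ((+) m ` T))) f)
    = bvec (gaps (insert 0 ((+) m ` T))) (\<lambda>i. f (g i))"
    unfolding gp gaps_insert[OF join.hyps(2,1)] by simp
  moreover have "beads_in (gaps (insert 0 ((+) m ` T))) (\<lambda>i. f (g i))"
    unfolding gaps_insert[OF join.hyps(2,1)] using hd(2) IH tl by simp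
  ultimately show ?case by blast
qed

text \<open>On basis vectors the action is precomposition and never leaves the basis, so naturality
  can be checked one map at a time.\<close>

lemma nm_bvec:
  assumes T: "(T, p) \<in> necklaces" and U: "(U, q) \<in> necklaces" and g: "g \<in> necklace_maps (T, p) (U, q)"
    and f: "beads_in (gaps U) f"
  shows "nmap (necklace_functor R F (std_vertex (f 0)) (std_vertex (f q))) (T, p) (U, q) g (bvec (gaps U) f) = bvec (gaps T) (compose {0..p} f g)"
    and "beads_in (gaps T) (compose {0..p} f g)"
proof -
  have g': "g \<in> fint_maps p q" "U \<subseteq> g ` T" using g by (auto simp: necklace_maps_def)
  note i = inert_arr_bvec[OF U necklace_image[OF T g'(1)] g'(2) f]
  note a = active_arr_bvec[OF T g'(1), of f]
  have c: "compose {0..p} f g i = f (g i)" if "i \<le> sum_list (gaps T)" for i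
    using that sum_list_gaps[OF T] by (simp add: compose_def)
  show "nmap (necklace_functor R F (std_vertex (f 0)) (std_vertex (f q))) (T, p) (U, q) g (bvec (gaps U) f) = bvec (gaps T) (compose {0..p} f g)"
    using i a bvec_cong[OF c] by (simp add: necklace_functor_def)
  show "beads_in (gaps T) (compose {0..p} f g)"
    using i a beads_in_cong[OF c] by simp
qed

end

lemma multilinear_plus:
  assumes N: "module R N" and \<phi>: "multilinear R S Qs a b N \<phi>" and \<psi>: "multilinear R S Qs a b N \<psi>"
  shows "multilinear R S Qs a b N (\<lambda>xs. \<phi> xs \<oplus>\<^bsub>N\<^esub> \<psi> xs)"
proof -
  interpret N: module R N by (rule N)
  note c = multilinear_closed[OF \<phi>] multilinear_closed[OF \<psi>]
  show ?thesis
    unfolding multilinear_def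
    by (simp add: multilinear_add[OF \<phi>] multilinear_add[OF \<psi>] multilinear_smult[OF \<phi>] multilinear_smult[OF \<psi>]
        c N.smult_r_distr N.M.add.m_ac)
qed

lemma multilinear_zero: "module R N \<Longrightarrow> multilinear R S Qs a b N (\<lambda>_. \<zero>\<^bsub>N\<^esub>)"
proof -
  assume "module R N"
  then interpret N: module R N .
  show ?thesis by (simp add: multilinear_def)
qed

lemma multilinear_finsum:
  assumes N: "module R N" and Qs: "module_quivers R S Qs" and "finite A"
    and "\<And>i. i \<in> A \<Longrightarrow> multilinear R S Qs a b N (\<phi> i)"
  shows "multilinear R S Qs a b N (\<lambda>xs. \<Oplus>\<^bsub>N\<^esub>i\<in>A. \<phi> i xs)"
  using assms(3,4)
proof (induction A rule: finite_induct)
  interpret N: module R N by (rule N)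
  case empty
  then show ?case using multilinear_zero[OF N] by simp
next
  interpret N: module R N by (rule N)
  case (insert i A)
  show ?case
  proof (rule multilinear_cong[OF Qs])
    show "multilinear R S Qs a b N (\<lambda>xs. \<phi> i xs \<oplus>\<^bsub>N\<^esub> (\<Oplus>\<^bsub>N\<^esub>i\<in>A. \<phi> i xs))"
      using insert by (intro multilinear_plus[OF N]) auto
    fix xs assume xs: "xs \<in> qpaths S Qs a b"
    show "(\<Oplus>\<^bsub>N\<^esub>i\<in>insert i A. \<phi> i xs) = \<phi> i xs \<oplus>\<^bsub>N\<^esub> (\<Oplus>\<^bsub>N\<^esub>i\<in>A. \<phi> i xs)"
      using insert.hyps multilinear_closed[OF insert.prems xs]
      by (intro N.M.finsum_insert) auto
  qed
qed

section \<open>Freeness of the necklace modules on their beaded maps\<close>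

context simplex_part
begin

text \<open>The first vector of a path is expanded in generators, the others are handled by
  induction. A generator and a beaded map for the remaining gaps glue to one beaded map.\<close>

lemma multilinear_cutpath_ext:
  assumes N: "module R N" and "a \<in> tverts F"
    and "multilinear R (tverts F) (map (tsimp F) ms) a b N \<phi>"
    and "multilinear R (tverts F) (map (tsimp F) ms) a b N \<psi>"
    and "\<And>f. \<lbrakk>beads_in ms f; std_vertex (f 0) = a; std_vertex (f (sum_list ms)) = b\<rbrakk>
      \<Longrightarrow> \<phi> (cutpath ms f) = \<psi> (cutpath ms f)"
    and "xs \<in> qpaths (tverts F) (map (tsimp F) ms) a b"
  shows "\<phi> xs = \<psi> xs"
  using assms(2-)
proof (induction ms arbitrary: a \<phi> \<psi> xs)
  case Nil
  then have "xs = []" "a = b" by auto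
  \<comment> \<open>For the empty list a map contributes only its starting vertex, so the constant
    map with value \<open>a 0\<close> serves.\<close>
  then show ?case using Nil.prems(4)[of "\<lambda>_. a 0"] vertex_eq[OF Nil.prems(1)] Nil.prems(1) by simp
next
  case (Cons m ms)
  obtain u c ys where xs: "xs = (a, u, c) # ys" "c \<in> tverts F" "u \<in> carrier (tsimp F m a c)"
    "ys \<in> qpaths (tverts F) (map (tsimp F) ms) c b"
    using Cons.prems(5) by auto
  note \<phi> = Cons.prems(2)[unfolded list.map] and \<psi> = Cons.prems(3)[unfolded list.map]
  have gen: "\<phi> ((a, free_gen R x, c) # ys) = \<psi> ((a, free_gen R x, c) # ys)" if x: "x \<in> simplices m a c" for x
  proof (rule Cons.IH[OF xs(2) multilinear_tail[OF \<phi> Cons.prems(1) xs(2), OF F_gen[OF x]]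
        multilinear_tail[OF \<psi> Cons.prems(1) xs(2), OF F_gen[OF x]] _ xs(4)])
    fix f assume f: "beads_in ms f" "std_vertex (f 0) = c" "std_vertex (f (sum_list ms)) = b"
    \<comment> \<open>The glued map. The shared vertex \<open>c\<close> gives
      \<open>x m = f 0\<close>, so the two parts agree where they meet.\<close>
    let ?h = "\<lambda>i. if i \<le> m then x i else f (i - m)"
    have x': "x \<in> ssimp K m" "std_vertex (x 0) = a" "std_vertex (x m) = c" using x by (auto simp: simplices_def)
    have r: "restrict ?h {0..m} = x"
      using K_mono[of m] mono_mapsD(3)[of x m n] x'(1) by (auto simp: fun_eq_iff)
    have xm: "x m = f 0" using x'(3) f(2) std_vertex_inject by metis
    have h: "?h (m + i) = f i" for i using xm by (cases i) auto
    have t: "(\<lambda>i. ?h (m + i)) = f" using h by (rule ext)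
    have h0: "?h 0 = x 0" "?h m = x m" by simp_all
    have cut: "cutpath (m # ms) ?h = (a, free_gen R x, c) # cutpath ms f"
      unfolding cutpath.simps r t h0 x'(2,3) ..
    have "beads_in (m # ms) ?h" unfolding beads_in.simps r t using x'(1) f(1) by blast
    moreover have "std_vertex (?h 0) = a" unfolding h0 by (rule x'(2))
    moreover have "std_vertex (?h (sum_list (m # ms))) = b" unfolding sum_list.Cons h by (rule f(3))
    ultimately have "\<phi> (cutpath (m # ms) ?h) = \<psi> (cutpath (m # ms) ?h)" by (rule Cons.prems(4))
    then show "\<phi> ((a, free_gen R x, c) # cutpath ms f) = \<psi> ((a, free_gen R x, c) # cutpath ms f)"
      unfolding cut .
  qed
  have "\<phi> ((a, u, c) # ys) = \<psi> ((a, u, c) # ys)"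
    by (rule free_module_ext[OF N multilinear_head[OF \<phi> Cons.prems(1) xs(2,4), unfolded F_simp]
          multilinear_head[OF \<psi> Cons.prems(1) xs(2,4), unfolded F_simp] gen xs(3)[unfolded F_simp]])
  then show ?case by (simp add: xs(1))
qed

lemma beads_in_mono:
  "\<lbrakk>beads_in ms f; i \<le> j; j \<le> sum_list ms\<rbrakk> \<Longrightarrow> f i \<le> f j"
proof (induction ms arbitrary: f i j)
  case (Cons m ms)
  have head: "f k \<le> f l" if "k \<le> l" "l \<le> m" for k l
    using Cons.prems(1) K_mono[of m] mono_mapsD(1)[of "restrict f {0..m}" m n k l] that by auto
  have tail: "f k \<le> f l" if "m \<le> k" "k \<le> l" "l \<le> m + sum_list ms" for k l
    using Cons.IH[of "\<lambda>i. f (m + i)" "k - m" "l - m"] Cons.prems(1) that by auto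
  show ?case
    using Cons.prems(2,3) head[of i j] tail[of i j] head[of i m] tail[of m j]
    by (cases "j \<le> m"; cases "m \<le> i") auto
qed simp

text \<open>The maps in \<open>multilinear_cutpath_ext\<close> are arbitrary beyond
  \<open>p\<close>. Restricted to \<open>{0..p}\<close> they belong to \<open>fint_maps p n\<close>:
  monotonicity comes from the beads, and the end values from the vertices 0 and
  \<open>n\<close>.\<close>

lemma necklace_ext:
  assumes N: "module R N" and T: "(T, p) \<in> necklaces" and v: "std_vertex 0 \<in> tverts F"
    and \<phi>: "\<phi> \<in> linear_maps R (nobj (necklace_functor R F (std_vertex 0) (std_vertex n)) (T, p)) N"
    and \<psi>: "\<psi> \<in> linear_maps R (nobj (necklace_functor R F (std_vertex 0) (std_vertex n)) (T, p)) N"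
    and eq: "\<And>f. \<lbrakk>f \<in> fint_maps p n; beads_in (gaps T) f\<rbrakk> \<Longrightarrow> \<phi> (bvec (gaps T) f) = \<psi> (bvec (gaps T) f)"
    and u: "u \<in> carrier (nobj (necklace_functor R F (std_vertex 0) (std_vertex n)) (T, p))"
  shows "\<phi> u = \<psi> u"
proof -
  have o: "nobj (necklace_functor R F (std_vertex 0) (std_vertex n)) (T, p)
    = qtens R (tverts F) (map (tsimp F) (gaps T)) (std_vertex 0) (std_vertex n)"
    by (simp add: necklace_functor_def)
  note sum = sum_list_gaps[OF T]
  let ?p = "ptens R (tverts F) (map (tsimp F) (gaps T)) (std_vertex 0) (std_vertex n)"
  note pm = ptens_multilinear[OF module_quivers_objs]
  have "\<phi> (?p xs) = \<psi> (?p xs)" if "xs \<in> qpaths (tverts F) (map (tsimp F) (gaps T)) (std_vertex 0) (std_vertex n)" for xs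
  proof (rule multilinear_cutpath_ext[OF N v multilinear_comp[OF pm \<phi>[unfolded o]] multilinear_comp[OF pm \<psi>[unfolded o]] _ that])
    fix f assume f: "beads_in (gaps T) f" "std_vertex (f 0) = std_vertex 0" "std_vertex (f (sum_list (gaps T))) = std_vertex n"
    let ?f = "restrict f {0..p}"
    have c: "?f i = f i" if "i \<le> sum_list (gaps T)" for i using that sum by simp
    have f0: "f 0 = 0" "f p = n" using f(2,3) by (simp_all add: sum)
    have "?f \<in> fint_maps p n"
      using beads_in_mono[OF f(1)] f0 by (intro fint_mapsI) (auto simp: sum)
    moreover have "beads_in (gaps T) ?f" using f(1) beads_in_cong[of "gaps T" ?f f, OF c] by simp
    ultimately have "\<phi> (bvec (gaps T) ?f) = \<psi> (bvec (gaps T) ?f)" by (rule eq)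
    then show "\<phi> (?p (cutpath (gaps T) f)) = \<psi> (?p (cutpath (gaps T) f))"
      using bvec_cong[of "gaps T" ?f f, OF c] by (simp add: bvec_def f0 sum)
  qed
  then show ?thesis
    by (rule qtens_ext[OF module_quivers_objs N \<phi>[unfolded o] \<psi>[unfolded o] _ u[unfolded o]])
qed

text \<open>The coordinate at \<open>f\<close> as a function on paths, namely the product of the
  coordinates at its beads. The vertices stored in the path are not consulted.\<close>

fun coef :: "nat list \<Rightarrow> ((nat \<Rightarrow> nat) \<times> ((nat \<Rightarrow> nat) \<Rightarrow> 'k) \<times> (nat \<Rightarrow> nat)) list \<Rightarrow> (nat \<Rightarrow> nat) \<Rightarrow> 'k" where
  "coef [] xs f = \<one>"
| "coef (m # ms) xs f = fst (snd (hd xs)) (restrict f {0..m}) \<otimes> coef ms (tl xs) (\<lambda>i. f (m + i))"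

lemma coef_closed: "xs \<in> qpaths (tverts F) (map (tsimp F) ms) a b \<Longrightarrow> coef ms xs f \<in> carrier R"
proof (induction ms arbitrary: a xs f)
  case (Cons m ms)
  then obtain u c ys where xs: "xs = (a, u, c) # ys" "u \<in> carrier (tsimp F m a c)"
    "ys \<in> qpaths (tverts F) (map (tsimp F) ms) c b" by auto
  have "u (restrict f {0..m}) \<in> carrier R" using xs(2) by (simp add: F_simp free_module_def)
  with Cons.IH[OF xs(3)] show ?case by (simp add: xs(1))
qed simp

text \<open>In the induction the coordinate of the first bead is moved into \<open>z\<close>, so
  \<open>z\<close> has to be arbitrary.\<close>

lemma coef_multilinear:
  assumes N: "module R N" and "z \<in> carrier N" "a \<in> tverts F"
  shows "multilinear R (tverts F) (map (tsimp F) ms) a b N (\<lambda>xs. coef ms xs f \<odot>\<^bsub>N\<^esub> z)"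
  using assms(2,3)
proof (induction ms arbitrary: a z f)
  interpret N: module R N by (rule N)
  case Nil
  then show ?case by (simp add: multilinear_Nil)
next
  interpret N: module R N by (rule N)
  case (Cons m ms)
  show ?case unfolding list.map
  proof (rule multilinear_ConsI)
    fix c xs assume c: "c \<in> tverts F" and xs: "xs \<in> qpaths (tverts F) (map (tsimp F) ms) c b"
    note k = coef_closed[OF xs, of "\<lambda>i. f (m + i)"]
    show "(\<lambda>x. coef (m # ms) ((a, x, c) # xs) f \<odot>\<^bsub>N\<^esub> z) \<in> linear_maps R (tsimp F m a c) N"
      using k Cons.prems(1)
      by (intro linear_mapsI) (auto simp: F_simp free_module_def l_distr N.smult_l_distr m_assoc N.smult_assoc1)
  next
    fix c x assume c: "c \<in> tverts F" and x: "x \<in> carrier (tsimp F m a c)"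
    have xr: "x (restrict f {0..m}) \<in> carrier R" using x by (simp add: F_simp free_module_def)
    show "multilinear R (tverts F) (map (tsimp F) ms) c b N (\<lambda>xs. coef (m # ms) ((a, x, c) # xs) f \<odot>\<^bsub>N\<^esub> z)"
    proof (rule multilinear_cong[OF module_quivers_objs])
      show "multilinear R (tverts F) (map (tsimp F) ms) c b N
          (\<lambda>xs. coef ms xs (\<lambda>i. f (m + i)) \<odot>\<^bsub>N\<^esub> (x (restrict f {0..m}) \<odot>\<^bsub>N\<^esub> z))"
        using xr Cons.prems(1) c by (intro Cons.IH) auto
      fix xs assume "xs \<in> qpaths (tverts F) (map (tsimp F) ms) c b"
      from coef_closed[OF this, of "\<lambda>i. f (m + i)"]
      show "coef (m # ms) ((a, x, c) # xs) f \<odot>\<^bsub>N\<^esub> z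
          = coef ms xs (\<lambda>i. f (m + i)) \<odot>\<^bsub>N\<^esub> (x (restrict f {0..m}) \<odot>\<^bsub>N\<^esub> z)"
        using xr Cons.prems(1) by (simp add: N.smult_assoc1[symmetric] m_comm)
    qed
  qed
qed

lemma coef_cutpath_closed: "coef ms (cutpath ms g) f \<in> carrier R"
  by (induction ms arbitrary: f g) (simp_all add: free_gen_def)

text \<open>These coordinates are dual to the cut maps. The assumption on \<open>f 0\<close> decides
  the empty list, where there is no bead to compare and the product is 1.\<close>

lemma coef_cutpath:
  "f 0 = g 0 \<Longrightarrow> coef ms (cutpath ms g) f = (if \<forall>i\<le>sum_list ms. f i = g i then \<one> else \<zero>)"
proof (induction ms arbitrary: f g)
  case (Cons m ms)
  have r: "restrict f {0..m} = restrict g {0..m} \<longleftrightarrow> (\<forall>i\<le>m. f i = g i)"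
    by (auto simp: fun_eq_iff restrict_def)
  show ?case
  proof (cases "\<forall>i\<le>m. f i = g i")
    case True
    have "(\<forall>i\<le>m + sum_list ms. f i = g i) \<longleftrightarrow> (\<forall>i\<le>sum_list ms. f (m + i) = g (m + i))"
    proof
      assume *: "\<forall>i\<le>sum_list ms. f (m + i) = g (m + i)"
      show "\<forall>i\<le>m + sum_list ms. f i = g i"
      proof (intro allI impI)
        fix i assume "i \<le> m + sum_list ms"
        then show "f i = g i" using True *[rule_format, of "i - m"] by (cases "i \<le> m") auto
      qed
    qed auto
    then show ?thesis
      using Cons.IH[of "\<lambda>i. f (m + i)" "\<lambda>i. g (m + i)"] True r by (simp add: free_gen_def)
  next
    case False
    then have 1: "\<not> (\<forall>i\<le>sum_list (m # ms). f i = g i)" and 2: "restrict f {0..m} \<noteq> restrict g {0..m}"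
      using r trans_le_add1[of _ m "sum_list ms"] unfolding sum_list.Cons by blast+
    have "coef (m # ms) (cutpath (m # ms) g) f = \<zero>"
      using 2 coef_cutpath_closed by (simp add: free_gen_def)
    then show ?thesis unfolding if_not_P[OF 1] .
  qed
qed auto

text \<open>The map is the lift of the finite sum, over all \<open>f\<close>, of the coordinate at
  \<open>f\<close> times \<open>c f\<close>. At the basis vector of \<open>g\<close> duality leaves
  the term \<open>f = g\<close> alone.\<close>

lemma necklace_free:
  assumes N: "module R N" and T: "(T, p) \<in> necklaces" and v: "std_vertex 0 \<in> tverts F"
    and c: "\<And>f. f \<in> fint_maps p n \<Longrightarrow> c f \<in> carrier N"
  shows "\<exists>\<beta>\<in>linear_maps R (nobj (necklace_functor R F (std_vertex 0) (std_vertex n)) (T, p)) N.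
    \<forall>f\<in>fint_maps p n. beads_in (gaps T) f \<longrightarrow> \<beta> (bvec (gaps T) f) = c f"
proof -
  interpret N: module R N by (rule N)
  have o: "nobj (necklace_functor R F (std_vertex 0) (std_vertex n)) (T, p)
    = qtens R (tverts F) (map (tsimp F) (gaps T)) (std_vertex 0) (std_vertex n)"
    by (simp add: necklace_functor_def)
  note sum = sum_list_gaps[OF T]
  let ?\<phi> = "\<lambda>xs. \<Oplus>\<^bsub>N\<^esub>f\<in>fint_maps p n. coef (gaps T) xs f \<odot>\<^bsub>N\<^esub> c f"
  have m: "multilinear R (tverts F) (map (tsimp F) (gaps T)) (std_vertex 0) (std_vertex n) N ?\<phi>"
    by (intro multilinear_finsum[OF N module_quivers_objs finite_fint_maps] coef_multilinear[OF N] c v)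
  show ?thesis unfolding o
  proof (intro bexI ballI impI)
    show "qtens_lift R N ?\<phi> \<in> linear_maps R (qtens R (tverts F) (map (tsimp F) (gaps T)) (std_vertex 0) (std_vertex n)) N"
      by (rule qtens_lift_linear[OF module_quivers_objs N m])
    fix g assume g: "g \<in> fint_maps p n" "beads_in (gaps T) g"
    have ends: "g 0 = 0" "g p = n" using fint_mapsD[OF g(1)] by auto
    have "cutpath (gaps T) g \<in> qpaths (tverts F) (map (tsimp F) (gaps T)) (std_vertex 0) (std_vertex n)"
      using cutpath_path[OF g(2)] by (simp add: ends sum)
    then have "qtens_lift R N ?\<phi> (bvec (gaps T) g) = ?\<phi> (cutpath (gaps T) g)"
      using qtens_lift_ptens[OF module_quivers_objs N m] by (simp add: bvec_def ends sum)
    also have "\<dots> = (\<Oplus>\<^bsub>N\<^esub>f\<in>fint_maps p n. if g = f then c f else \<zero>\<^bsub>N\<^esub>)"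
    proof (rule N.M.finsum_cong')
      show "(\<lambda>f. if g = f then c f else \<zero>\<^bsub>N\<^esub>) \<in> fint_maps p n \<rightarrow> carrier N" using c by auto
      fix f assume f: "f \<in> fint_maps p n"
      have "(\<forall>i\<le>p. f i = g i) \<longleftrightarrow> g = f"
      proof
        assume "\<forall>i\<le>p. f i = g i"
        then show "g = f" using fint_mapsD(5)[OF f] fint_mapsD(5)[OF g(1)] by (metis ext not_le)
      qed simp
      then show "coef (gaps T) (cutpath (gaps T) g) f \<odot>\<^bsub>N\<^esub> c f = (if g = f then c f else \<zero>\<^bsub>N\<^esub>)"
        using coef_cutpath[of f g "gaps T"] fint_mapsD(1)[OF f] ends c[OF f] by (simp add: sum)
    qed simp
    also have "\<dots> = c g"
      using c by (intro N.M.finsum_singleton[OF g(1) finite_fint_maps]) auto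
    finally show "qtens_lift R N ?\<phi> (bvec (gaps T) g) = c g" .
  qed
qed

end

section \<open>The map induced by the inclusion of one subcomplex in another\<close>

locale simplex_parts = K: simplex_part R n K + L: simplex_part R n L
  for R :: "('k, 'z) ring_scheme" (structure) and n K L +
  assumes sub: "ssimp K m \<subseteq> ssimp L m"
begin

lemma simplices_sub: "K.simplices m a b \<subseteq> L.simplices m a b"
  using sub by (auto simp: K.simplices_def L.simplices_def)

lemma verts_sub: "tverts K.F \<subseteq> tverts L.F"
  using sub by (simp add: K.F_verts L.F_verts)

abbreviation incl where
  "incl m c d \<equiv> free_lift R (tsimp L.F m c d) (\<lambda>x. free_gen R x)"

lemma incl_linear: "incl m c d \<in> linear_maps R (tsimp K.F m c d) (tsimp L.F m c d)"
  unfolding K.F_simp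
  by (intro K.free_lift_linear L.F_module L.F_gen) (use simplices_sub in auto)

lemma incl_gen: "x \<in> K.simplices m c d \<Longrightarrow> incl m c d (free_gen R x) = free_gen R x"
  by (intro K.free_lift_gen L.F_module L.F_gen) (use simplices_sub in auto)

abbreviation incl_path where
  "incl_path ms xs \<equiv> map2 (\<lambda>m (c, u, d). (c, incl m c d u, d)) ms xs"

lemma incl_path_mem: "xs \<in> qpaths (tverts K.F) (map (tsimp K.F) ms) a b
    \<Longrightarrow> incl_path ms xs \<in> qpaths (tverts L.F) (map (tsimp L.F) ms) a b"
  using verts_sub
  by (induction ms arbitrary: a xs) (auto intro: linear_maps_closed[OF incl_linear])

text \<open>The inclusion is linear in each entry. Applied to \<open>ptens\<close> this shows that
  \<open>free_necklace_map\<close> is a legitimate lift.\<close>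

lemma incl_path_multilinear:
  assumes "multilinear R (tverts L.F) (map (tsimp L.F) ms) a b N \<phi>" "a \<in> tverts K.F"
  shows "multilinear R (tverts K.F) (map (tsimp K.F) ms) a b N (\<lambda>xs. \<phi> (incl_path ms xs))"
  using assms
proof (induction ms arbitrary: a \<phi>)
  case Nil
  then show ?case by (simp add: multilinear_Nil)
next
  case (Cons m ms)
  note \<phi> = Cons.prems(1)[unfolded list.map]
  have a: "a \<in> tverts L.F" using Cons.prems(2) verts_sub by auto
  show ?case unfolding list.map
  proof (rule multilinear_ConsI)
    fix c xs assume c: "c \<in> tverts K.F" and xs: "xs \<in> qpaths (tverts K.F) (map (tsimp K.F) ms) c b"
    have cL: "c \<in> tverts L.F" using c verts_sub by auto
    from linear_maps_comp[OF incl_linear multilinear_head[OF \<phi> a cL incl_path_mem[OF xs]]]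
    show "(\<lambda>x. \<phi> (incl_path (m # ms) ((a, x, c) # xs))) \<in> linear_maps R (tsimp K.F m a c) N" by simp
  next
    fix c x assume c: "c \<in> tverts K.F" and x: "x \<in> carrier (tsimp K.F m a c)"
    have cL: "c \<in> tverts L.F" using c verts_sub by auto
    from Cons.IH[OF multilinear_tail[OF \<phi> a cL, OF linear_maps_closed[OF incl_linear x]] c]
    show "multilinear R (tverts K.F) (map (tsimp K.F) ms) c b N (\<lambda>xs. \<phi> (incl_path (m # ms) ((a, x, c) # xs)))"
      by simp
  qed
qed

lemma incl_path_cutpath: "K.beads_in ms f \<Longrightarrow> incl_path ms (K.cutpath ms f) = K.cutpath ms f"
proof (induction ms arbitrary: f)
  case (Cons m ms)
  then show ?case using incl_gen[OF K.bead_simplex[of f m]] by simp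
qed simp

lemma beads_in_sub: "K.beads_in ms f \<Longrightarrow> L.beads_in ms f"
  using verts_sub sub by (induction ms arbitrary: f) auto

lemma necklace_map_linear:
  assumes "a \<in> tverts K.F"
  shows "free_necklace_map R L (\<lambda>m x. x) (T, p) a b \<in>
    linear_maps R (nobj (necklace_functor R K.F a b) (T, p)) (nobj (necklace_functor R L.F a b) (T, p))"
  using K.qtens_lift_linear[OF K.module_quivers_objs L.qtens_module[OF L.module_quivers_objs]
      incl_path_multilinear[OF L.ptens_multilinear[OF L.module_quivers_objs] assms], of "gaps T" b]
  by (simp add: free_necklace_map_def necklace_functor_def Let_def)

lemma necklace_map_bvec:
  assumes T: "(T, p) \<in> necklaces" and f: "K.beads_in (gaps T) f"
  shows "free_necklace_map R L (\<lambda>m x. x) (T, p) (std_vertex (f 0)) (std_vertex (f p)) (K.bvec (gaps T) f)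
    = L.bvec (gaps T) f"
proof -
  have a: "std_vertex (f 0) \<in> tverts K.F" using K.beads_in_vertex[OF f] .
  have "K.cutpath (gaps T) f \<in> qpaths (tverts K.F) (map (tsimp K.F) (gaps T)) (std_vertex (f 0)) (std_vertex (f p))"
    using K.cutpath_path[OF f] by (simp add: sum_list_gaps[OF T])
  from K.qtens_lift_ptens[OF K.module_quivers_objs L.qtens_module[OF L.module_quivers_objs]
      incl_path_multilinear[OF L.ptens_multilinear[OF L.module_quivers_objs] a] this]
  show ?thesis
    by (simp add: free_necklace_map_def Let_def K.bvec_def L.bvec_def sum_list_gaps[OF T] incl_path_cutpath[OF f])
qed

end

section \<open>Lifting inner horns\<close>

lemma std_simplex_simps [simp]:
  "ssimp (std_simplex n) m = mono_maps m n" "sact (std_simplex n) l m f x = compose {0..l} x f"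
  by (simp_all add: std_simplex_def)

lemma horn_simps:
  "x \<in> ssimp (horn n j) m \<longleftrightarrow> x \<in> mono_maps m n \<and> (\<exists>i\<le>n. i \<noteq> j \<and> i \<notin> x ` {0..m})"
  "sact (horn n j) l m f x = compose {0..l} x f"
  by (auto simp: horn_def std_simplex_def)

lemma mono_maps_compose: "\<lbrakk>x \<in> mono_maps m n; f \<in> mono_maps l m\<rbrakk> \<Longrightarrow> compose {0..l} x f \<in> mono_maps l n"
  using mono_mapsD[of x m n] mono_mapsD[of f l m] by (intro mono_mapsI) (auto simp: compose_def)

lemma simplex_parts_horn:
  assumes "cring R"
  shows "simplex_parts R n (horn n j) (std_simplex n)"
proof -
  interpret cring R by fact
  have h: "simplex_part R n (horn n j)"
  proof (unfold_locales)
    fix x m f l assume x: "x \<in> ssimp (horn n j) m" and f: "f \<in> mono_maps l m"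
    then obtain i where i: "i \<le> n" "i \<noteq> j" "i \<notin> x ` {0..m}" by (auto simp: horn_simps)
    \<comment> \<open>Precomposition can only shrink the image, so the missed vertex stays
      missed.\<close>
    have "i \<notin> compose {0..l} x f ` {0..l}" using i(3) mono_mapsD(2)[OF f] by (force simp: compose_def)
    with i x f show "compose {0..l} x f \<in> ssimp (horn n j) l"
      by (auto simp: horn_simps intro: mono_maps_compose)
  qed (auto simp: horn_simps)
  have s: "simplex_part R n (std_simplex n)"
    by unfold_locales (auto intro: mono_maps_compose)
  show ?thesis
    by (intro simplex_parts.intro h s simplex_parts_axioms.intro) (auto simp: horn_simps)
qed

lemma templicial_module_locale:
  assumes "cring R" "templicial_module R X"
  shows "templicial R X"
proof -
  interpret cring R by fact
  show ?thesis
    by (intro templicial.intro linear_templicial.intro linear_templicial_axioms.intro quiver_tensors.intro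
        templicial_axioms.intro is_cring)
      (use assms(2) in \<open>simp_all add: templicial_module_def Let_def\<close>)
qed

lemma naF_structure_locale:
  assumes "cring R" "templicial_module R X" "naF_structure R X Z"
  shows "naF_templicial R X Z"
  by (intro naF_templicial.intro naF_templicial_axioms.intro templicial_module_locale assms(1,2))
    (use assms(3) in \<open>simp_all add: naF_structure_def Let_def\<close>)

context simplex_part
begin

text \<open>Joints with values 0 and \<open>n\<close> only leave room for a single bead that is not
  constant. It runs from 0 to \<open>n\<close>, and as a simplex of the horn it misses a vertex
  other than \<open>j\<close>, which is therefore inner.\<close>

lemma beads_in_horn_cases:
  assumes K: "\<And>m x. x \<in> ssimp K m \<Longrightarrow> \<exists>i\<le>n. i \<noteq> j \<and> i \<notin> x ` {0..m}" and n: "0 < n"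
    and "(T, q) \<in> necklaces" "beads_in (gaps T) f" "f 0 = 0" "f q = n" "\<And>t. t \<in> T \<Longrightarrow> f t = 0 \<or> f t = n"
  shows "\<exists>i. 0 < i \<and> i < n \<and> i \<noteq> j \<and> i \<notin> f ` {0..q}"
  using assms(3-)
proof (induction T q arbitrary: f rule: necklace_induct)
  case zero
  then show ?case using n by simp
next
  case (join m T q)
  note b = join.prems(1)
  have mono: "f u \<le> f v" if "u \<le> v" "v \<le> m + q" for u v
    using beads_in_mono[OF b that(1)] that(2) sum_list_gaps[OF necklace_insert[OF join.hyps(2), of m]] by simp
  have b': "restrict f {0..m} \<in> ssimp K m" "beads_in (gaps T) (\<lambda>i. f (m + i))"
    using b by (simp_all add: gaps_insert[OF join.hyps(2,1)])
  have "m + 0 \<in> (+) m ` T" using join.hyps(2) unfolding necklaces_iff by blast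
  then have fm: "f m = 0 \<or> f m = n" using join.prems(4)[of m] by simp
  then show ?case
  proof
    \<comment> \<open>The first bead is constantly 0, so a positive vertex missed by the remaining
      beads is missed altogether.\<close>
    assume 0: "f m = 0"
    have "\<exists>i. 0 < i \<and> i < n \<and> i \<noteq> j \<and> i \<notin> (\<lambda>i. f (m + i)) ` {0..q}"
      using join.prems 0 by (intro join.IH b'(2)) auto
    then obtain i where i: "0 < i" "i < n" "i \<noteq> j" "i \<notin> (\<lambda>i. f (m + i)) ` {0..q}" by blast
    have "i \<noteq> f u" if "u \<le> m + q" for u
    proof (cases "u \<le> m")
      case True
      then show ?thesis using mono[of u m] 0 i(1) by auto
    next
      case False
      then have "f u = (\<lambda>i. f (m + i)) (u - m)" "u - m \<in> {0..q}" using that by auto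
      then show ?thesis using i(4) by blast
    qed
    then have "i \<notin> f ` {0..m + q}" by (auto simp: image_iff)
    with i(1-3) show ?thesis by blast
  next
    \<comment> \<open>The first bead takes both values 0 and \<open>n\<close>, so the vertex it
      misses is neither; everything after it is constantly \<open>n\<close>.\<close>
    assume fn: "f m = n"
    obtain i where i: "i \<le> n" "i \<noteq> j" "i \<notin> restrict f {0..m} ` {0..m}" using K[OF b'(1)] by blast
    have i': "f u \<noteq> i" if "u \<le> m" for u using i(3) that by auto
    have "i \<noteq> 0" "i \<noteq> n" using i'[of 0] i'[of m] join.prems(2) fn by auto
    moreover have "i \<noteq> f u" if "u \<le> m + q" for u
    proof (cases "u \<le> m")
      case True
      then show ?thesis using i' by metis
    next
      case False
      then have "f u = n" using mono[of m u] mono[of u "m + q"] that fn join.prems(3) by simp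
      then show ?thesis using \<open>i \<noteq> n\<close> by simp
    qed
    then have "i \<notin> f ` {0..m + q}" by (auto simp: image_iff)
    ultimately show ?thesis using i(1,2) by (intro exI[of _ i] conjI) simp_all
  qed
qed

end

text \<open>As \<open>i\<close> is skipped, lowering all larger values by one undoes the coface. The
  ends are respected because \<open>i\<close> is inner.\<close>

lemma coface_factor:
  assumes f: "f \<in> fint_maps q (Suc p)" and i: "0 < i" "i \<le> p" "i \<notin> f ` {0..q}"
  obtains g where "g \<in> fint_maps q p" "compose {0..q} (coface p i) g = f"
proof
  let ?g = "\<lambda>t\<in>{0..q}. if f t < i then f t else f t - 1"
  note fD = fint_mapsD[OF f]
  have ne: "f t \<noteq> i" if "t \<le> q" for t using i(3) that by auto
  show "?g \<in> fint_maps q p"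
  proof (rule fint_mapsI)
    fix s t assume "s \<le> t" "t \<le> q"
    then show "?g s \<le> ?g t" using fD(3)[of s t] ne[of t] by auto
  qed (use fD i in auto)
  show "compose {0..q} (coface p i) ?g = f"
  proof
    fix t
    show "compose {0..q} (coface p i) ?g t = f t"
      using fD(4)[of t] fD(5)[of t] ne[of t] i by (auto simp: compose_def coface_def)
  qed
qed

section \<open>Extension of a transformation from the horn to the simplex\<close>

context naF_templicial
begin

lemma horn_extension:
  assumes a: "a \<in> tverts X" and b: "b \<in> tverts X" and j: "0 < j" "j < Suc p"
    and \<alpha>: "necklace_nat_trans R
      (necklace_functor R (free_templicial R (horn (Suc p) j)) (std_vertex 0) (std_vertex (Suc p)))
      (necklace_functor R X a b) \<alpha>"
  shows "\<exists>\<beta>. necklace_nat_trans R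
      (necklace_functor R (free_templicial R (std_simplex (Suc p))) (std_vertex 0) (std_vertex (Suc p)))
      (necklace_functor R X a b) \<beta> \<and>
    (\<forall>A\<in>necklaces. \<forall>u\<in>carrier (nobj (necklace_functor R
        (free_templicial R (horn (Suc p) j)) (std_vertex 0) (std_vertex (Suc p))) A).
      \<beta> A (free_necklace_map R (std_simplex (Suc p)) (\<lambda>m x. x) A (std_vertex 0) (std_vertex (Suc p)) u) = \<alpha> A u)"
proof -
  let ?n = "Suc p"
  interpret P: simplex_parts R ?n "horn ?n j" "std_simplex ?n"
    by (rule simplex_parts_horn[OF is_cring])
  let ?H = "necklace_functor R P.K.F (std_vertex 0) (std_vertex ?n)"
  let ?D = "necklace_functor R P.L.F (std_vertex 0) (std_vertex ?n)"
  let ?Y = "necklace_functor R X a b"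
  let ?h = "\<lambda>T f. P.K.bvec (gaps T) f" and ?d = "\<lambda>T f. P.L.bvec (gaps T) f"
  let ?id = "\<lambda>i\<in>{0..?n}. i"
  \<comment> \<open>Both end vertices belong to the horn: 0 misses \<open>n\<close> and
    \<open>n\<close> misses 0, and \<open>j\<close> is neither of them.\<close>
  have vK: "std_vertex 0 \<in> tverts P.K.F"
    unfolding P.K.F_verts horn_simps
    using j by (auto simp: std_vertex_def mono_maps_def mono_on_def intro!: exI[of _ ?n])
  have vL: "std_vertex 0 \<in> tverts P.L.F" using vK P.verts_sub by blast
  have vK': "std_vertex ?n \<in> tverts P.K.F"
    unfolding P.K.F_verts horn_simps
    using j by (auto simp: std_vertex_def mono_maps_def mono_on_def intro!: exI[of _ 0])
  have vL': "std_vertex ?n \<in> tverts P.L.F" using vK' P.verts_sub by blast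
  have \<alpha>lin: "\<alpha> (T, q) \<in> linear_maps R (nobj ?H (T, q)) (nobj ?Y (T, q))" if "(T, q) \<in> necklaces" for T q
    using \<alpha> that unfolding necklace_nat_trans_def by blast
  have hc: "?h U f \<in> carrier (nobj ?H (U, r))"
    if "(U, r) \<in> necklaces" "f \<in> fint_maps r ?n" "P.K.beads_in (gaps U) f" for U r f
    using P.K.bvec_closed[OF that(3)] fint_mapsD(1,2)[OF that(2)] sum_list_gaps[OF that(1)]
    by (simp add: necklace_functor_def)
  have dc: "?d U f \<in> carrier (nobj ?D (U, r))"
    if "(U, r) \<in> necklaces" "f \<in> fint_maps r ?n" "P.L.beads_in (gaps U) f" for U r f
    using P.L.bvec_closed[OF that(3)] fint_mapsD(1,2)[OF that(2)] sum_list_gaps[OF that(1)]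
    by (simp add: necklace_functor_def)
  have \<alpha>nat: "\<alpha> (T, q) (?h T (compose {0..q} f g)) = nmap ?Y (T, q) (U, r) g (\<alpha> (U, r) (?h U f))"
    if T: "(T, q) \<in> necklaces" and U: "(U, r) \<in> necklaces" and g: "g \<in> necklace_maps (T, q) (U, r)"
      and f: "f \<in> fint_maps r ?n" "P.K.beads_in (gaps U) f" for T q U r g f
  proof -
    have "nmap ?H (T, q) (U, r) g (?h U f) = ?h T (compose {0..q} f g)"
      using P.K.nm_bvec(1)[OF T U g f(2)] fint_mapsD(1,2)[OF f(1)] by simp
    moreover have "\<alpha> (T, q) (nmap ?H (T, q) (U, r) g (?h U f)) = nmap ?Y (T, q) (U, r) g (\<alpha> (U, r) (?h U f))"
      using \<alpha> T U g hc[OF U f] unfolding necklace_nat_trans_def by blast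
    ultimately show ?thesis by simp
  qed
  \<comment> \<open>The identity of [n] is not a simplex of the horn, but cut at an inner joint it
    is beaded there: the front bead misses \<open>n\<close>, the back bead misses 0, and
    \<open>j\<close> is inner.\<close>
  have bid: "P.K.beads_in (gaps {0, m, ?n}) ?id" if m: "0 < m" "m < ?n" for m
  proof -
    have "restrict ?id {0..m} \<in> ssimp (horn ?n j) m"
      unfolding horn_simps using m j by (auto intro!: mono_mapsI exI[of _ ?n])
    moreover have "restrict (\<lambda>i. ?id (m + i)) {0..?n - m} \<in> ssimp (horn ?n j) (?n - m)"
      unfolding horn_simps using m j by (auto intro!: mono_mapsI exI[of _ 0])
    moreover have "std_vertex (?id (m + (?n - m))) \<in> tverts P.K.F" using vK' m by simp
    ultimately show ?thesis unfolding gaps_three[OF m] P.K.beads_in.simps using m by (simp add: add.commute)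
  qed
  have p: "0 < p" using j by simp
  have bface: "P.K.beads_in (gaps {0, p}) (coface p i)" if i: "0 < i" "i \<le> p" "i \<noteq> j" for i
  proof -
    have "restrict (coface p i) {0..p} \<in> ssimp (horn ?n j) p"
      unfolding horn_simps
    proof
      show "restrict (coface p i) {0..p} \<in> mono_maps p ?n"
        using coface_fint[OF i(1,2)] fint_mapsD[OF coface_fint[OF i(1,2)]] by (intro mono_mapsI) auto
      show "\<exists>k\<le>?n. k \<noteq> j \<and> k \<notin> restrict (coface p i) {0..p} ` {0..p}"
        using i by (intro exI[of _ i]) (auto simp: coface_def split: if_splits)
    qed
    then show ?thesis unfolding gaps_two[OF p] P.K.beads_in_single .
  qed
  \<comment> \<open>\<open>w m\<close> is the value of \<open>\<alpha>\<close> at the identity cut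
    at \<open>m\<close>, and \<open>y i\<close> the value at the coface \<open>i\<close> taken as
    one bead, unwrapped to an element of degree \<open>p\<close>.\<close>
  define w where "w m = \<alpha> ({0, m, ?n}, ?n) (?h {0, m, ?n} ?id)" for m
  define y where "y i = qunwrap R (tverts X) (tsimp X p) a b (\<alpha> ({0, p}, p) (?h {0, p} (coface p i)))" for i
  have n3: "({0, m, ?n}, ?n) \<in> necklaces" if "m < ?n" for m using that by (auto simp: necklaces_iff)
  have n2: "({0, q}, q) \<in> necklaces" for q by (auto simp: necklaces_iff)
  have idc: "compose {0..q} ?id f = f" if "f \<in> fint_maps q ?n" for q f
    using fint_mapsD(4,5)[OF that] by (auto simp: compose_def fun_eq_iff)
  have wc: "w m \<in> carrier (nobj ?Y ({0, m, ?n}, ?n))" if "0 < m" "m < ?n" for m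
    unfolding w_def
    by (rule linear_maps_closed[OF \<alpha>lin[OF n3[OF that(2)]] hc[OF n3[OF that(2)] fint_maps_id bid[OF that]]])
  have yw: "spread a b {0, p} p (y i) = \<alpha> ({0, p}, p) (?h {0, p} (coface p i))"
    and yc: "y i \<in> carrier (tsimp X p a b)" if i: "0 < i" "i \<le> p" "i \<noteq> j" for i
  proof -
    have "\<alpha> ({0, p}, p) (?h {0, p} (coface p i)) \<in> carrier (nobj ?Y ({0, p}, p))"
      by (rule linear_maps_closed[OF \<alpha>lin[OF n2] hc[OF n2 coface_fint[OF i(1,2)] bface[OF i]]])
    then have c: "\<alpha> ({0, p}, p) (?h {0, p} (coface p i)) \<in> carrier (qtens R (tverts X) [tsimp X p] a b)"
      by (simp add: obj_eq[OF a b] gaps_two[OF p])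
    show "y i \<in> carrier (tsimp X p a b)" unfolding y_def by (rule linear_maps_closed[OF qunwrap_tsimp[OF a b] c])
    show "spread a b {0, p} p (y i) = \<alpha> ({0, p}, p) (?h {0, p} (coface p i))"
      unfolding spread_two[OF a b p] y_def by (rule qwrap_qunwrap[OF tsimp_module a b c])
  qed
  \<comment> \<open>If a joint is mapped to the inner vertex \<open>k\<close>, the map factors
    through the identity cut at \<open>k\<close>, so \<open>w k\<close> determines the value of
    \<open>\<alpha>\<close>.\<close>
  have w_nat: "nmap ?Y (T, q) ({0, k, ?n}, ?n) g (w k) = \<alpha> (T, q) (?h T g)"
    if "(T, q) \<in> necklaces" "0 < k" "k < ?n" "g \<in> necklace_maps (T, q) ({0, k, ?n}, ?n)" for T q k g
  proof -
    have "g \<in> fint_maps q ?n" using that(4) by (simp add: necklace_maps_def)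
    then show ?thesis
      using \<alpha>nat[OF that(1) n3[OF that(3)] that(4) fint_maps_id bid[OF that(2,3)]] by (simp only: w_def idc)
  qed
  \<comment> \<open>Likewise \<open>y i\<close> determines the value at every map that factors
    through the coface \<open>i\<close>.\<close>
  have y_nat: "spread a b T q (tact X q p g a b (y i)) = \<alpha> (T, q) (?h T (compose {0..q} (coface p i) g))"
    if "(T, q) \<in> necklaces" "g \<in> fint_maps q p" and i: "0 < i" "i \<le> p" "i \<noteq> j" for T q g i
  proof -
    have g: "g \<in> necklace_maps (T, q) ({0, p}, p)"
      using that(1,2) fint_mapsD(1,2)[OF that(2)] by (force simp: necklace_maps_def necklaces_iff)
    show ?thesis
      using nm_spread[OF a b that(1) n2 g yc[OF i]] \<alpha>nat[OF that(1) n2 g coface_fint[OF i(1,2)] bface[OF i]]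
      by (simp add: yw[OF i])
  qed
  have "\<exists>x\<in>carrier (tsimp X ?n a b). \<forall>k. 0 < k \<and> k < ?n \<longrightarrow> spread a b {0, k, ?n} ?n x = w k"
  proof (rule wedge_filler[OF a b wc])
    fix k m assume km: "0 < k" "k < m" "m < ?n"
    have T: "({0, k, m, ?n}, ?n) \<in> necklaces" using km by (auto simp: necklaces_iff)
    have "?id \<in> necklace_maps ({0, k, m, ?n}, ?n) ({0, m, ?n}, ?n)"
      "?id \<in> necklace_maps ({0, k, m, ?n}, ?n) ({0, k, ?n}, ?n)"
      using fint_maps_id[of ?n] km by (auto simp: necklace_maps_def)
    \<comment> \<open>Both sides are the value of \<open>\<alpha>\<close> at the identity cut at
      \<open>k\<close> and \<open>m\<close>.\<close>
    then show "nmap ?Y ({0, k, m, ?n}, ?n) ({0, m, ?n}, ?n) ?id (w m) = nmap ?Y ({0, k, m, ?n}, ?n) ({0, k, ?n}, ?n) ?id (w k)"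
      using w_nat[OF T, of m ?id] w_nat[OF T, of k ?id] km by simp
  qed simp_all
  then obtain x0 where x0: "wedge_fill a b p w x0" unfolding wedge_fill_def less_Suc_eq_le by blast
  have "\<exists>x. wedge_fill a b p w x \<and> (\<forall>i. 0 < i \<and> i \<le> p \<and> i \<noteq> j \<longrightarrow> tact X p (Suc p) (coface p i) a b x = y i)"
  proof (rule face_filler[OF a b j yc _ _ x0])
    fix i k assume i: "0 < i" "i \<le> p" "i \<noteq> j" and k: "0 < k" "k < p"
    let ?k = "coface p i k"
    have k': "0 < ?k" "?k < ?n" using k by (auto simp: coface_def)
    have T: "({0, k, p}, p) \<in> necklaces" using k by (auto simp: necklaces_iff)
    have f: "coface p i \<in> necklace_maps ({0, k, p}, p) ({0, ?k, ?n}, ?n)"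
      using coface_fint[OF i(1,2)] fint_mapsD(1,2)[OF coface_fint[OF i(1,2)]] by (auto simp: necklace_maps_def)
    have "compose {0..p} (coface p i) (\<lambda>i\<in>{0..p}. i) = coface p i"
      by (auto simp: compose_def coface_def fun_eq_iff)
    \<comment> \<open>Both sides are the value of \<open>\<alpha>\<close> at the coface
      \<open>i\<close> cut at \<open>k\<close>, computed from the face on the left and from the
      wedge on the right.\<close>
    then show "spread a b {0, k, p} p (y i) = nmap ?Y ({0, k, p}, p) ({0, ?k, ?n}, ?n) (coface p i) (w ?k)"
      using y_nat[OF T fint_maps_id i] tact_id[OF a b yc[OF i]] w_nat[OF T k' f] by simp
  next
    fix i l assume il: "0 < i" "i < l" "l \<le> p" "i \<noteq> j" "l \<noteq> j"
    then obtain q where q: "p = Suc q" "0 < q" by (cases p) auto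
    have c1: "coface q i \<in> fint_maps q p" "coface q (l - 1) \<in> fint_maps q p"
      using il coface_fint[of i q] coface_fint[of "l - 1" q] by (auto simp: q)
    \<comment> \<open>By \<open>coface_coface\<close> the two iterated faces belong to the same map.
      Since \<open>q\<close> is positive, \<open>{0, q}\<close> is a single bead, where
      \<open>spread\<close> is the injective map \<open>qwrap\<close>.\<close>
    have "spread a b {0, q} q (tact X q p (coface q i) a b (y l)) = spread a b {0, q} q (tact X q p (coface q (l - 1)) a b (y i))"
      using y_nat[OF n2 c1(1), of l] y_nat[OF n2 c1(2), of i] coface_coface[of i l q] il by (simp add: q)
    then have "qwrap R (tverts X) (tsimp X q) a b (tact X q p (coface q i) a b (y l))
      = qwrap R (tverts X) (tsimp X q) a b (tact X q p (coface q (l - 1)) a b (y i))"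
      by (simp add: spread_two[OF a b q(2)])
    moreover have "tact X q p (coface q i) a b (y l) \<in> carrier (tsimp X q a b)"
      "tact X q p (coface q (l - 1)) a b (y i) \<in> carrier (tsimp X q a b)"
      using il c1 yc linear_maps_closed[OF tact_linear[OF _ a b]] by auto
    ultimately have "tact X q p (coface q i) a b (y l) = tact X q p (coface q (l - 1)) a b (y i)"
      using qunwrap_qwrap_tsimp[OF a b] by metis
    then show "tact X (p - 1) p (coface (p - 1) i) a b (y l) = tact X (p - 1) p (coface (p - 1) (l - 1)) a b (y i)"
      by (simp add: q)
  qed
  then obtain x where x: "x \<in> carrier (tsimp X ?n a b)"
    and xw: "\<And>k. \<lbrakk>0 < k; k < ?n\<rbrakk> \<Longrightarrow> spread a b {0, k, ?n} ?n x = w k"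
    and xy: "\<And>i. \<lbrakk>0 < i; i \<le> p; i \<noteq> j\<rbrakk> \<Longrightarrow> tact X p ?n (coface p i) a b x = y i"
    by (auto simp: wedge_fill_def)
  have ac: "tact X q ?n f a b x \<in> carrier (tsimp X q a b)" if "f \<in> fint_maps q ?n" for q f
    by (rule linear_maps_closed[OF tact_linear[OF that a b] x])
  \<comment> \<open>Freeness allows any values on basis vectors. Those chosen here are the ones that
    \<open>x\<close> represents, so naturality follows from \<open>nm_spread\<close> and
    functoriality of the action.\<close>
  have "\<exists>\<beta>. \<forall>A\<in>necklaces. \<beta> A \<in> linear_maps R (nobj ?D A) (nobj ?Y A) \<and>
      (\<forall>f\<in>fint_maps (snd A) ?n. P.L.beads_in (gaps (fst A)) f \<longrightarrow>
        \<beta> A (?d (fst A) f) = spread a b (fst A) (snd A) (tact X (snd A) ?n f a b x))"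
  proof (rule bchoice, rule ballI)
    fix A :: necklace assume A: "A \<in> necklaces"
    obtain T q where Tq: "A = (T, q)" by (cases A)
    have T: "(T, q) \<in> necklaces" using A Tq by simp
    have "spread a b T q (tact X q ?n f a b x) \<in> carrier (nobj ?Y (T, q))" if "f \<in> fint_maps q ?n" for f
      by (rule linear_maps_closed[OF spread_linear[OF a b T] ac[OF that]])
    from P.L.necklace_free[where c = "\<lambda>f. spread a b T q (tact X q ?n f a b x)", OF obj_module[OF a b] T vL this]
    show "\<exists>\<beta>. \<beta> \<in> linear_maps R (nobj ?D A) (nobj ?Y A) \<and>
      (\<forall>f\<in>fint_maps (snd A) ?n. P.L.beads_in (gaps (fst A)) f \<longrightarrow>
        \<beta> (?d (fst A) f) = spread a b (fst A) (snd A) (tact X (snd A) ?n f a b x))"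
      unfolding Tq by auto
  qed
  then obtain \<beta> where \<beta>: "\<And>T q. (T, q) \<in> necklaces \<Longrightarrow> \<beta> (T, q) \<in> linear_maps R (nobj ?D (T, q)) (nobj ?Y (T, q))"
    and \<beta>d: "\<And>T q f. \<lbrakk>(T, q) \<in> necklaces; f \<in> fint_maps q ?n; P.L.beads_in (gaps T) f\<rbrakk>
      \<Longrightarrow> \<beta> (T, q) (?d T f) = spread a b T q (tact X q ?n f a b x)"
    by fastforce
  have nat: "\<beta> (T, q) (nmap ?D (T, q) (U, r) g u) = nmap ?Y (T, q) (U, r) g (\<beta> (U, r) u)"
    if T: "(T, q) \<in> necklaces" and U: "(U, r) \<in> necklaces" and g: "g \<in> necklace_maps (T, q) (U, r)"
      and u: "u \<in> carrier (nobj ?D (U, r))" for T q U r g u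
  proof (rule P.L.necklace_ext[OF obj_module[OF a b] U vL
        linear_maps_comp[OF P.L.nm_linear[OF vL vL' T U g] \<beta>[OF T]]
        linear_maps_comp[OF \<beta>[OF U] nm_linear[OF a b T U g]] _ u])
    fix f assume f: "f \<in> fint_maps r ?n" "P.L.beads_in (gaps U) f"
    have g': "g \<in> fint_maps q r" using g by (simp add: necklace_maps_def)
    have "nmap ?D (T, q) (U, r) g (?d U f) = ?d T (compose {0..q} f g)"
      using P.L.nm_bvec(1)[OF T U g f(2)] fint_mapsD(1,2)[OF f(1)] by simp
    then have "\<beta> (T, q) (nmap ?D (T, q) (U, r) g (?d U f)) = spread a b T q (tact X q ?n (compose {0..q} f g) a b x)"
      using \<beta>d[OF T fint_maps_compose[OF g' f(1)] P.L.nm_bvec(2)[OF T U g f(2)]] by simp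
    also have "\<dots> = nmap ?Y (T, q) (U, r) g (\<beta> (U, r) (?d U f))"
      using nm_spread[OF a b T U g ac[OF f(1)]] tact_comp[OF g' f(1) a b x] \<beta>d[OF U f] by simp
    finally show "\<beta> (T, q) (nmap ?D (T, q) (U, r) g (?d U f)) = nmap ?Y (T, q) (U, r) g (\<beta> (U, r) (?d U f))" .
  qed
  have ext: "\<beta> (T, q) (free_necklace_map R (std_simplex ?n) (\<lambda>m x. x) (T, q) (std_vertex 0) (std_vertex ?n) u) = \<alpha> (T, q) u"
    if T: "(T, q) \<in> necklaces" and u: "u \<in> carrier (nobj ?H (T, q))" for T q u
  proof (rule P.K.necklace_ext[OF obj_module[OF a b] T vK
        linear_maps_comp[OF P.necklace_map_linear[OF vK] \<beta>[OF T]] \<alpha>lin[OF T] _ u])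
    fix f assume f: "f \<in> fint_maps q ?n" "P.K.beads_in (gaps T) f"
    have "\<beta> (T, q) (free_necklace_map R (std_simplex ?n) (\<lambda>m x. x) (T, q) (std_vertex 0) (std_vertex ?n) (?h T f))
      = spread a b T q (tact X q ?n f a b x)"
      using P.necklace_map_bvec[OF T f(2)] \<beta>d[OF T f(1) P.beads_in_sub[OF f(2)]] fint_mapsD(1,2)[OF f(1)] by simp
    also have "\<dots> = \<alpha> (T, q) (?h T f)"
    \<comment> \<open>A joint with an inner value reduces the claim to the wedge data. Otherwise
      \<open>beads_in_horn_cases\<close> yields an inner vertex that \<open>f\<close> misses, and
      the claim reduces to a face of \<open>x\<close>.\<close>
    proof (cases "\<exists>t\<in>T. 0 < f t \<and> f t < ?n")
      case True
      then obtain t where t: "t \<in> T" "0 < f t" "f t < ?n" by blast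
      have g: "f \<in> necklace_maps (T, q) ({0, f t, ?n}, ?n)"
        using f(1) t(1) T fint_mapsD(1,2)[OF f(1)] by (force simp: necklace_maps_def necklaces_iff)
      show ?thesis
        using nm_spread[OF a b T n3[OF t(3)] g x] w_nat[OF T t(2,3) g] xw[OF t(2,3)] by simp
    next
      case False
      have "\<exists>i. 0 < i \<and> i < ?n \<and> i \<noteq> j \<and> i \<notin> f ` {0..q}"
      proof (rule P.K.beads_in_horn_cases[OF _ _ T f(2) fint_mapsD(1,2)[OF f(1)]])
        show "f t = 0 \<or> f t = ?n" if "t \<in> T" for t
          using False that fint_mapsD(4)[OF f(1), of t] T by (fastforce simp: necklaces_iff)
      qed (auto simp: horn_simps)
      then obtain i where i: "0 < i" "i \<le> p" "i \<noteq> j" "i \<notin> f ` {0..q}" by auto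
      obtain g where g: "g \<in> fint_maps q p" "compose {0..q} (coface p i) g = f"
        using coface_factor[OF f(1) i(1,2,4)] by metis
      show ?thesis
        using y_nat[OF T g(1) i(1-3)] xy[OF i(1-3)] tact_comp[OF g(1) coface_fint[OF i(1,2)] a b x] by (simp add: g(2))
    qed
    finally show "\<beta> (T, q) (free_necklace_map R (std_simplex ?n) (\<lambda>m x. x) (T, q) (std_vertex 0) (std_vertex ?n) (?h T f))
      = \<alpha> (T, q) (?h T f)" .
  qed
  show ?thesis
    using \<beta> nat ext by (intro exI[of _ \<beta>]) (auto simp: necklace_nat_trans_def)
qed

end

theorem theorem4p14:
  fixes R :: "('k, 'z) ring_scheme"
    and X :: "('k, 's, 'm) templicial"
    and Z :: "('k, 's, 'm) naF_data"
  assumes "cring R"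
    and "templicial_module R X"
    and "naF_structure R X Z"
  shows "quasi_category_in_modules R X"
proof -
  interpret naF_templicial R X Z by (rule naF_structure_locale[OF assms])
  show ?thesis
    unfolding quasi_category_in_modules_def lifts_inner_horns_def
  proof (intro ballI allI impI)
    fix a b j n \<alpha>
    assume ab: "a \<in> tverts X" "b \<in> tverts X" and j: "0 < j \<and> j < n"
      and \<alpha>: "necklace_nat_trans R (necklace_functor R (free_templicial R (horn n j)) (std_vertex 0) (std_vertex n))
        (necklace_functor R X a b) \<alpha>"
    obtain p where n: "n = Suc p" using j by (cases n) auto
    from horn_extension[OF ab _ _ \<alpha>[unfolded n]] j
    show "\<exists>\<beta>. necklace_nat_trans R
        (necklace_functor R (free_templicial R (std_simplex n)) (std_vertex 0) (std_vertex n)) (necklace_functor R X a b) \<beta> \<and>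
      (\<forall>A\<in>necklaces. \<forall>u\<in>carrier (nobj (necklace_functor R
          (free_templicial R (horn n j)) (std_vertex 0) (std_vertex n)) A).
        \<beta> A (free_necklace_map R (std_simplex n) (\<lambda>m x. x) A (std_vertex 0) (std_vertex n) u) = \<alpha> A u)"
      unfolding n by blast
  qed
qed

end
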